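(* Let $0<\alpha<\tfrac12$. Let $V_{\alpha,\flat}=\{(x,y)\in V_\alpha: x\le1\}$, and let $\hat F_{\alpha,\flat}$ and $F_{\alpha,\flat}$ be the maps defined in the context. Let $\mu_{\alpha,\flat}$ be the measure on $V_{\alpha,\flat}$ with density $\dfrac{dx\,dy}{(x-y)^2}$ and let $\nu_{\alpha,\flat}$ be the projection of $\mu_{\alpha,\flat}$ to the first coordinate. Then $\mu_{\alpha,\flat}$ is $\hat F_{\alpha,\flat}$-invariant and the dynamical system $(V_{\alpha,\flat},\hat F_{\alpha,\flat},\mu_{\alpha,\flat})$ is a representation of the natural extension of $([\alpha-1,1],F_{\alpha,\flat},\nu_{\alpha,\flat})$.
   Context: Sets and maps are considered up to Lebesgue null sets. The measures may be infinite ($\sigma$-finite). Natural extension: $(V,\hat F,\mu)$ represents the natural extension of $(I,F,\nu)$ via the first-coordinate projection $\pi_1$ if $\hat F$ is bijective on $V$ up to null sets and preserves $\mu$, $\pi_1\circ\hat F=F\circ\pi_1$ a.e., $\nu=\mu\circ\pi_1^{-1}$, and the Borel $\sigma$-algebra of $V$ is, modulo null sets, generated by $\bigvee_{n\ge 0}\hat F^{n}\pi_1^{-1}\mathcal B(I)$. The map $F_{\alpha,\flat}$ on $[\alpha-1,1]$: $F_{\alpha,\flat}(x)=-\frac{1+2x}{x}$ if $\alpha-1\le x<-\frac12$; $-\frac{x}{1+x}$ if $-\frac12\le x<0$; $\frac{x}{1-x}$ if $0\le x<\frac12$; $\frac{1-2x}{x}$ if $\frac12\le x<\frac1{1+\alpha}$;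 $\frac{1-x}{x}$ if $\frac1{1+\alpha}\le x\le1$. The planar map $\hat F_{\alpha,\flat}(x,y)$ applies to both coordinates the same linear fractional transformation, selected by $x$: $\left(-\frac{1+2x}{x},-\frac{1+2y}{y}\right)$ if $\alpha-1\le x<-\frac12$; $\left(-\frac{x}{1+x},-\frac{y}{1+y}\right)$ if $-\frac12\le x<0$; $\left(\frac{x}{1-x},\frac{y}{1-y}\right)$ if $0\le x<\frac12$; $\left(\frac{1-2x}{x},\frac{1-2y}{y}\right)$ if $\frac12\le x\le\frac1{1+\alpha}$; $\left(\frac{1-x}{x},\frac{1-y}{y}\right)$ if $\frac1{1+\alpha}<x\le1$. (Usual conventions at $y=-\infty$.) The domain $\Omega_\alpha$: for $x\in[\alpha-1,\alpha)$, $x\ne0$, put $b(x)=\lfloor \frac1{|x|}+1-\alpha\rfloor$ and let $\hat G_\alpha(x,y)=\left(-\frac1x-b(x),\frac1{b(x)-y}\right)$ for $x<0$ and $\hat G_\alpha(x,y)=\left(\frac1x-b(x),\frac1{b(x)+y}\right)$ for $x>0$. $\Omega_\alpha\subset[\alpha-1,\alpha]\times[0,1]$ is the closure of $\{\hat G_\alpha^n(x,0): x\in[\alpha-1,\alpha),\ n\ge0\}$ (over all $n$ for which the iterate is defined). (It is known that $\hat G_\alpha$ is bijective on $\Omega_\alpha$ up to null sets and is a natural extension of the $\alpha$-continued fraction map.) Put $\Omega_\alpha^*=\{(x,y):(x,-\frac1y)\in\Omega_\alpha\}$. Let $k_0$ be the integer with $\frac1{k_0+\alpha}\le\alpha<\frac1{k_0-1+\alpha}$.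 Cylinders: $\Omega^*_{\alpha,k_0,+}=\{(x,y)\in\Omega^*_\alpha:\frac1{k_0+\alpha}<x<\alpha\}$; $\Omega^*_{\alpha,k,+}=\{(x,y)\in\Omega^*_\alpha:\frac1{k+\alpha}<x\le\frac1{k-1+\alpha}\}$ for $k>k_0$; $\Omega^*_{\alpha,k,+}=\emptyset$ for $2\le k<k_0$; $\Omega^*_{\alpha,2,-}=\{(x,y)\in\Omega^*_\alpha:\alpha-1<x\le-\frac1{2+\alpha}\}$; $\Omega^*_{\alpha,k,-}=\{(x,y)\in\Omega^*_\alpha:-\frac1{k-1+\alpha}<x\le-\frac1{k+\alpha}\}$ for $k\ge3$. Put $\hat\Omega_{\alpha,k,-}=\{(x,y):(-\frac1x,-\frac1y)\in\Omega^*_{\alpha,k,-}\}$ and $\hat\Omega_{\alpha,k,+}=\{(x,y):(\frac1x,\frac1y)\in\Omega^*_{\alpha,k,+}\}$. For $j\ge1$ put $$\Upsilon_{\alpha,j}=\bigcup_{k\ge j+1}\big(\hat\Omega_{\alpha,k,-}-(k-j,k-j)\big)\cup\bigcup_{k\ge j+1}\big(\hat\Omega_{\alpha,k,+}-(k-j,k-j)\big),$$ $\Upsilon_\alpha=\bigcup_{j\ge1}\Upsilon_{\alpha,j}$, $(\Upsilon_\alpha)^{-1}=\{(x,y):(\frac1x,\frac1y)\in\Upsilon_\alpha\}$, and $V_\alpha=\Omega^*_\alpha\cup(\Upsilon_\alpha)^{-1}$. *)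

theory Defs
  imports "HOL-Analysis.Analysis"
begin

text \<open>
  Systems considered up to null sets. A map on (the space of) a measure \<open>M\<close> is a total function on the
  underlying type that need only send almost every point of \<^term>\<open>space M\<close> back into \<^term>\<open>space M\<close>.
\<close>

text \<open>
  This is \<open>T \<in> measurable M M \<and> distr M M T = M\<close>, except that \<open>T\<close> may leave \<^term>\<open>space M\<close> on a null set.
\<close>

definition invariant_measure :: "'a measure \<Rightarrow> ('a \<Rightarrow> 'a) \<Rightarrow> bool" where
  "invariant_measure M T \<longleftrightarrow>
     (AE z in M. T z \<in> space M) \<and>
     (\<forall>A\<in>sets M. T -` A \<inter> space M \<in> sets M \<and> emeasure M (T -` A \<inter> space M) = emeasure M A)"

definition bij_mod_null :: "'a measure \<Rightarrow> ('a \<Rightarrow> 'a) \<Rightarrow> bool" where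
  "bij_mod_null M T \<longleftrightarrow>
     (\<exists>N\<in>null_sets M. \<exists>N'\<in>null_sets M. bij_betw T (space M - N) (space M - N'))"

definition eq_mod_null :: "'a measure \<Rightarrow> 'a set set \<Rightarrow> 'a set set \<Rightarrow> bool" where
  "eq_mod_null M \<A> \<B> \<longleftrightarrow>
     (\<forall>A\<in>\<A>. \<exists>B\<in>\<B>. sym_diff A B \<in> null_sets M) \<and>
     (\<forall>B\<in>\<B>. \<exists>A\<in>\<A>. sym_diff A B \<in> null_sets M)"

definition join_forward_images :: "('a \<Rightarrow> 'b) \<Rightarrow> 'a measure \<Rightarrow> ('a \<Rightarrow> 'a) \<Rightarrow> 'b measure \<Rightarrow> 'a set set" where
  "join_forward_images p M T N =
     sigma_sets (space M)
       (\<Union>n::nat. {(T ^^ n) ` (p -` B \<inter> space M) \<inter> space M | B. B \<in> sets N})"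

definition represents_natural_extension ::
    "('a \<Rightarrow> 'b) \<Rightarrow> 'a measure \<Rightarrow> ('a \<Rightarrow> 'a) \<Rightarrow> 'b measure \<Rightarrow> ('b \<Rightarrow> 'b) \<Rightarrow> bool" where
  "represents_natural_extension p M T N S \<longleftrightarrow>
     sigma_finite_measure M \<and> sigma_finite_measure N \<and>
     S \<in> measurable N N \<and>
     bij_mod_null M T \<and> invariant_measure M T \<and>
     (AE z in M. p (T z) = S (p z)) \<and>
     p \<in> measurable M N \<and> N = distr M N p \<and>
     eq_mod_null M (sets M) (join_forward_images p M T N)"


text \<open>Both maps are only used for first coordinates in \<open>[\<alpha> - 1, 1]\<close>.\<close>

definition F_flat :: "real \<Rightarrow> real \<Rightarrow> real" where
  "F_flat \<alpha> x =
     (if x < - 1/2 then - ((1 + 2*x) / x)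
      else if x < 0 then - (x / (1 + x))
      else if x < 1/2 then x / (1 - x)
      else if x < 1 / (1 + \<alpha>) then (1 - 2*x) / x
      else (1 - x) / x)"

text \<open>
  The second coordinate ranges over finite reals; the singular lines \<open>y \<in> {0, -1, 1}\<close> are null,
  so the value of \<open>x / 0\<close> there is irrelevant.
\<close>

definition Fhat_flat :: "real \<Rightarrow> real \<times> real \<Rightarrow> real \<times> real" where
  "Fhat_flat \<alpha> = (\<lambda>(x, y).
     (if x < - 1/2 then (- ((1 + 2*x) / x), - ((1 + 2*y) / y))
      else if x < 0 then (- (x / (1 + x)), - (y / (1 + y)))
      else if x < 1/2 then (x / (1 - x), y / (1 - y))
      else if x \<le> 1 / (1 + \<alpha>) then ((1 - 2*x) / x, (1 - 2*y) / y)
      else ((1 - x) / x, (1 - y) / y)))"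


definition cf_digit :: "real \<Rightarrow> real \<Rightarrow> int" where
  "cf_digit \<alpha> x = \<lfloor>1 / \<bar>x\<bar> + 1 - \<alpha>\<rfloor>"

text \<open>Undefined at \<open>x = 0\<close>; the guard in \<open>Omega\<close> below never evaluates it there.\<close>

definition Ghat :: "real \<Rightarrow> real \<times> real \<Rightarrow> real \<times> real" where
  "Ghat \<alpha> = (\<lambda>(x, y).
     (if x < 0 then (- 1 / x - of_int (cf_digit \<alpha> x), 1 / (of_int (cf_digit \<alpha> x) - y))
      else (1 / x - of_int (cf_digit \<alpha> x), 1 / (of_int (cf_digit \<alpha> x) + y))))"

definition Omega :: "real \<Rightarrow> (real \<times> real) set" where
  "Omega \<alpha> = closure {(Ghat \<alpha> ^^ n) (x, 0) | n x.
     x \<in> {\<alpha> - 1..<\<alpha>} \<and> (\<forall>m<n. fst ((Ghat \<alpha> ^^ m) (x, 0)) \<noteq> 0)}"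

text \<open>The null set of points of \<open>Omega\<close> on the line \<open>y = 0\<close>, corresponding to \<open>y = -\<infinity>\<close>, is dropped.\<close>

definition Omega_star :: "real \<Rightarrow> (real \<times> real) set" where
  "Omega_star \<alpha> = {(x, y). y \<noteq> 0 \<and> (x, - 1 / y) \<in> Omega \<alpha>}"

definition k0 :: "real \<Rightarrow> int" where
  "k0 \<alpha> = (THE k::int. 1 / (of_int k + \<alpha>) \<le> \<alpha> \<and> \<alpha> < 1 / (of_int k - 1 + \<alpha>))"

definition Omega_star_pos :: "real \<Rightarrow> int \<Rightarrow> (real \<times> real) set" where
  "Omega_star_pos \<alpha> k =
     (if k = k0 \<alpha> then {(x, y) \<in> Omega_star \<alpha>. 1 / (of_int k + \<alpha>) < x \<and> x < \<alpha>}
      else if k > k0 \<alpha> then {(x, y) \<in> Omega_star \<alpha>. 1 / (of_int k + \<alpha>) < x \<and> x \<le> 1 / (of_int k - 1 + \<alpha>)}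
      else {})"

definition Omega_star_neg :: "real \<Rightarrow> int \<Rightarrow> (real \<times> real) set" where
  "Omega_star_neg \<alpha> k =
     (if k = 2 then {(x, y) \<in> Omega_star \<alpha>. \<alpha> - 1 < x \<and> x \<le> - 1 / (2 + \<alpha>)}
      else if k \<ge> 3 then {(x, y) \<in> Omega_star \<alpha>. - 1 / (of_int k - 1 + \<alpha>) < x \<and> x \<le> - 1 / (of_int k + \<alpha>)}
      else {})"

definition Omega_hat_neg :: "real \<Rightarrow> int \<Rightarrow> (real \<times> real) set" where
  "Omega_hat_neg \<alpha> k = {(x, y). (- 1 / x, - 1 / y) \<in> Omega_star_neg \<alpha> k}"

definition Omega_hat_pos :: "real \<Rightarrow> int \<Rightarrow> (real \<times> real) set" where
  "Omega_hat_pos \<alpha> k = {(x, y). (1 / x, 1 / y) \<in> Omega_star_pos \<alpha> k}"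

definition diag_shift :: "int \<Rightarrow> (real \<times> real) set \<Rightarrow> (real \<times> real) set" where
  "diag_shift c A = (\<lambda>(x, y). (x - of_int c, y - of_int c)) ` A"

definition Upsilon_level :: "real \<Rightarrow> int \<Rightarrow> (real \<times> real) set" where
  "Upsilon_level \<alpha> j =
     (\<Union>k\<in>{j + 1..}. diag_shift (k - j) (Omega_hat_neg \<alpha> k)) \<union>
     (\<Union>k\<in>{j + 1..}. diag_shift (k - j) (Omega_hat_pos \<alpha> k))"

definition Upsilon :: "real \<Rightarrow> (real \<times> real) set" where
  "Upsilon \<alpha> = (\<Union>j\<in>{1..}. Upsilon_level \<alpha> j)"

definition Upsilon_inv :: "real \<Rightarrow> (real \<times> real) set" where
  "Upsilon_inv \<alpha> = {(x, y). x \<noteq> 0 \<and> y \<noteq> 0 \<and> (1 / x, 1 / y) \<in> Upsilon \<alpha>}"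

definition V :: "real \<Rightarrow> (real \<times> real) set" where
  "V \<alpha> = Omega_star \<alpha> \<union> Upsilon_inv \<alpha>"

definition V_flat :: "real \<Rightarrow> (real \<times> real) set" where
  "V_flat \<alpha> = {(x, y) \<in> V \<alpha>. x \<le> 1}"

definition mu_flat :: "real \<Rightarrow> (real \<times> real) measure" where
  "mu_flat \<alpha> = density (restrict_space lborel (V_flat \<alpha>)) (\<lambda>(x, y). ennreal (1 / (x - y)\<^sup>2))"

definition nu_flat :: "real \<Rightarrow> real measure" where
  "nu_flat \<alpha> = distr (mu_flat \<alpha>) (restrict_space borel {\<alpha> - 1..1}) fst"

end

theory Submission
  imports Defs
begin

text \<open>
  On \<open>Omega_star\<close> the map \<open>Gstar\<close>, which is \<open>Ghat\<close> in the coordinate \<open>- 1 / y\<close>, is piecewise a Moebius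
  transformation acting on both coordinates, hence preserves \<open>dx dy / (x - y)\<^sup>2\<close>. Because \<open>Omega\<close> is the closure of
  an orbit, \<open>Gstar\<close> maps \<open>Omega_star\<close> into itself and, by compactness, onto itself up to null sets; since
  \<open>Omega_star\<close> has finite measure, \<open>Gstar\<close> is then also injective up to null sets. Subtracting the digit \<open>k\<close> of
  \<open>Gstar\<close> one unit at a time gives \<open>Fhat_flat\<close>, so that \<open>V_flat\<close> is a tower over \<open>Omega_star\<close> whose floors are the
  pieces of \<open>Upsilon_inv\<close>; every point of the tower determines where it returns to \<open>Omega_star\<close>, so the floors are
  disjoint and \<open>Fhat_flat\<close> is bijective. Finally, in a suitable fibre coordinate the branches of \<open>Fhat_flat\<close> are
  inverse branches of the Farey map, so the second coordinate of a point is determined by the first coordinates of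
  its past.
\<close>

section \<open>Piecewise automorphisms of a measure\<close>

text \<open>The conventions of HOL division shape the proof. Since \<open>1 / 0 = 0\<close>, every
  map \<open>s / t - k\<close> with \<open>s = 1\<close> or \<open>s = -1\<close> is a bijection of
  the whole real line, so the Moebius branches become Borel automorphisms of the plane with no poles
  to cut out. Forward images of Borel sets are then Borel, which matters because
  \<open>join_forward_images\<close> is built from images of all of \<open>V_flat\<close>, including
  its null remainder.

  The passage from onto to one-to-one needs finite measure. \<open>Omega_star\<close> has it because
  its ordinates are at most -1 and its abscissae at least \<alpha> - 1; the bounds for
  \<open>V_flat\<close> leave no such gap near the origin. Hence bijectivity is proved on the base
  and lifted through the tower. Each map is made bijective on one invariant Borel set,
  \<open>E\<close> or \<open>V_core\<close>, so that the whole past of a point is available there.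

  The Farey map enters because undoing one of its inverse branches turns p / q into p / (q - p) or q
  / (p - q), a step of the subtractive Euclidean algorithm. A bounded number of common past branches
  therefore prevents p / q from separating two fibre coordinates.\<close>

definition measure_aut :: "'a measure \<Rightarrow> ('a \<Rightarrow> 'a) \<Rightarrow> bool" where
  "measure_aut M f \<longleftrightarrow> bij f \<and> f \<in> measurable M M \<and> inv f \<in> measurable M M \<and> distr M M f = M"

lemma measure_autI:
  assumes "f \<in> measurable M M" "g \<in> measurable M M" "\<And>x. g (f x) = x" "\<And>x. f (g x) = x"
    and "distr M M f = M"
  shows "measure_aut M f"
proof -
  have "bij f" using assms(3,4) by (metis bijI')
  moreover have "inv f = g" using assms(3,4) by (metis ext inv_unique_comp comp_apply id_apply)
  ultimately show ?thesis using assms by (simp add: measure_aut_def)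
qed

lemma measure_aut_comp:
  assumes f: "measure_aut M f" and g: "measure_aut M g"
  shows "measure_aut M (f \<circ> g)"
proof -
  have "distr M M (f \<circ> g) = distr (distr M M g) M f"
    using f g by (subst distr_distr) (auto simp: measure_aut_def)
  also have "\<dots> = M" using f g by (simp add: measure_aut_def)
  finally have d: "distr M M (f \<circ> g) = M" .
  have "inv (f \<circ> g) = inv g \<circ> inv f" using f g by (simp add: measure_aut_def o_inv_distrib)
  moreover have "inv g \<circ> inv f \<in> measurable M M" using f g by (auto simp: measure_aut_def)
  ultimately show ?thesis using f g d by (auto simp: measure_aut_def bij_comp)
qed

lemma measure_aut_image:
  assumes f: "measure_aut M f" and sp: "space M = UNIV" and A: "A \<in> sets M"
  shows "f ` A \<in> sets M" "emeasure M (f ` A) = emeasure M A"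
proof -
  have "f ` A = inv f -` A \<inter> space M"
    using f sp by (auto simp: measure_aut_def bij_vimage_eq_inv_image bij_imp_bij_inv inv_inv_eq)
  then show *: "f ` A \<in> sets M" using f A by (auto simp: measure_aut_def measurable_sets)
  have "emeasure M (f ` A) = emeasure (distr M M f) (f ` A)" using f by (simp add: measure_aut_def)
  also have "\<dots> = emeasure M (f -` (f ` A) \<inter> space M)"
    using f * by (subst emeasure_distr) (auto simp: measure_aut_def)
  also have "f -` (f ` A) \<inter> space M = A"
    using f sp by (auto simp: measure_aut_def inj_vimage_image_eq bij_is_inj)
  finally show "emeasure M (f ` A) = emeasure M A" .
qed

lemma measure_aut_vimage:
  assumes f: "measure_aut M f" and sp: "space M = UNIV" and A: "A \<in> sets M"
  shows "f -` A \<in> sets M" "emeasure M (f -` A) = emeasure M A"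
proof -
  show *: "f -` A \<in> sets M" using f A sp by (metis measure_aut_def measurable_sets inf_top_right)
  have "f ` (f -` A) = A" using f by (simp add: measure_aut_def bij_is_surj)
  then show "emeasure M (f -` A) = emeasure M A"
    using measure_aut_image(2)[OF f sp *] by simp
qed

text \<open>Disjoint pieces make the measures of images add up. Asking for automorphisms of the
  whole space, and not for bijections between pieces, gives measurable images and preimages of
  arbitrary measurable subsets.\<close>

definition piecewise_aut :: "'a measure \<Rightarrow> ('a \<Rightarrow> 'a) \<Rightarrow> 'a set \<Rightarrow> bool" where
  "piecewise_aut M T D \<longleftrightarrow> (\<exists>(P :: nat \<Rightarrow> 'a set) \<phi>.
     (\<forall>i. P i \<in> sets M \<and> measure_aut M (\<phi> i) \<and> (\<forall>z\<in>P i. T z = \<phi> i z)) \<and>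
     disjoint_family P \<and> D = (\<Union>i. P i))"

lemma piecewise_autI:
  assumes "countable I" "I \<noteq> {}"
    and "\<And>i. i \<in> I \<Longrightarrow> P i \<in> sets M" "\<And>i. i \<in> I \<Longrightarrow> measure_aut M (\<phi> i)"
    and "\<And>i z. i \<in> I \<Longrightarrow> z \<in> P i \<Longrightarrow> T z = \<phi> i z"
    and "D = (\<Union>i\<in>I. P i)"
  shows "piecewise_aut M T D"
proof -
  define e where "e = from_nat_into I"
  have e: "range e = I" using assms(1,2) by (simp add: e_def range_from_nat_into)
  then have eI: "e n \<in> I" for n by auto
  let ?P = "disjointed (\<lambda>n. P (e n))"
  have "range (\<lambda>n. P (e n)) \<subseteq> sets M" using assms(3) eI by auto
  then have "range ?P \<subseteq> sets M" by (rule sets.range_disjointed_sets)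
  moreover have "?P n \<subseteq> P (e n)" for n by (rule disjointed_subset)
  moreover have "(\<Union>n. ?P n) = D"
    using assms(6) e UN_disjointed_eq[of "\<lambda>n. P (e n)"] by (metis image_image)
  moreover have "T z = \<phi> (e n) z" if "z \<in> ?P n" for n z
    using assms(5)[OF eI] calculation(2) that by blast
  ultimately show ?thesis unfolding piecewise_aut_def using assms(4)[OF eI]
    by (intro exI[of _ ?P] exI[of _ "\<lambda>n. \<phi> (e n)"] conjI disjoint_family_disjointed allI) auto
qed

lemma piecewise_aut_subset:
  assumes "piecewise_aut M T D" "E \<in> sets M" "E \<subseteq> D"
  shows "piecewise_aut M T E"
proof -
  from assms(1) obtain P \<phi> where P: "\<And>i::nat. P i \<in> sets M \<and> measure_aut M (\<phi> i) \<and> (\<forall>z\<in>P i. T z = \<phi> i z)"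
     "disjoint_family P" "D = (\<Union>i. P i)" unfolding piecewise_aut_def by blast
  show ?thesis unfolding piecewise_aut_def
  proof (intro exI[of _ "\<lambda>i. P i \<inter> E"] exI[of _ \<phi>] conjI allI)
    show "disjoint_family (\<lambda>i. P i \<inter> E)"
      using P(2) unfolding disjoint_family_on_def by blast
  qed (use P assms(2,3) in auto)
qed

lemma piecewise_aut_sets: "piecewise_aut M T D \<Longrightarrow> D \<in> sets M"
  by (auto simp: piecewise_aut_def)

lemma image_UN_piecewise:
  assumes "\<And>i z. z \<in> P i \<Longrightarrow> T z = \<phi> i z"
  shows "T ` (\<Union>i. P i) = (\<Union>i. \<phi> i ` P i)"
  unfolding image_UN using assms by (intro SUP_cong image_cong) auto

lemma piecewise_aut_image_sets:
  assumes "piecewise_aut M T D" and sp: "space M = UNIV"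
  shows "T ` D \<in> sets M"
proof -
  from assms(1) obtain P \<phi> where P: "\<And>i::nat. P i \<in> sets M" "\<And>i. measure_aut M (\<phi> i)"
     "\<And>i z. z\<in>P i \<Longrightarrow> T z = \<phi> i z" "D = (\<Union>i. P i)" unfolding piecewise_aut_def by metis
  have "T ` D = (\<Union>i. \<phi> i ` P i)" unfolding P(4) by (rule image_UN_piecewise[OF P(3)])
  then show ?thesis using P measure_aut_image(1)[OF _ sp] by auto
qed

lemma piecewise_aut_image_inj:
  assumes "piecewise_aut M T D" and sp: "space M = UNIV" and inj: "inj_on T D"
  shows "emeasure M (T ` D) = emeasure M D"
proof -
  from assms(1) obtain P \<phi> where P: "\<And>i::nat. P i \<in> sets M" "\<And>i. measure_aut M (\<phi> i)"
     "\<And>i z. z\<in>P i \<Longrightarrow> T z = \<phi> i z" "D = (\<Union>i. P i)" "disjoint_family P" unfolding piecewise_aut_def by metis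
  have im: "T ` P i = \<phi> i ` P i" for i using P(3) by auto
  have "disjoint_family (\<lambda>i. T ` P i)"
    unfolding disjoint_family_on_def
  proof (intro ballI impI)
    fix i j :: nat assume "i \<noteq> j"
    then have "P i \<inter> P j = {}" using P(5) by (auto simp: disjoint_family_on_def)
    then show "T ` P i \<inter> T ` P j = {}"
      using inj_on_image_Int[OF inj, of "P i" "P j"] P(4) by auto
  qed
  moreover have "range (\<lambda>i. T ` P i) \<subseteq> sets M" using im P measure_aut_image(1)[OF _ sp] by auto
  ultimately have "(\<Sum>i. emeasure M (T ` P i)) = emeasure M (\<Union>i. T ` P i)"
    by (intro suminf_emeasure)
  moreover have "(\<Sum>i. emeasure M (P i)) = emeasure M (\<Union>i. P i)"
    using P by (intro suminf_emeasure) auto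
  moreover have "emeasure M (T ` P i) = emeasure M (P i)" for i
    using im P measure_aut_image(2)[OF _ sp] by auto
  ultimately show ?thesis using P(4) by (simp add: image_UN)
qed

lemma piecewise_aut_image_null:
  assumes "piecewise_aut M T D" and sp: "space M = UNIV" and D: "D \<in> null_sets M"
  shows "T ` D \<in> null_sets M"
proof -
  from assms(1) obtain P \<phi> where P: "\<And>i::nat. P i \<in> sets M" "\<And>i. measure_aut M (\<phi> i)"
     "\<And>i z. z\<in>P i \<Longrightarrow> T z = \<phi> i z" "D = (\<Union>i. P i)" unfolding piecewise_aut_def by metis
  have "P i \<in> null_sets M" for i using P D by (auto intro: null_sets_subset)
  then have "\<phi> i ` P i \<in> null_sets M" for i
    using measure_aut_image[OF P(2) sp P(1)] by (auto simp: null_sets_def)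
  moreover have "T ` D = (\<Union>i. \<phi> i ` P i)" unfolding P(4) by (rule image_UN_piecewise[OF P(3)])
  ultimately show ?thesis by auto
qed

lemma piecewise_aut_vimage:
  assumes "piecewise_aut M T D" and sp: "space M = UNIV"
  shows "A \<in> sets M \<Longrightarrow> T -` A \<inter> D \<in> sets M"
    and "A \<in> null_sets M \<Longrightarrow> T -` A \<inter> D \<in> null_sets M"
proof -
  from assms(1) obtain P \<phi> where P: "\<And>i::nat. P i \<in> sets M" "\<And>i. measure_aut M (\<phi> i)"
     "\<And>i z. z\<in>P i \<Longrightarrow> T z = \<phi> i z" "D = (\<Union>i. P i)" unfolding piecewise_aut_def by metis
  have eq: "T -` A \<inter> D = (\<Union>i. \<phi> i -` A \<inter> P i)" for A using P(3,4) by auto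
  show "A \<in> sets M \<Longrightarrow> T -` A \<inter> D \<in> sets M"
    unfolding eq using P measure_aut_vimage(1)[OF _ sp] by auto
  assume "A \<in> null_sets M"
  then have "\<phi> i -` A \<in> null_sets M" for i
    using measure_aut_vimage[OF P(2) sp, of A i] by (auto simp: null_sets_def)
  then show "T -` A \<inter> D \<in> null_sets M"
    unfolding eq using P by (auto intro: null_set_Int2)
qed

text \<open>Replacing \<open>A i\<close> by \<open>A i - A j\<close> keeps the union and lowers the
  sum of the measures by that of the overlap. Countable subadditivity still bounds the lowered sum
  from below by the finite measure of the union, so the overlap must be null.\<close>

lemma null_Int_of_suminf_le_emeasure_UN:
  fixes A :: "nat \<Rightarrow> 'a set"
  assumes A: "\<And>n. A n \<in> sets M" and fin: "emeasure M (\<Union>n. A n) < \<infinity>"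
    and le: "(\<Sum>n. emeasure M (A n)) \<le> emeasure M (\<Union>n. A n)" and "i \<noteq> j"
  shows "A i \<inter> A j \<in> null_sets M"
proof -
  let ?B = "\<lambda>n. if n = i then A i - A j else A n"
  let ?x = "emeasure M (A i \<inter> A j)"
  have B: "?B n \<in> sets M" for n using A by auto
  have UB: "(\<Union>n. ?B n) = (\<Union>n. A n)"
  proof
    show "(\<Union>n. A n) \<subseteq> (\<Union>n. ?B n)"
    proof
      fix z assume "z \<in> (\<Union>n. A n)"
      then obtain n where n: "z \<in> A n" by auto
      show "z \<in> (\<Union>n. ?B n)"
      proof (cases "z \<in> A j")
        case True then show ?thesis using \<open>i \<noteq> j\<close> by (intro UN_I[of j]) auto
      next
        case False then show ?thesis using n by (intro UN_I[of n]) auto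
      qed
    qed
  qed (auto split: if_splits)
  have split: "emeasure M (A n) = emeasure M (?B n) + (if n = i then ?x else 0)" for n
  proof (cases "n = i")
    case True
    have "emeasure M (A i) = emeasure M ((A i - A j) \<union> (A i \<inter> A j))"
      by (rule arg_cong[where f="emeasure M"]) auto
    also have "\<dots> = emeasure M (A i - A j) + ?x"
      using A by (intro plus_emeasure[symmetric]) auto
    finally show ?thesis using True by simp
  qed simp
  have "(\<Sum>n. emeasure M (A n)) = (\<Sum>n. emeasure M (?B n)) + (\<Sum>n. if n = i then ?x else 0)"
    unfolding split by (rule suminf_add[symmetric]) auto
  also have "(\<Sum>n. if n = i then ?x else 0) = ?x"
    by (subst suminf_finite[of "{i}"]) auto
  finally have eq: "(\<Sum>n. emeasure M (A n)) = (\<Sum>n. emeasure M (?B n)) + ?x" .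
  have "emeasure M (\<Union>n. A n) \<le> (\<Sum>n. emeasure M (?B n))"
    unfolding UB[symmetric] using B by (intro emeasure_subadditive_countably) blast
  then have "emeasure M (\<Union>n. A n) + ?x \<le> (\<Sum>n. emeasure M (?B n)) + ?x"
    by (rule add_right_mono)
  also have "\<dots> \<le> emeasure M (\<Union>n. A n) + 0" using le unfolding eq[symmetric] by simp
  finally have "emeasure M (\<Union>n. A n) + ?x \<le> emeasure M (\<Union>n. A n) + 0" .
  then have "?x = 0" using fin by (auto simp: ennreal_add_left_cancel_le)
  then show ?thesis using A by (auto simp: null_sets_def)
qed

text \<open>The images of the pieces have total measure \<open>M D\<close>; since they cover \<open>D\<close>, they cannot overlap.\<close>

lemma piecewise_aut_inj_mod_null:
  assumes pw: "piecewise_aut M T D" and sp: "space M = UNIV" and fin: "emeasure M D < \<infinity>"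
    and N: "N \<in> null_sets M" and sub: "D - N \<subseteq> T ` D"
  obtains N' where "N' \<in> null_sets M" "inj_on T (D - N')"
proof -
  from pw obtain P \<phi> where P: "\<And>i::nat. P i \<in> sets M" "\<And>i. measure_aut M (\<phi> i)"
     "\<And>i z. z\<in>P i \<Longrightarrow> T z = \<phi> i z" "D = (\<Union>i. P i)" "disjoint_family P" unfolding piecewise_aut_def by metis
  define A where "A i = \<phi> i ` P i" for i
  have A: "A i \<in> sets M" "emeasure M (A i) = emeasure M (P i)" for i
    using measure_aut_image[OF P(2) sp P(1)] by (auto simp: A_def)
  have TD: "T ` D = (\<Union>i. A i)" unfolding P(4) A_def by (rule image_UN_piecewise[OF P(3)])
  have Ds: "D \<in> sets M" using P by auto
  have "(\<Sum>n. emeasure M (A n)) = emeasure M D"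
    unfolding A(2) P(4) using P by (intro suminf_emeasure) auto
  moreover have le: "emeasure M D \<le> emeasure M (\<Union>n. A n)"
  proof -
    have "emeasure M D = emeasure M (D - N)" using Ds N by (simp add: emeasure_Diff_null_set)
    also have "\<dots> \<le> emeasure M (\<Union>n. A n)" using sub TD A by (intro emeasure_mono) auto
    finally show ?thesis .
  qed
  moreover have "emeasure M (\<Union>n. A n) \<le> (\<Sum>n. emeasure M (A n))"
    using A by (intro emeasure_subadditive_countably) auto
  ultimately have fin2: "emeasure M (\<Union>n. A n) < \<infinity>"
    and le2: "(\<Sum>n. emeasure M (A n)) \<le> emeasure M (\<Union>n. A n)" using fin by auto
  define Z where "Z = (\<Union>i. \<Union>j\<in>{j. j \<noteq> i}. A i \<inter> A j)"
  have "Z \<in> null_sets M" unfolding Z_def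
    by (intro null_sets_UN null_sets_UN' null_Int_of_suminf_le_emeasure_UN[OF A(1) fin2 le2]) auto
  then have *: "T -` Z \<inter> D \<in> null_sets M" by (rule piecewise_aut_vimage(2)[OF pw sp])
  have "inj_on T (D - (T -` Z \<inter> D))"
  proof (rule inj_onI)
    fix z w assume z: "z \<in> D - (T -` Z \<inter> D)" and w: "w \<in> D - (T -` Z \<inter> D)" and eq: "T z = T w"
    from z w P(4) obtain i j where ij: "z \<in> P i" "w \<in> P j" by auto
    then have "T z \<in> A i" "T w \<in> A j" using P(3) by (auto simp: A_def)
    then have "i = j" using z eq ij(1) by (auto simp: Z_def)
    then have "\<phi> i z = \<phi> i w" using ij P(3) eq by metis
    then show "z = w" using P(2)[of i] by (meson measure_aut_def bij_is_inj injD)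
  qed
  then show ?thesis using * that by blast
qed

text \<open>Removing a bad null set once is not enough, since good points may enter it or come from
  it. The bad set is saturated under images and preimages; both preserve null sets and countably
  many rounds suffice, so \<open>T\<close> permutes what is left of \<open>D\<close>.\<close>

lemma piecewise_aut_bij_core:
  assumes pw: "piecewise_aut M T D" and sp: "space M = UNIV" and fin: "emeasure M D < \<infinity>"
    and N: "N \<in> null_sets M" and into: "\<And>z. z \<in> D - N \<Longrightarrow> T z \<in> D" and onto: "D - N \<subseteq> T ` D"
  obtains E where "E \<in> sets M" "E \<subseteq> D - N" "D - E \<in> null_sets M" "bij_betw T E E"
proof -
  obtain N' where N': "N' \<in> null_sets M" "inj_on T (D - N')"
    using piecewise_aut_inj_mod_null[OF pw sp fin N onto] .
  have Ds: "D \<in> sets M" using pw by (rule piecewise_aut_sets)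
  define step where "step B = B \<union> T ` (B \<inter> D) \<union> (T -` B \<inter> D)" for B
  define C where "C n = (step ^^ n) (N \<union> N')" for n
  have stepn: "step B \<in> null_sets M" if "B \<in> null_sets M" for B
  proof -
    have "B \<inter> D \<in> null_sets M" using that Ds by (rule null_set_Int2)
    then have "T ` (B \<inter> D) \<in> null_sets M"
      using Ds that by (intro piecewise_aut_image_null[OF piecewise_aut_subset[OF pw] sp]) auto
    moreover have "T -` B \<inter> D \<in> null_sets M" using piecewise_aut_vimage(2)[OF pw sp that] .
    ultimately show ?thesis unfolding step_def using that by (intro null_sets.Un)
  qed
  have C: "C n \<in> null_sets M" for n
  proof (induction n)
    case 0 show ?case using null_sets.Un[OF N N'(1)] by (simp add: C_def)
  next
    case (Suc n) show ?case using stepn[OF Suc] by (simp add: C_def)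
  qed
  define Bad where "Bad = (\<Union>n. C n)"
  have Bad: "Bad \<in> null_sets M" unfolding Bad_def using C by (rule null_sets_UN)
  have NB: "N \<subseteq> Bad" "N' \<subseteq> Bad" unfolding Bad_def C_def by (auto intro!: exI[of _ "0::nat"])
  have CS: "C (Suc n) = step (C n)" for n by (simp add: C_def)
  have cl1: "T z \<in> Bad" if b: "z \<in> Bad" "z \<in> D" for z
  proof -
    obtain n where "z \<in> C n" using b by (auto simp: Bad_def)
    then have "T z \<in> C (Suc n)" using b unfolding CS step_def by auto
    then show ?thesis by (auto simp: Bad_def)
  qed
  have cl2: "z \<in> Bad" if b: "T z \<in> Bad" "z \<in> D" for z
  proof -
    obtain n where "T z \<in> C n" using b by (auto simp: Bad_def)
    then have "z \<in> C (Suc n)" using b unfolding CS step_def by auto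
    then show ?thesis by (auto simp: Bad_def)
  qed
  have "bij_betw T (D - Bad) (D - Bad)"
    unfolding bij_betw_def
  proof
    show "inj_on T (D - Bad)" using N'(2) NB by (auto intro: inj_on_subset)
    show "T ` (D - Bad) = D - Bad"
    proof
      show "T ` (D - Bad) \<subseteq> D - Bad" using into NB cl2 by auto
      show "D - Bad \<subseteq> T ` (D - Bad)"
      proof
        fix z assume z: "z \<in> D - Bad"
        then obtain w where "w \<in> D" "z = T w" using onto NB by auto
        then show "z \<in> T ` (D - Bad)" using z cl1 by auto
      qed
    qed
  qed
  moreover have "D - (D - Bad) \<in> null_sets M"
    using Bad Ds by (simp add: Diff_Diff_Int null_set_Int1)
  ultimately show ?thesis using that[of "D - Bad"] Ds Bad NB by auto
qed

section \<open>The invariant planar measure\<close>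

lemma distr_inverse_lborel:
  "distr lborel borel inverse = density lborel (\<lambda>x::real. ennreal (1 / x\<^sup>2))"
proof -
  let ?D = "density lborel (\<lambda>x::real. ennreal (1 / x\<^sup>2))"
  \<comment> \<open>The converse push-forward comes first because its target is Lebesgue measure,
    which \<open>lborel_eqI\<close> recognises from boxes. Applying the involution
    \<open>inverse\<close> once more gives the claim.\<close>
  have "lborel = distr ?D borel inverse"
  proof (rule lborel_eqI)
    fix l u :: real
    assume "\<And>b. b \<in> Basis \<Longrightarrow> l \<bullet> b \<le> u \<bullet> b"
    then have lu: "l \<le> u" by simp
    let ?S = "UNIV - {0::real}" and ?f = "indicat_real {l<..<u}"
    have img: "inverse ` ?S = ?S"
    proof
      show "?S \<subseteq> inverse ` ?S"
        by (intro subsetI image_eqI[of _ inverse "inverse _"]) auto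
    qed auto
    have f_int: "(?f has_integral (u - l)) UNIV"
    proof -
      have "((\<lambda>x. if x \<in> {l<..<u} then 1 else 0::real) has_integral (u - l)) UNIV"
        using has_integral_const_real[of "1::real" l u] lu has_integral_Icc_iff_Ioo[of "\<lambda>x. 1::real" "u - l" l u]
        by (subst has_integral_restrict_UNIV) simp
      then show ?thesis by (rule has_integral_eq[rotated]) (auto simp: indicator_def)
    qed
    have fS: "(?f has_integral (u - l)) ?S"
      using f_int by (subst has_integral_spike_set_eq[of _ UNIV]) (auto intro: negligible_subset[of "{0}"])
    then have "?f absolutely_integrable_on ?S"
      by (intro nonnegative_absolutely_integrable_1) auto
    moreover have "integral ?S ?f = u - l" using fS by (rule integral_unique)
    ultimately have "?f absolutely_integrable_on (inverse ` ?S) \<and> integral (inverse ` ?S) ?f = u - l"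
      using img by simp
    then have "(\<lambda>x. \<bar>- (1 / x\<^sup>2)\<bar> * ?f (inverse x)) absolutely_integrable_on ?S \<and>
        integral ?S (\<lambda>x. \<bar>- (1 / x\<^sup>2)\<bar> * ?f (inverse x)) = u - l"
      by (subst has_absolute_integral_change_of_variables_1')
         (auto intro!: derivative_eq_intros inj_onI simp: power2_eq_square field_simps)
    then have "((\<lambda>x. \<bar>- (1 / x\<^sup>2)\<bar> * ?f (inverse x)) has_integral (u - l)) ?S"
      using has_integral_integrable_integral set_lebesgue_integral_eq_integral(1) by blast
    then have hi: "((\<lambda>x. \<bar>- (1 / x\<^sup>2)\<bar> * ?f (inverse x)) has_integral (u - l)) UNIV"
      by (subst (asm) has_integral_spike_set_eq[of _ UNIV]) (auto intro: negligible_subset[of "{0}"])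
    have "emeasure (distr ?D borel inverse) (box l u) = emeasure ?D (inverse -` {l<..<u})"
      by (subst emeasure_distr) auto
    also have "\<dots> = (\<integral>\<^sup>+x. ennreal (1 / x\<^sup>2) * indicator (inverse -` {l<..<u}) x \<partial>lborel)"
      using measurable_sets[of inverse borel borel "{l<..<u}"] by (subst emeasure_density) auto
    also have "\<dots> = (\<integral>\<^sup>+x. ennreal (\<bar>- (1 / x\<^sup>2)\<bar> * ?f (inverse x)) \<partial>lborel)"
      by (intro nn_integral_cong) (auto simp: indicator_def)
    also have "\<dots> = ennreal (u - l)"
      by (rule nn_integral_has_integral_lborel[OF _ _ hi]) auto
    finally show "emeasure (distr ?D borel inverse) (box l u) = ennreal (\<Prod>b\<in>Basis. (u - l) \<bullet> b)"
      by simp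
  qed simp
  then have "distr lborel borel inverse = distr (distr ?D borel inverse) borel inverse" by simp
  also have "\<dots> = distr ?D borel (inverse \<circ> inverse)" by (rule distr_distr) auto
  also have "\<dots> = ?D" by (simp add: o_def distr_id2)
  finally show ?thesis .
qed

definition diag_map :: "(real \<Rightarrow> real) \<Rightarrow> real \<times> real \<Rightarrow> real \<times> real" where
  "diag_map f = (\<lambda>(x, y). (f x, f y))"

definition mobius_measure :: "(real \<times> real) measure" where
  "mobius_measure = density lborel (\<lambda>(x, y). ennreal (1 / (x - y)\<^sup>2))"

lemma sets_mobius_measure [simp, measurable_cong]: "sets mobius_measure = sets borel"
  by (simp add: mobius_measure_def)

lemma space_mobius_measure [simp]: "space mobius_measure = UNIV"
  by (simp add: mobius_measure_def)

lemma measurable_mobius_density [measurable]: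
  "(\<lambda>(x, y). ennreal (1 / (x - y)\<^sup>2)) \<in> borel_measurable (borel :: (real \<times> real) measure)"
  unfolding case_prod_beta borel_prod[symmetric] by measurable

lemma measurable_diag_map [measurable]:
  "f \<in> borel_measurable borel \<Longrightarrow> diag_map f \<in> borel_measurable borel"
  unfolding diag_map_def case_prod_beta borel_prod[symmetric]
  by (intro measurable_Pair measurable_compose[OF measurable_fst] measurable_compose[OF measurable_snd])

lemma sigma_finite_mobius_measure: "sigma_finite_measure mobius_measure"
  unfolding mobius_measure_def
  by (subst sigma_finite_measure.sigma_finite_iff_density_finite[OF sigma_finite_lborel]) auto

lemma distr_diag_map_lborel:
  assumes f: "f \<in> borel_measurable borel" and d: "distr lborel borel f = density lborel w"
    and w: "w \<in> borel_measurable borel" "\<And>x. w x \<noteq> \<infinity>"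
  shows "distr lborel borel (diag_map f) = density lborel (\<lambda>(x, y). w x * w y)"
proof -
  have sf: "sigma_finite_measure (density lborel w)"
    by (subst sigma_finite_measure.sigma_finite_iff_density_finite[OF sigma_finite_lborel]) (use w in auto)
  have "distr lborel borel (diag_map f) = distr (lborel \<Otimes>\<^sub>M lborel) (borel \<Otimes>\<^sub>M borel) (\<lambda>(x, y). (f x, f y))"
    unfolding diag_map_def lborel_prod borel_prod ..
  also have "\<dots> = distr lborel borel f \<Otimes>\<^sub>M distr lborel borel f"
    by (rule pair_measure_distr[symmetric]) (use f d sf in simp_all)
  also have "\<dots> = density (lborel \<Otimes>\<^sub>M lborel) (\<lambda>(x, y). w x * w y)"
    unfolding d by (rule pair_measure_density) (use w sf sigma_finite_lborel in simp_all)
  finally show ?thesis unfolding lborel_prod .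
qed

lemma null_line_fst: "{c} \<times> UNIV \<in> null_sets mobius_measure"
  and null_line_snd: "UNIV \<times> {c} \<in> null_sets mobius_measure"
proof -
  have "{c} \<times> UNIV \<in> null_sets (lborel :: (real \<times> real) measure)"
    unfolding lborel_prod[symmetric] by (auto simp: null_sets_def lborel.emeasure_pair_measure_Times)
  moreover have "UNIV \<times> {c} \<in> null_sets (lborel :: (real \<times> real) measure)"
    unfolding lborel_prod[symmetric] by (auto simp: null_sets_def lborel.emeasure_pair_measure_Times)
  moreover have "absolutely_continuous lborel mobius_measure"
    unfolding mobius_measure_def by (rule absolutely_continuousI_density) auto
  ultimately show "{c} \<times> UNIV \<in> null_sets mobius_measure" "UNIV \<times> {c} \<in> null_sets mobius_measure"
    unfolding absolutely_continuous_def by auto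
qed

lemma null_countable_lines:
  assumes "countable Q"
  shows "Q \<times> UNIV \<in> null_sets mobius_measure" "UNIV \<times> Q \<in> null_sets mobius_measure"
proof -
  have "Q \<times> UNIV = (\<Union>c\<in>Q. {c} \<times> (UNIV::real set))" "UNIV \<times> Q = (\<Union>c\<in>Q. (UNIV::real set) \<times> {c})" by auto
  then show "Q \<times> UNIV \<in> null_sets mobius_measure" "UNIV \<times> Q \<in> null_sets mobius_measure"
    using assms null_line_fst null_line_snd by (auto intro!: null_sets_UN')
qed

text \<open>Writing the invariant density as a function \<open>v\<close> of the image point lets it
  pass through the push-forward. What remains is a pointwise identity between \<open>v\<close>, the
  original density and the density \<open>j\<close> of the pushed Lebesgue measure.\<close>

lemma distr_mobius_measureI:
  assumes T: "T \<in> borel_measurable borel" and v: "v \<in> borel_measurable borel" and j: "j \<in> borel_measurable borel"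
    and w: "\<And>x y. ennreal (1 / (x - y)\<^sup>2) = v (T (x, y))"
    and d: "distr lborel borel T = density lborel j"
    and ae: "AE z in lborel. j z * v z = (case z of (x, y) \<Rightarrow> ennreal (1 / (x - y)\<^sup>2))"
  shows "distr mobius_measure mobius_measure T = mobius_measure"
proof -
  have "distr mobius_measure mobius_measure T = distr (density lborel (\<lambda>z. v (T z))) borel T"
    unfolding mobius_measure_def by (intro distr_cong arg_cong[where f="density lborel"]) (auto simp: w)
  also have "\<dots> = density (distr lborel borel T) v"
    using T v by (subst density_distr) auto
  also have "\<dots> = density lborel (\<lambda>z. j z * v z)"
    unfolding d using j v by (subst density_density_eq) auto
  also have "\<dots> = mobius_measure" unfolding mobius_measure_def
    using ae j v by (intro density_cong) auto
  finally show ?thesis .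
qed

lemma aut_shift: "measure_aut mobius_measure (diag_map (\<lambda>x. x - c))"
proof (rule measure_autI[where g = "diag_map (\<lambda>x. x + c)"])
  show "distr mobius_measure mobius_measure (diag_map (\<lambda>x. x - c)) = mobius_measure"
  proof (rule distr_mobius_measureI[where v = "\<lambda>(x, y). ennreal (1 / (x - y)\<^sup>2)" and j = "\<lambda>_. 1"])
    show "diag_map (\<lambda>x. x - c) \<in> borel_measurable borel" by measurable
    have "distr lborel borel (diag_map (\<lambda>x. x - c)) = distr lborel borel ((+) (- c, - c))"
      by (rule arg_cong[where f = "distr lborel borel"]) (auto simp: diag_map_def)
    also have "\<dots> = lborel" by (rule lborel_distr_plus)
    finally show "distr lborel borel (diag_map (\<lambda>x. x - c)) = density lborel (\<lambda>_. 1)"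
      by (simp add: density_1)
  qed (auto simp: diag_map_def)
qed (measurable, auto simp: diag_map_def)

lemma aut_uminus: "measure_aut mobius_measure (diag_map uminus)"
proof (rule measure_autI[where g = "diag_map uminus"])
  show "distr mobius_measure mobius_measure (diag_map uminus) = mobius_measure"
  proof (rule distr_mobius_measureI[where v = "\<lambda>(x, y). ennreal (1 / (x - y)\<^sup>2)"])
    show "diag_map uminus \<in> borel_measurable borel" by measurable
    show "distr lborel borel (diag_map uminus) = density lborel (\<lambda>(x, y). 1 * 1)"
      by (rule distr_diag_map_lborel) (auto simp: density_1 lborel_distr_uminus)
  qed (auto simp: diag_map_def power2_commute)
qed (measurable, auto simp: diag_map_def)

text \<open>Together with shifts and negation, inversion generates all branches used below. Its
  Jacobian factor 1 / (x y)^2 is absorbed by the identity x y (1/x - 1/y) = y - x, valid off the two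
  axes. As \<open>inverse 0 = 0\<close>, the map is an involution of the entire plane.\<close>

lemma aut_inverse: "measure_aut mobius_measure (diag_map inverse)"
proof (rule measure_autI[where g = "diag_map inverse"])
  let ?v = "\<lambda>(x :: real, y :: real). ennreal (1 / (inverse x - inverse y)\<^sup>2)"
  let ?j = "\<lambda>(x :: real, y :: real). ennreal (1 / x\<^sup>2) * ennreal (1 / y\<^sup>2)"
  show "distr mobius_measure mobius_measure (diag_map inverse) = mobius_measure"
  proof (rule distr_mobius_measureI[where v = ?v])
    show "diag_map inverse \<in> borel_measurable borel" by measurable
    show "distr lborel borel (diag_map inverse) = density lborel ?j"
      by (rule distr_diag_map_lborel[OF _ distr_inverse_lborel]) auto
    show "?v \<in> borel_measurable borel" "?j \<in> borel_measurable borel"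
      unfolding case_prod_beta borel_prod[symmetric] by measurable
    have n1: "AE z::real\<times>real in lborel. fst z \<noteq> (0::real)" and n2: "AE z::real\<times>real in lborel. snd z \<noteq> (0::real)"
    proof -
      have "{0::real} \<times> (UNIV::real set) \<in> null_sets lborel" "(UNIV::real set) \<times> {0::real} \<in> null_sets lborel"
        unfolding lborel_prod[symmetric] by (auto simp: null_sets_def lborel.emeasure_pair_measure_Times)
      then have "AE z in lborel. z \<notin> {0::real} \<times> (UNIV::real set)" "AE z in lborel. z \<notin> (UNIV::real set) \<times> {0::real}"
        by (auto dest: AE_not_in)
      then show "AE z::real\<times>real in lborel. fst z \<noteq> (0::real)" "AE z::real\<times>real in lborel. snd z \<noteq> (0::real)"
        by (auto simp: mem_Times_iff)
    qed
    show "AE z in lborel. ?j z * ?v z = (case z of (x, y) \<Rightarrow> ennreal (1 / (x - y)\<^sup>2))"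
      using n1 n2
    proof eventually_elim
      case (elim z)
      obtain x y where z: "z = (x, y)" by force
      have "1 / x\<^sup>2 * (1 / y\<^sup>2) * (1 / (inverse x - inverse y)\<^sup>2) = 1 / (x * y * (inverse x - inverse y))\<^sup>2"
        by (simp add: power_mult_distrib)
      also have "x * y * (inverse x - inverse y) = y - x" using elim z by (simp add: field_simps)
      finally show ?case unfolding z by (simp add: ennreal_mult[symmetric] power2_commute)
    qed
  qed (auto simp: diag_map_def)
qed (measurable, auto simp: diag_map_def)

lemma aut_diag_comp:
  "measure_aut mobius_measure (diag_map f) \<Longrightarrow> measure_aut mobius_measure (diag_map g) \<Longrightarrow>
   measure_aut mobius_measure (diag_map (\<lambda>x. f (g x)))"
  using measure_aut_comp[of mobius_measure "diag_map f" "diag_map g"]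
  by (simp add: diag_map_def comp_def case_prod_unfold)

text \<open>The gap between \<open>b\<close> and \<open>c\<close> keeps the strip away from the
  diagonal: replacing x by b bounds the density by 1 / (y - b)^2, which is integrable from c to
  infinity.\<close>

lemma emeasure_mobius_strip_finite:
  assumes "b < c"
  shows "emeasure mobius_measure ({a..b} \<times> {c..}) < \<infinity>"
proof -
  let ?g = "\<lambda>y. ennreal (1 / (y - b)\<^sup>2) * indicator {c..} y"
  have g: "(\<integral>\<^sup>+y. ?g y \<partial>lborel) = ennreal (0 - (- 1 / (c - b)))"
  proof (rule nn_integral_FTC_atLeast)
    have "filterlim (\<lambda>y. - b + y) at_top at_top"
      by (rule filterlim_tendsto_add_at_top[OF tendsto_const filterlim_ident])
    then show "((\<lambda>y. - 1 / (y - b)) \<longlongrightarrow> 0) at_top"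
      by (intro tendsto_divide_0[OF tendsto_const] filterlim_at_top_imp_at_infinity)
         (simp add: add.commute)
  qed (use assms in \<open>auto intro!: derivative_eq_intros simp: power2_eq_square\<close>)
  have "emeasure mobius_measure ({a..b} \<times> {c..}) =
      (\<integral>\<^sup>+z. (case z of (x, y) \<Rightarrow> ennreal (1 / (x - y)\<^sup>2)) * indicator ({a..b} \<times> {c..}) z \<partial>lborel)"
    unfolding mobius_measure_def by (subst emeasure_density) (auto intro!: borel_closed closed_Times)
  also have "\<dots> \<le> (\<integral>\<^sup>+z. indicator {a..b} (fst z) * ?g (snd z) \<partial>(lborel \<Otimes>\<^sub>M lborel))"
    unfolding lborel_prod
  proof (intro nn_integral_mono)
    fix z :: "real \<times> real"
    obtain x y where z: "z = (x, y)" by force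
    show "(case z of (x, y) \<Rightarrow> ennreal (1 / (x - y)\<^sup>2)) * indicator ({a..b} \<times> {c..}) z
        \<le> indicator {a..b} (fst z) * ?g (snd z)"
    proof (cases "x \<in> {a..b} \<and> y \<in> {c..}")
      case True
      then have "(y - b)\<^sup>2 \<le> (y - x)\<^sup>2" "0 < (y - b)\<^sup>2" using assms by (auto intro!: power_mono)
      then have "1 / (y - x)\<^sup>2 \<le> 1 / (y - b)\<^sup>2" by (simp add: frac_le)
      then show ?thesis using True by (simp add: z power2_commute)
    qed (auto simp: z indicator_def)
  qed
  also have "\<dots> = (\<integral>\<^sup>+x. (\<integral>\<^sup>+y. indicator {a..b} x * ?g y \<partial>lborel) \<partial>lborel)"
    by (subst lborel.nn_integral_fst[symmetric]) auto
  also have "\<dots> = (\<integral>\<^sup>+x. indicator {a..b} x * ennreal (0 - (- 1 / (c - b))) \<partial>lborel)"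
    by (subst nn_integral_cmult) (auto simp: g)
  also have "\<dots> < \<infinity>"
    by (subst nn_integral_multc) (auto simp: ennreal_mult_less_top emeasure_lborel_Icc_eq)
  finally show ?thesis .
qed

lemma emeasure_mobius_strip_finite':
  assumes "d < a"
  shows "emeasure mobius_measure ({a..b} \<times> {..d}) < \<infinity>"
proof -
  have "{a..b} \<times> {..d} = diag_map uminus -` ({-b..-a} \<times> {-d..})"
    by (auto simp: diag_map_def)
  moreover have "emeasure mobius_measure (diag_map uminus -` ({-b..-a} \<times> {-d..})) = emeasure mobius_measure ({-b..-a} \<times> {-d..})"
    by (rule measure_aut_vimage(2)[OF aut_uminus]) (auto intro!: borel_closed closed_Times)
  ultimately show ?thesis
    using emeasure_mobius_strip_finite[of "-a" "-d" "-b"] assms by simp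
qed

section \<open>The natural extension domain of the alpha-continued fraction map\<close>

definition orbits :: "real \<Rightarrow> (real \<times> real) set" where
  "orbits \<alpha> = {(Ghat \<alpha> ^^ n) (x, 0) | n x.
     x \<in> {\<alpha> - 1..<\<alpha>} \<and> (\<forall>m<n. fst ((Ghat \<alpha> ^^ m) (x, 0)) \<noteq> 0)}"

lemma Omega_eq_closure: "Omega \<alpha> = closure (orbits \<alpha>)"
  by (simp add: Omega_def orbits_def)

lemma Ghat_nonzero:
  fixes x z :: real
  shows "x \<noteq> 0 \<Longrightarrow> Ghat \<alpha> (x, z) = (1 / \<bar>x\<bar> - cf_digit \<alpha> x, 1 / (cf_digit \<alpha> x + sgn x * z))"
  by (auto simp: Ghat_def sgn_if)

lemma cf_digit_eqI: "\<alpha> - 1 \<le> u \<Longrightarrow> u < \<alpha> \<Longrightarrow> 1 / \<bar>x\<bar> = u + of_int b \<Longrightarrow> cf_digit \<alpha> x = b"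
  unfolding cf_digit_def by (intro floor_unique) auto

lemma cf_digit_bounds: "1 / \<bar>x\<bar> - cf_digit \<alpha> x \<in> {\<alpha> - 1..<\<alpha>}"
  unfolding cf_digit_def by (simp, linarith)

context
  fixes \<alpha> :: real
  assumes \<alpha>_pos: "0 < \<alpha>" and \<alpha>_half: "\<alpha> < 1 / 2"
begin

text \<open>Since \<alpha> < 1/2, the negative half of the interval is the longer one, so |x| \<le>
  1 - \<alpha>, and (1 + \<alpha>)(1 - \<alpha>) \<le> 1 yields 1/|x| \<ge> 1 + \<alpha>. The bound
  keeps the denominators of \<open>Ghat\<close> at least 1 for ordinates in [0, 1].\<close>

lemma cf_digit_ge_2:
  assumes "x \<noteq> 0" "\<alpha> - 1 \<le> x" "x \<le> \<alpha>"
  shows "2 \<le> cf_digit \<alpha> x"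
proof -
  have "\<bar>x\<bar> \<le> 1 - \<alpha>" using assms \<alpha>_half by linarith
  have "(1 + \<alpha>) * \<bar>x\<bar> \<le> (1 + \<alpha>) * (1 - \<alpha>)" using \<open>\<bar>x\<bar> \<le> 1 - \<alpha>\<close> \<alpha>_pos by (intro mult_left_mono) auto
  also have "\<dots> \<le> 1" by (simp add: algebra_simps)
  finally have "1 + \<alpha> \<le> 1 / \<bar>x\<bar>" using assms by (simp add: field_simps)
  then show ?thesis unfolding cf_digit_def by linarith
qed

lemma orbits_bounds: "p \<in> orbits \<alpha> \<Longrightarrow> fst p \<in> {\<alpha> - 1..<\<alpha>} \<and> snd p \<in> {0..1}"
proof -
  have step: "fst (Ghat \<alpha> p) \<in> {\<alpha> - 1..<\<alpha>} \<and> snd (Ghat \<alpha> p) \<in> {0..1}"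
    if p: "fst p \<in> {\<alpha> - 1..<\<alpha>} \<and> snd p \<in> {0..1}" "fst p \<noteq> 0" for p
  proof -
    obtain x z where xz: "p = (x, z)" by force
    let ?b = "cf_digit \<alpha> x"
    have "2 \<le> ?b" using cf_digit_ge_2[of x] p xz by simp
    moreover have "\<bar>sgn x * z\<bar> \<le> 1" using p xz by (auto simp: sgn_if)
    ultimately have "1 \<le> ?b + sgn x * z" by linarith
    then have "1 / (?b + sgn x * z) \<in> {0..1}" by simp
    then show ?thesis using cf_digit_bounds[of x \<alpha>] p xz by (simp add: Ghat_nonzero)
  qed
  assume "p \<in> orbits \<alpha>"
  then obtain n x where p: "p = (Ghat \<alpha> ^^ n) (x, 0)" "x \<in> {\<alpha> - 1..<\<alpha>}"
    "\<forall>m<n. fst ((Ghat \<alpha> ^^ m) (x, 0)) \<noteq> 0" by (auto simp: orbits_def)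
  have "m \<le> n \<Longrightarrow> fst ((Ghat \<alpha> ^^ m) (x, 0)) \<in> {\<alpha> - 1..<\<alpha>} \<and> snd ((Ghat \<alpha> ^^ m) (x, 0)) \<in> {0..1}" for m
  proof (induction m)
    case 0 then show ?case using p(2) by simp
  next
    case (Suc m)
    then show ?case using step[of "(Ghat \<alpha> ^^ m) (x, 0)"] p(3) by simp
  qed
  then show ?thesis using p(1) by blast
qed

lemma orbits_step:
  assumes "p \<in> orbits \<alpha>" "fst p \<noteq> 0" shows "Ghat \<alpha> p \<in> orbits \<alpha>"
proof -
  from assms(1) obtain n x where p: "p = (Ghat \<alpha> ^^ n) (x, 0)" "x \<in> {\<alpha> - 1..<\<alpha>}"
    "\<forall>m<n. fst ((Ghat \<alpha> ^^ m) (x, 0)) \<noteq> 0" by (auto simp: orbits_def)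
  have "Ghat \<alpha> p = (Ghat \<alpha> ^^ Suc n) (x, 0)" using p(1) by simp
  moreover have "\<forall>m<Suc n. fst ((Ghat \<alpha> ^^ m) (x, 0)) \<noteq> 0" using p assms(2) less_Suc_eq by metis
  ultimately show ?thesis using p(2) unfolding orbits_def by blast
qed

lemma orbits_cases:
  assumes "p \<in> orbits \<alpha>"
  obtains "snd p = 0" | q where "q \<in> orbits \<alpha>" "fst q \<noteq> 0" "p = Ghat \<alpha> q"
proof -
  from assms(1) obtain n x where p: "p = (Ghat \<alpha> ^^ n) (x, 0)" "x \<in> {\<alpha> - 1..<\<alpha>}"
    "\<forall>m<n. fst ((Ghat \<alpha> ^^ m) (x, 0)) \<noteq> 0" by (auto simp: orbits_def)
  show ?thesis
  proof (cases n)
    case 0 then show ?thesis using p(1) that(1) by simp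
  next
    case (Suc k)
    have "(Ghat \<alpha> ^^ k) (x, 0) \<in> orbits \<alpha>" using p Suc unfolding orbits_def
      using less_SucI by blast
    then show ?thesis using p Suc that(2)[of "(Ghat \<alpha> ^^ k) (x, 0)"] by simp
  qed
qed

lemma Omega_bounds: "Omega \<alpha> \<subseteq> {\<alpha> - 1..\<alpha>} \<times> {0..1}"
  unfolding Omega_eq_closure
proof (rule closure_minimal)
  show "orbits \<alpha> \<subseteq> {\<alpha> - 1..\<alpha>} \<times> {0..1}" using orbits_bounds by (force simp: mem_Times_iff)
qed (intro closed_Times; simp)

text \<open>Away from the jumps of the digit the map is continuous: orbit points close to (x, z)
  eventually share the sign and the digit of x, and their images are orbit points converging to the
  image of (x, z).\<close>

lemma Ghat_Omega:
  assumes p: "(x, z) \<in> Omega \<alpha>" and x: "x \<noteq> 0" "1 / \<bar>x\<bar> + 1 - \<alpha> \<notin> \<int>"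
  shows "Ghat \<alpha> (x, z) \<in> Omega \<alpha>"
proof -
  let ?b = "cf_digit \<alpha> x"
  obtain a where a: "\<And>n. a n \<in> orbits \<alpha>" "a \<longlonglongrightarrow> (x, z)"
    using p unfolding Omega_eq_closure closure_sequential by blast
  have ax: "(\<lambda>n. fst (a n)) \<longlonglongrightarrow> x" and az: "(\<lambda>n. snd (a n)) \<longlonglongrightarrow> z"
    using tendsto_fst[OF a(2)] tendsto_snd[OF a(2)] by auto
  have lim: "(\<lambda>n. 1 / \<bar>fst (a n)\<bar> + 1 - \<alpha>) \<longlonglongrightarrow> 1 / \<bar>x\<bar> + 1 - \<alpha>"
    using x by (intro tendsto_intros ax) auto
  have "eventually (\<lambda>n. \<bar>fst (a n) - x\<bar> < \<bar>x\<bar>) sequentially"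
    using tendstoD[OF ax, of "\<bar>x\<bar>"] x by (simp add: dist_real_def)
  moreover have "eventually (\<lambda>n. of_int \<lfloor>1 / \<bar>x\<bar> + 1 - \<alpha>\<rfloor> < 1 / \<bar>fst (a n)\<bar> + 1 - \<alpha>) sequentially"
    using eventually_floor_less[OF lim x(2)] .
  moreover have "eventually (\<lambda>n. 1 / \<bar>fst (a n)\<bar> + 1 - \<alpha> < of_int \<lceil>1 / \<bar>x\<bar> + 1 - \<alpha>\<rceil>) sequentially"
    using eventually_less_ceiling[OF lim x(2)] .
  ultimately have ev: "eventually (\<lambda>n. fst (a n) \<noteq> 0 \<and>
      Ghat \<alpha> (a n) = (1 / \<bar>fst (a n)\<bar> - ?b, 1 / (?b + sgn x * snd (a n)))) sequentially"
  proof eventually_elim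
    case (elim n)
    have ne: "fst (a n) \<noteq> 0" and sg: "sgn (fst (a n)) = sgn x"
      using elim(1) by (auto simp: sgn_if)
    have "cf_digit \<alpha> (fst (a n)) = ?b"
      unfolding cf_digit_def using elim(2,3) ceiling_diff_floor_le_1[of "1 / \<bar>x\<bar> + 1 - \<alpha>"]
      by (intro floor_unique) linarith+
    then show ?case using Ghat_nonzero[OF ne, of \<alpha> "snd (a n)"] ne sg by simp
  qed
  have xz: "\<alpha> - 1 \<le> x" "x \<le> \<alpha>" "0 \<le> z" "z \<le> 1" using Omega_bounds p by auto
  have "2 \<le> ?b" using cf_digit_ge_2 x xz by simp
  moreover have "\<bar>sgn x * z\<bar> \<le> 1" using xz by (auto simp: sgn_if)
  ultimately have ne: "?b + sgn x * z \<noteq> 0" by linarith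
  have "(\<lambda>n. (1 / \<bar>fst (a n)\<bar> - ?b, 1 / (?b + sgn x * snd (a n)))) \<longlonglongrightarrow> (1 / \<bar>x\<bar> - ?b, 1 / (?b + sgn x * z))"
    using x ne by (intro tendsto_intros ax az) auto
  then have "(\<lambda>n. Ghat \<alpha> (a n)) \<longlonglongrightarrow> Ghat \<alpha> (x, z)"
    unfolding Ghat_nonzero[OF x(1)] by (rule Lim_transform_eventually) (use ev in \<open>auto elim: eventually_mono\<close>)
  moreover have "eventually (\<lambda>n. Ghat \<alpha> (a n) \<in> closure (orbits \<alpha>)) sequentially"
    using ev by eventually_elim (use orbits_step a(1) closure_subset in blast)
  ultimately show ?thesis unfolding Omega_eq_closure
    by (intro Lim_in_closed_set[of "closure (orbits \<alpha>)"]) auto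
qed

text \<open>Orbit points approximating (u, z) eventually have positive ordinate, hence have
  predecessors in the orbit set. Only finitely many pairs of sign and digit can occur for these, so
  one pair recurs along a subsequence, where the branch can be inverted and the limit taken.
  Excluding u = \<alpha> puts u in the half-open interval that determines the digit of the
  limit.\<close>

lemma Omega_subset_Ghat_image:
  assumes p: "(u, z) \<in> Omega \<alpha>" and "0 < z" "u \<noteq> \<alpha>"
  obtains x' z' where "(x', z') \<in> Omega \<alpha>" "x' \<noteq> 0" "Ghat \<alpha> (x', z') = (u, z)"
proof -
  obtain a where a: "\<And>n. a n \<in> orbits \<alpha>" "a \<longlonglongrightarrow> (u, z)"
    using p unfolding Omega_eq_closure closure_sequential by blast
  have az: "(\<lambda>n. snd (a n)) \<longlonglongrightarrow> z" using tendsto_snd[OF a(2)] by auto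
  have uz: "\<alpha> - 1 \<le> u" "u < \<alpha>" using Omega_bounds p \<open>u \<noteq> \<alpha>\<close> by force+
  have "eventually (\<lambda>n. z / 2 < snd (a n)) sequentially"
    using order_tendstoD(1)[OF az, of "z/2"] \<open>0 < z\<close> by simp
  then obtain N where N: "\<And>n. n \<ge> N \<Longrightarrow> z / 2 < snd (a n)" by (auto simp: eventually_sequentially)
  have "\<exists>q\<in>orbits \<alpha>. fst q \<noteq> 0 \<and> a n = Ghat \<alpha> q" if "n \<ge> N" for n
    using orbits_cases[OF a(1)[of n]] N[OF that] \<open>0 < z\<close> by (metis less_divide_eq_numeral1(1) mult_zero_left order_less_asym)
  then obtain q where q: "\<And>n. n \<ge> N \<Longrightarrow> q n \<in> orbits \<alpha> \<and> fst (q n) \<noteq> 0 \<and> a n = Ghat \<alpha> (q n)" by metis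
  \<comment> \<open>An ordinate above z / 2 means that digit plus signed ordinate of the predecessor
    is below 2 / z; the signed ordinate is at most 1 in absolute value, which accounts for the extra
    1.\<close>
  define K where "K = {2..\<lceil>2 / z\<rceil> + 1}"
  let ?c = "\<lambda>n. (sgn (fst (q n)), cf_digit \<alpha> (fst (q n)))"
  have c: "?c n \<in> {-1, 1} \<times> K" if n: "n \<ge> N" for n
  proof -
    let ?x = "fst (q n)" and ?z = "snd (q n)"
    let ?b = "cf_digit \<alpha> ?x"
    have bd: "?x \<in> {\<alpha> - 1..<\<alpha>}" "?z \<in> {0..1}" using orbits_bounds q[OF n] by auto
    have b2: "2 \<le> ?b" using cf_digit_ge_2[of ?x] q[OF n] bd by simp
    moreover have s1: "\<bar>sgn ?x * ?z\<bar> \<le> 1" using bd by (auto simp: sgn_if)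
    ultimately have pos: "0 < ?b + sgn ?x * ?z" by linarith
    have "z / 2 < 1 / (?b + sgn ?x * ?z)"
      using N[OF n] q[OF n] Ghat_nonzero[of ?x \<alpha> ?z] by simp
    then have "?b + sgn ?x * ?z < 2 / z" using pos \<open>0 < z\<close> by (simp add: field_simps)
    then have "?b \<le> \<lceil>2 / z\<rceil> + 1" using s1 by linarith
    then show ?thesis using b2 q[OF n] by (auto simp: K_def sgn_if)
  qed
  obtain n0 where n0: "n0 \<in> {N..}" and inf: "infinite {n \<in> {N..}. ?c n = ?c n0}"
    using pigeonhole_infinite[of "{N..}" ?c] c
    by (metis (no_types, lifting) atLeast_iff finite.emptyI finite.insertI finite_SigmaI finite_atLeastAtMost_int finite_subset
        image_subsetI K_def infinite_Ici)
  define s where "s = sgn (fst (q n0))"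
  define b where "b = cf_digit \<alpha> (fst (q n0))"
  have sb: "s \<in> {-1, 1}" "2 \<le> b" using c[of n0] n0 by (auto simp: s_def b_def K_def)
  then have ss: "s * s = 1" by auto
  define r where "r = enumerate {n \<in> {N..}. ?c n = ?c n0}"
  have r: "strict_mono r" using inf by (simp add: r_def strict_mono_enumerate)
  have rN: "r n \<ge> N" "sgn (fst (q (r n))) = s" "cf_digit \<alpha> (fst (q (r n))) = b" for n
    using enumerate_in_set[OF inf, of n] by (auto simp: r_def s_def b_def)
  have ar: "(\<lambda>n. fst (a (r n))) \<longlonglongrightarrow> u" "(\<lambda>n. snd (a (r n))) \<longlonglongrightarrow> z"
    using LIMSEQ_subseq_LIMSEQ[OF a(2) r] by (auto simp: comp_def dest: tendsto_fst tendsto_snd)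
  let ?h = "\<lambda>(u :: real) (z :: real). (s / (u + b), s * (1 / z - b))"
  have qr: "q (r n) = ?h (fst (a (r n))) (snd (a (r n)))" for n
  proof -
    obtain x' z' where xz: "q (r n) = (x', z')" by force
    have x': "x' \<noteq> 0" "sgn x' = s" "cf_digit \<alpha> x' = b" using q[OF rN(1)] rN(2,3) xz by (metis fst_conv)+
    have "a (r n) = (1 / \<bar>x'\<bar> - b, 1 / (b + s * z'))" using q[OF rN(1)] xz Ghat_nonzero[of x' \<alpha> z'] x' by metis
    moreover have "s * \<bar>x'\<bar> = x'" using x' by (auto simp: sgn_if split: if_splits)
    moreover have "s * (b + s * z' - b) = z'" using ss by (simp add: algebra_simps)
    ultimately show ?thesis using xz by simp
  qed
  have ub: "0 < u + b" using uz sb \<alpha>_pos by linarith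
  have "(\<lambda>n. q (r n)) \<longlonglongrightarrow> ?h u z" unfolding qr
    using ub \<open>0 < z\<close> by (intro tendsto_intros ar) auto
  then have "?h u z \<in> Omega \<alpha>" unfolding Omega_eq_closure closure_sequential
    by (intro exI[of _ "\<lambda>n. q (r n)"] conjI allI) (use q[OF rN(1)] in auto)
  moreover have "s / (u + b) \<noteq> 0" using sb ub by auto
  moreover have "Ghat \<alpha> (?h u z) = (u, z)"
  proof -
    have abs: "1 / \<bar>s / (u + b)\<bar> = u + b" using sb ub by auto
    have "cf_digit \<alpha> (s / (u + b)) = b" by (rule cf_digit_eqI[OF uz abs])
    moreover have "sgn (s / (u + b)) = s" using sb ub by (auto simp: sgn_if)
    moreover have "1 / (b + s * (s * (1 / z - b))) = z"
      using ss \<open>0 < z\<close> by (simp add: mult.assoc[symmetric])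
    ultimately show ?thesis using Ghat_nonzero[OF \<open>s / (u + b) \<noteq> 0\<close>] abs by simp
  qed
  ultimately show ?thesis using that by blast
qed

end

section \<open>The conjugate map on \<open>Omega_star\<close> and its invariant core\<close>

definition Gstar :: "real \<Rightarrow> real \<times> real \<Rightarrow> real \<times> real" where
  "Gstar \<alpha> = (\<lambda>(x, y). (sgn x / x - cf_digit \<alpha> x, sgn x / y - cf_digit \<alpha> x))"

text \<open>Integer values of \<open>1 / \<bar>x\<bar> - \<alpha>\<close> are the jumps of the
  digit. Integer values of \<open>1 / \<bar>x\<bar>\<close> would be sent to abscissa 0 or lie on a
  boundary between branches of \<open>Fhat_flat\<close>; 0 itself is included because
  \<open>1 / 0 = 0\<close>.\<close>

definition exceptional_abscissae :: "real \<Rightarrow> real set" where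
  "exceptional_abscissae \<alpha> = {\<alpha> - 1, \<alpha>} \<union> {x. 1 / \<bar>x\<bar> \<in> \<int> \<or> 1 / \<bar>x\<bar> - \<alpha> \<in> \<int>}"

lemma countable_Ints: "countable (\<int> :: real set)"
  by (simp add: Ints_def)

text \<open>Dropping integer ordinates excludes y = -1, and also the images of points on the line z
  = 0 of \<open>Omega\<close>, which have been lost in \<open>Omega_star\<close>.\<close>

definition exceptional_lines :: "real \<Rightarrow> (real \<times> real) set" where
  "exceptional_lines \<alpha> = exceptional_abscissae \<alpha> \<times> UNIV \<union> UNIV \<times> \<int>"

lemma countable_exceptional_abscissae: "countable (exceptional_abscissae \<alpha>)"
proof -
  have "exceptional_abscissae \<alpha> \<subseteq> {\<alpha> - 1, \<alpha>} \<union> (\<Union>n\<in>\<int>. \<Union>c\<in>{0, \<alpha>}. {1 / (n + c), - 1 / (n + c)})"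
  proof
    fix x assume "x \<in> exceptional_abscissae \<alpha>"
    then consider "x = \<alpha> - 1 \<or> x = \<alpha>" | n c where "n \<in> \<int>" "c \<in> {0, \<alpha>}" "1 / \<bar>x\<bar> = n + c"
      unfolding exceptional_abscissae_def by (auto, metis add.right_neutral, metis diff_add_cancel)
    then show "x \<in> {\<alpha> - 1, \<alpha>} \<union> (\<Union>n\<in>\<int>. \<Union>c\<in>{0, \<alpha>}. {1 / (n + c), - 1 / (n + c)})"
    proof cases
      case 2
      have "\<bar>x\<bar> = 1 / (1 / \<bar>x\<bar>)" by simp
      then have "\<bar>x\<bar> = 1 / (n + c)" unfolding 2(3) .
      then have "x \<in> {1 / (n + c), - 1 / (n + c)}" by (auto simp: abs_if split: if_splits)
      then show ?thesis using 2 by blast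
    qed auto
  qed
  moreover have "countable ({\<alpha> - 1, \<alpha>} \<union> (\<Union>n\<in>(\<int>::real set). \<Union>c\<in>{0, \<alpha>}. {1 / (n + c), - 1 / (n + c)}))"
    by (intro countable_Un countable_UN countable_Ints) auto
  ultimately show ?thesis by (rule countable_subset)
qed

lemma exceptional_lines_null: "exceptional_lines \<alpha> \<in> null_sets mobius_measure"
  unfolding exceptional_lines_def
  by (intro null_sets.Un null_countable_lines countable_exceptional_abscissae countable_Ints)

lemma zero_exceptional: "0 \<in> exceptional_abscissae \<alpha>"
  by (simp add: exceptional_abscissae_def)

lemma measurable_cf_digit [measurable]: "cf_digit \<alpha> \<in> measurable borel (count_space UNIV)"
  unfolding cf_digit_def by measurable

lemma aut_digit: "s \<in> {-1, 1} \<Longrightarrow> measure_aut mobius_measure (diag_map (\<lambda>t. s / t - k))"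
proof -
  assume s: "s \<in> {-1, 1}"
  have "measure_aut mobius_measure (diag_map (\<lambda>t. inverse t - k))"
    by (rule aut_diag_comp[OF aut_shift aut_inverse])
  moreover have "measure_aut mobius_measure (diag_map (\<lambda>t. - inverse t - k))"
    by (rule aut_diag_comp[OF aut_shift aut_diag_comp[OF aut_uminus aut_inverse]])
  ultimately show ?thesis using s by (auto simp: divide_inverse)
qed

lemma Omega_star_borel [measurable]: "Omega_star \<alpha> \<in> sets borel"
proof -
  have c: "Omega \<alpha> \<in> sets borel" by (simp add: Omega_def)
  have "(\<lambda>z :: real \<times> real. (fst z, - 1 / snd z)) \<in> borel_measurable borel"
    unfolding borel_prod[symmetric] by measurable
  from measurable_sets[OF this c] have "{z. (fst z, - 1 / snd z) \<in> Omega \<alpha>} \<in> sets borel"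
    by (simp add: vimage_def)
  moreover have "{z :: real \<times> real. snd z \<noteq> 0} \<in> sets borel"
    by (intro borel_open open_Collect_neq continuous_intros)
  ultimately have "{z. (fst z, - 1 / snd z) \<in> Omega \<alpha>} \<inter> {z. snd z \<noteq> 0} \<in> sets borel" by (rule sets.Int)
  also have "{z. (fst z, - 1 / snd z) \<in> Omega \<alpha>} \<inter> {z. snd z \<noteq> 0} = Omega_star \<alpha>"
    by (auto simp: Omega_star_def)
  finally show ?thesis .
qed

lemma piecewise_aut_Gstar:
  "piecewise_aut mobius_measure (Gstar \<alpha>) (Omega_star \<alpha> \<inter> {z. fst z \<noteq> 0})"
proof (rule piecewise_autI[where I = "{-1, 1} \<times> (UNIV :: int set)"
      and P = "\<lambda>(s, k). Omega_star \<alpha> \<inter> {z. sgn (fst z) = s \<and> cf_digit \<alpha> (fst z) = k}"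
      and \<phi> = "\<lambda>(s, k). diag_map (\<lambda>t. s / t - of_int k)"])
  fix i :: "real \<times> int" assume i: "i \<in> {-1, 1} \<times> UNIV"
  obtain s k where sk: "i = (s, k)" by force
  have "{x \<in> space borel. sgn x = s \<and> cf_digit \<alpha> x = k} \<in> sets borel" by measurable
  then have "{x. sgn x = s \<and> cf_digit \<alpha> x = k} \<times> UNIV \<in> sets (borel :: (real \<times> real) measure)"
    unfolding borel_prod[symmetric] by (intro pair_measureI) auto
  also have "{x. sgn x = s \<and> cf_digit \<alpha> x = k} \<times> UNIV = {z :: real \<times> real. sgn (fst z) = s \<and> cf_digit \<alpha> (fst z) = k}"
    by auto
  finally have "{z :: real \<times> real. sgn (fst z) = s \<and> cf_digit \<alpha> (fst z) = k} \<in> sets borel" .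
  then show "(case i of (s, k) \<Rightarrow> Omega_star \<alpha> \<inter> {z. sgn (fst z) = s \<and> cf_digit \<alpha> (fst z) = k}) \<in> sets mobius_measure"
    by (simp add: sk)
  show "measure_aut mobius_measure (case i of (s, k) \<Rightarrow> diag_map (\<lambda>t. s / t - of_int k))"
    using aut_digit i sk by auto
next
  have "sgn x \<in> {-1, 1} \<longleftrightarrow> x \<noteq> 0" for x :: real by (simp add: sgn_if)
  then show "Omega_star \<alpha> \<inter> {z. fst z \<noteq> 0} =
    (\<Union>i\<in>{-1, 1} \<times> UNIV. case i of (s, k) \<Rightarrow> Omega_star \<alpha> \<inter> {z. sgn (fst z) = s \<and> cf_digit \<alpha> (fst z) = k})"
    by auto
qed (auto simp: Gstar_def diag_map_def)

context
  fixes \<alpha> :: real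
  assumes \<alpha>_pos: "0 < \<alpha>" and \<alpha>_half: "\<alpha> < 1 / 2"
begin

lemmas Omega_bounds' = Omega_bounds[OF \<alpha>_pos \<alpha>_half]

lemma Omega_star_bounds: "Omega_star \<alpha> \<subseteq> {\<alpha> - 1..\<alpha>} \<times> {..-1}"
proof -
  have "y \<le> -1" if "y \<noteq> 0" "0 \<le> - 1 / y" "- 1 / y \<le> 1" for y :: real
    using that by (cases "y > 0") (auto simp: field_simps)
  then show ?thesis using Omega_bounds' by (auto simp: Omega_star_def)
qed

text \<open>Here the positivity of \<alpha> enters: ordinates y \<le> -1 and abscissae x \<ge>
  \<alpha> - 1 are separated by a gap of width \<alpha>.\<close>

lemma emeasure_Omega_star: "emeasure mobius_measure (Omega_star \<alpha>) < \<infinity>"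
proof -
  have "emeasure mobius_measure (Omega_star \<alpha>) \<le> emeasure mobius_measure ({\<alpha> - 1..\<alpha>} \<times> {..-1})"
    using Omega_star_bounds by (intro emeasure_mono) (auto intro!: borel_closed closed_Times)
  also have "\<dots> < \<infinity>" using \<alpha>_pos by (intro emeasure_mobius_strip_finite') auto
  finally show ?thesis .
qed

lemma Gstar_Omega_star:
  assumes "(x, y) \<in> Omega_star \<alpha>" "x \<notin> exceptional_abscissae \<alpha>"
  shows "Gstar \<alpha> (x, y) \<in> Omega_star \<alpha>"
proof -
  let ?b = "cf_digit \<alpha> x"
  have x: "x \<noteq> 0" using assms(2) zero_exceptional by auto
  have y: "y \<noteq> 0" and om: "(x, - 1 / y) \<in> Omega \<alpha>" using assms(1) by (auto simp: Omega_star_def)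
  have "1 / \<bar>x\<bar> + 1 - \<alpha> \<notin> \<int>"
  proof
    assume "1 / \<bar>x\<bar> + 1 - \<alpha> \<in> \<int>"
    then have "(1 / \<bar>x\<bar> + 1 - \<alpha>) - 1 \<in> \<int>" by (rule Ints_diff) simp
    then show False using assms(2) by (simp add: exceptional_abscissae_def)
  qed
  then have "Ghat \<alpha> (x, - 1 / y) \<in> Omega \<alpha>" using Ghat_Omega[OF \<alpha>_pos \<alpha>_half om x] by simp
  then have g: "(1 / \<bar>x\<bar> - ?b, 1 / (?b + sgn x * (- 1 / y))) \<in> Omega \<alpha>" unfolding Ghat_nonzero[OF x] .
  have "\<alpha> - 1 \<le> x" "x \<le> \<alpha>" and z: "0 \<le> - 1 / y" "- 1 / y \<le> 1" using om Omega_bounds' by auto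
  then have b: "2 \<le> ?b" using cf_digit_ge_2[OF \<alpha>_pos \<alpha>_half x] by simp
  have "\<bar>sgn x * (- 1 / y)\<bar> \<le> 1" using z by (auto simp: sgn_if)
  then have ne: "?b + sgn x * (- 1 / y) \<noteq> 0" using b by linarith
  have "1 / \<bar>x\<bar> = sgn x / x" by (auto simp: sgn_if)
  moreover have "1 / (?b + sgn x * (- 1 / y)) = - 1 / (sgn x / y - ?b)"
  proof -
    have "?b + sgn x * (- 1 / y) = - (sgn x / y - ?b)" by simp
    then show ?thesis by (metis divide_minus_left divide_minus_right)
  qed
  moreover have "sgn x / y - ?b \<noteq> 0" using ne by simp
  ultimately show ?thesis using g by (simp add: Gstar_def Omega_star_def)
qed

lemma Omega_star_subset_Gstar_image:
  assumes "(u, v) \<in> Omega_star \<alpha>" "u \<noteq> \<alpha>" "v \<notin> \<int>"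
  shows "(u, v) \<in> Gstar \<alpha> ` (Omega_star \<alpha> \<inter> {z. fst z \<noteq> 0})"
proof -
  have v: "v \<noteq> 0" and om: "(u, - 1 / v) \<in> Omega \<alpha>" using assms(1) by (auto simp: Omega_star_def)
  have z: "0 < - 1 / v" using om Omega_bounds' v by (force simp: less_le)
  obtain x z' where xz: "(x, z') \<in> Omega \<alpha>" "x \<noteq> 0" "Ghat \<alpha> (x, z') = (u, - 1 / v)"
    using Omega_subset_Ghat_image[OF \<alpha>_pos \<alpha>_half om z assms(2)] .
  let ?b = "cf_digit \<alpha> x" and ?s = "sgn x"
  have eq: "u = 1 / \<bar>x\<bar> - ?b" "- 1 / v = 1 / (?b + ?s * z')" using xz(3) Ghat_nonzero[OF xz(2)] by auto
  have "- v = 1 / (- 1 / v)" by simp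
  then have v_eq: "- v = ?b + ?s * z'" unfolding eq(2) by simp
  have "z' \<noteq> 0"
  proof
    assume "z' = 0"
    then have "v = - of_int ?b" using v_eq by simp
    then show False using assms(3) by simp
  qed
  then have "(x, - 1 / z') \<in> Omega_star \<alpha>" using xz by (simp add: Omega_star_def)
  moreover have "Gstar \<alpha> (x, - 1 / z') = (u, v)"
    using eq(1) v_eq xz(2) by (auto simp: Gstar_def sgn_if)
  ultimately show ?thesis using xz(2) by (force simp: image_iff)
qed

text \<open>\<open>Gstar\<close> preserves the finite measure of \<open>Omega_star\<close> piece by piece and is onto, hence one-to-one.\<close>

lemma Gstar_bij_core:
  obtains E where "E \<in> sets borel" "E \<subseteq> Omega_star \<alpha> - exceptional_lines \<alpha>"
    "Omega_star \<alpha> - E \<in> null_sets mobius_measure" "bij_betw (Gstar \<alpha>) E E"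
proof -
  let ?D = "Omega_star \<alpha> \<inter> {z. fst z \<noteq> 0}"
  note pw = piecewise_aut_Gstar[of \<alpha>]
  note D = piecewise_aut_sets[OF pw]
  have fin: "emeasure mobius_measure ?D < \<infinity>"
    using emeasure_mono[of ?D "Omega_star \<alpha>" mobius_measure] emeasure_Omega_star by (auto simp: less_top top_unique)
  \<comment> \<open>Points mapped into an exceptional line are discarded as well, so that images of
    the remaining points have nonzero abscissa and stay in \<open>?D\<close>.\<close>
  let ?N = "exceptional_lines \<alpha> \<union> (Gstar \<alpha> -` exceptional_lines \<alpha> \<inter> ?D)"
  have N: "?N \<in> null_sets mobius_measure"
    using exceptional_lines_null piecewise_aut_vimage(2)[OF pw] by (intro null_sets.Un) auto
  have into: "Gstar \<alpha> z \<in> ?D" if "z \<in> ?D - ?N" for z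
  proof -
    obtain x y where z: "z = (x, y)" by force
    have x: "x \<notin> exceptional_abscissae \<alpha>" and xy: "(x, y) \<in> Omega_star \<alpha>" using that z by (auto simp: exceptional_lines_def)
    have "Gstar \<alpha> (x, y) \<notin> exceptional_lines \<alpha>" using that z by auto
    then have "fst (Gstar \<alpha> (x, y)) \<noteq> 0" using zero_exceptional[of \<alpha>] by (auto simp: exceptional_lines_def mem_Times_iff)
    then show ?thesis using Gstar_Omega_star[OF xy x] z by simp
  qed
  have onto: "?D - ?N \<subseteq> Gstar \<alpha> ` ?D"
  proof
    fix z assume z: "z \<in> ?D - ?N"
    obtain u v where uv: "z = (u, v)" by force
    have "(u, v) \<in> Omega_star \<alpha>" "u \<noteq> \<alpha>" "v \<notin> \<int>"
      using z uv by (auto simp: exceptional_lines_def exceptional_abscissae_def)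
    then show "z \<in> Gstar \<alpha> ` ?D" using Omega_star_subset_Gstar_image uv by blast
  qed
  obtain E where E: "E \<in> sets mobius_measure" "E \<subseteq> ?D - ?N" "?D - E \<in> null_sets mobius_measure" "bij_betw (Gstar \<alpha>) E E"
    using piecewise_aut_bij_core[OF pw space_mobius_measure fin N into onto] .
  have "Omega_star \<alpha> - E \<subseteq> (?D - E) \<union> {0} \<times> UNIV" by auto
  moreover have "(?D - E) \<union> {0} \<times> UNIV \<in> null_sets mobius_measure"
    using E(3) null_line_fst by (rule null_sets.Un)
  ultimately have "Omega_star \<alpha> - E \<in> null_sets mobius_measure"
    using E(1) by (intro null_sets_subset[of _ _ "Omega_star \<alpha> - E"]) auto
  then show ?thesis using that[of E] E by auto
qed

end

section \<open>The tower over the natural extension domain\<close>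

lemma k0_bounds:
  fixes \<alpha> :: real
  assumes "0 < \<alpha>" "\<alpha> < 1 / 2"
  shows "1 / (k0 \<alpha> + \<alpha>) \<le> \<alpha>" "1 / \<alpha> > k0 \<alpha> - 1 + \<alpha>" "2 \<le> k0 \<alpha>"
proof -
  have inv: "2 < 1 / \<alpha>" using assms by (simp add: field_simps)
  \<comment> \<open>As \<alpha> is positive, the second inequality forces k - 1 + \<alpha> > 0. Then
    both can be inverted, and they confine 1/\<alpha> - \<alpha> to the interval (k - 1, k].\<close>
  have iff: "1 / (of_int k + \<alpha>) \<le> \<alpha> \<and> \<alpha> < 1 / (of_int k - 1 + \<alpha>) \<longleftrightarrow> k = \<lceil>1 / \<alpha> - \<alpha>\<rceil>" for k :: int
  proof
    assume k: "1 / (of_int k + \<alpha>) \<le> \<alpha> \<and> \<alpha> < 1 / (of_int k - 1 + \<alpha>)"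
    then have "0 < 1 / (of_int k - 1 + \<alpha>)" using assms by linarith
    then have pos: "0 < of_int k - 1 + \<alpha>" by simp
    then have "of_int k - 1 + \<alpha> < 1 / \<alpha>" "1 / \<alpha> \<le> of_int k + \<alpha>" using k assms by (auto simp: field_simps)
    then show "k = \<lceil>1 / \<alpha> - \<alpha>\<rceil>" by (intro ceiling_unique[symmetric]) auto
  next
    assume k: "k = \<lceil>1 / \<alpha> - \<alpha>\<rceil>"
    then have "of_int k - 1 + \<alpha> < 1 / \<alpha>" "1 / \<alpha> \<le> of_int k + \<alpha>" by linarith+
    moreover have "0 < of_int k - 1 + \<alpha>" using k inv assms by linarith
    ultimately show "1 / (of_int k + \<alpha>) \<le> \<alpha> \<and> \<alpha> < 1 / (of_int k - 1 + \<alpha>)"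
      using assms by (auto simp: field_simps)
  qed
  have k: "k0 \<alpha> = \<lceil>1 / \<alpha> - \<alpha>\<rceil>" unfolding k0_def iff by simp
  show "1 / (k0 \<alpha> + \<alpha>) \<le> \<alpha>" using iff k by blast
  show "1 / \<alpha> > k0 \<alpha> - 1 + \<alpha>" "2 \<le> k0 \<alpha>" unfolding k using inv assms by linarith+
qed

lemma inverse_abs_gt_iff: "0 < c \<Longrightarrow> x \<noteq> 0 \<Longrightarrow> c < 1 / \<bar>x\<bar> \<longleftrightarrow> \<bar>x\<bar> < 1 / (c :: real)"
  and inverse_abs_ge_iff: "0 < c \<Longrightarrow> x \<noteq> 0 \<Longrightarrow> c \<le> 1 / \<bar>x\<bar> \<longleftrightarrow> \<bar>x\<bar> \<le> 1 / (c :: real)"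
  and inverse_abs_less_iff: "0 < c \<Longrightarrow> x \<noteq> 0 \<Longrightarrow> 1 / \<bar>x\<bar> < c \<longleftrightarrow> 1 / (c :: real) < \<bar>x\<bar>"
  by (auto simp: field_simps)

lemma sgn_div_self: "sgn x / x = 1 / \<bar>x :: real\<bar>"
  by (auto simp: sgn_if)

locale gstar_core =
  fixes \<alpha> :: real and E :: "(real \<times> real) set"
  assumes \<alpha>_pos: "0 < \<alpha>" and \<alpha>_half: "\<alpha> < 1 / 2"
    and E_borel [measurable]: "E \<in> sets borel"
    and E_sub: "E \<subseteq> Omega_star \<alpha> - exceptional_lines \<alpha>"
    and E_full: "Omega_star \<alpha> - E \<in> null_sets mobius_measure"
    and E_bij: "bij_betw (Gstar \<alpha>) E E"
begin

text \<open>In reciprocal coordinates, going up one floor subtracts 1. Floor 0 is set apart because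
  the formula with \<open>i = 0\<close> would reflect a point of negative abscissa through the
  origin instead of fixing it.\<close>

definition level :: "(real \<times> real) \<times> nat \<Rightarrow> real \<times> real" where
  "level = (\<lambda>(p, i). if i = 0 then p else diag_map (\<lambda>t. 1 / (sgn (fst p) / t - i)) p)"

text \<open>A floor \<open>i > 0\<close> has first coordinate 1 / (1/|x| - i), so the condition
  confines it to the open interval (0, 1). This is how the truncation x \<le> 1 of
  \<open>V_flat\<close> appears in the tower, up to the line x = 1.\<close>

definition tower :: "((real \<times> real) \<times> nat) set" where
  "tower = {(p, i). p \<in> E \<and> (i = 0 \<or> 1 < 1 / \<bar>fst p\<bar> - i)}"

definition tower_map :: "(real \<times> real) \<times> nat \<Rightarrow> (real \<times> real) \<times> nat" where
  "tower_map = (\<lambda>(p, i). if 1 < 1 / \<bar>fst p\<bar> - Suc i then (p, Suc i) else (Gstar \<alpha> p, 0))"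

definition V_core :: "(real \<times> real) set" where
  "V_core = level ` tower"

lemma E_D:
  assumes "(x, y) \<in> E"
  defines "X \<equiv> 1 / \<bar>x\<bar>" and "b \<equiv> cf_digit \<alpha> x"
  shows "x \<noteq> 0" "\<alpha> - 1 < x" "x < \<alpha>" "y < -1" "X \<notin> \<int>" "X - \<alpha> \<notin> \<int>" "2 \<le> b"
    "\<alpha> - 1 < X - b" "X - b < \<alpha>" "X - b \<noteq> 0" "1 + \<alpha> < X" "0 < x \<Longrightarrow> 2 < X"
    "Gstar \<alpha> (x, y) = (X - b, sgn x / y - b)" "(x, y) \<in> Omega_star \<alpha>"
proof -
  show om: "(x, y) \<in> Omega_star \<alpha>" using E_sub assms(1) by auto
  have ex: "x \<notin> exceptional_abscissae \<alpha>" "y \<notin> \<int>" using E_sub assms(1) by (auto simp: exceptional_lines_def)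
  show x0: "x \<noteq> 0" using ex zero_exceptional by auto
  have bd: "\<alpha> - 1 \<le> x" "x \<le> \<alpha>" "y \<le> -1" using Omega_star_bounds[OF \<alpha>_pos \<alpha>_half] om by auto
  show x: "\<alpha> - 1 < x" "x < \<alpha>" using bd ex by (auto simp: exceptional_abscissae_def less_le)
  have "y \<noteq> -1" using ex by (metis Ints_1 Ints_minus)
  then show "y < -1" using bd by simp
  show X: "X \<notin> \<int>" "X - \<alpha> \<notin> \<int>" using ex by (auto simp: exceptional_abscissae_def X_def)
  show "2 \<le> b" unfolding b_def using cf_digit_ge_2[OF \<alpha>_pos \<alpha>_half x0] x by simp
  have Xb: "\<alpha> - 1 \<le> X - b" "X - b < \<alpha>" unfolding X_def b_def using cf_digit_bounds[of x \<alpha>] by auto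
  show "X - b < \<alpha>" by fact
  have "X - b \<noteq> \<alpha> - 1"
  proof
    assume "X - b = \<alpha> - 1"
    then have "X - \<alpha> = of_int (b - 1)" by simp
    then show False using X(2) by (metis Ints_of_int)
  qed
  then show "\<alpha> - 1 < X - b" using Xb by simp
  show "X - b \<noteq> 0" using X(1) by (metis Ints_of_int eq_iff_diff_eq_0)
  have "(1 + \<alpha>) * \<bar>x\<bar> < 1"
  proof -
    have "(1 + \<alpha>) * \<bar>x\<bar> < (1 + \<alpha>) * (1 - \<alpha>)" using x \<alpha>_pos \<alpha>_half by (intro mult_strict_left_mono) auto
    also have "\<dots> \<le> 1" by (simp add: algebra_simps)
    finally show ?thesis .
  qed
  then show "1 + \<alpha> < X" unfolding X_def using x0 by (simp add: field_simps)
  show "0 < x \<Longrightarrow> 2 < X" unfolding X_def using x \<alpha>_half by (simp add: field_simps)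
  show "Gstar \<alpha> (x, y) = (X - b, sgn x / y - b)" by (simp add: Gstar_def X_def b_def sgn_div_self)
qed

lemma level_pos:
  assumes "((x, y), i) \<in> tower" and "i \<noteq> 0 \<or> 0 < x"
  shows "level ((x, y), i) = (1 / (1 / \<bar>x\<bar> - i), 1 / (sgn x / y - i))"
    and "1 < 1 / \<bar>x\<bar> - i" and "sgn x / y - i < 0"
proof -
  have E: "(x, y) \<in> E" and i: "i = 0 \<or> 1 < 1 / \<bar>x\<bar> - i" using assms(1) by (auto simp: tower_def)
  show "level ((x, y), i) = (1 / (1 / \<bar>x\<bar> - i), 1 / (sgn x / y - i))"
    using assms(2) by (cases "i = 0") (auto simp: level_def diag_map_def sgn_div_self)
  show "1 < 1 / \<bar>x\<bar> - i"
  proof (cases "i = 0")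
    case True
    then have "2 < 1 / \<bar>x\<bar>" "real i = 0" using assms(2) E_D(12)[OF E] by auto
    then show ?thesis by linarith
  qed (use i in auto)
  have lt: "sgn x / y < 1" using E_D(1,4)[OF E] by (auto simp: sgn_if field_simps)
  have "0 < x \<Longrightarrow> sgn x / y < 0" using E_D(4)[OF E] by (simp add: field_simps)
  then show "sgn x / y - i < 0"
  proof (cases "i = 0")
    case False
    then have "1 \<le> real i" by simp
    then show ?thesis using lt by linarith
  qed (use assms(2) in auto)
qed

lemma level_0: "level (p, 0) = p"
  by (simp add: level_def)

text \<open>Let W = 1/|x| - i be the reciprocal of the first coordinate. If W > 2, one unit is
  subtracted and the next floor is reached. If 1 + \<alpha> < W < 2, two units are subtracted at
  once and the point returns to the base at W - 2 < 0; if 1 < W < 1 + \<alpha>, one unit gives the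
  return at W - 1 > 0. The digit is accordingly i + 2 or i + 1. The boundary values of W are
  exceptional. A base point with x < 0 is not of the form 1 / W with W > 1 and needs its own
  case.\<close>

lemma Fhat_flat_level:
  assumes "t \<in> tower"
  shows "Fhat_flat \<alpha> (level t) = level (tower_map t)"
proof -
  obtain x y i where t: "t = ((x, y), i)" by (metis surj_pair)
  have tw: "((x, y), i) \<in> tower" and E: "(x, y) \<in> E" using assms t by (auto simp: tower_def)
  note ED = E_D[OF E]
  define X where "X = 1 / \<bar>x\<bar>"
  show ?thesis
  proof (cases "i \<noteq> 0 \<or> 0 < x")
    case True
    note lp = level_pos[OF tw True, folded X_def]
    define W where "W = X - i"
    define W' where "W' = sgn x / y - i"
    have W: "1 < W" "W' < 0" using lp by (auto simp: W_def W'_def)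
    have lv: "level t = (1 / W, 1 / W')" using lp t by (simp add: W_def W'_def)
    have XW: "X = W + i" by (simp add: W_def)
    have "W \<noteq> 2"
    proof
      assume "W = 2"
      then have "X = of_int (int i + 2)" using XW by simp
      then show False using ED(5) unfolding X_def by (metis Ints_of_int)
    qed
    moreover have "W \<noteq> 1 + \<alpha>"
    proof
      assume "W = 1 + \<alpha>"
      then have "X - \<alpha> = of_int (int i + 1)" using XW by simp
      then show False using ED(6) unfolding X_def by (metis Ints_of_int)
    qed
    ultimately consider "2 < W" | "1 + \<alpha> < W" "W < 2" | "W < 1 + \<alpha>" by linarith
    then show ?thesis
    proof cases
      case 1
      then have "Fhat_flat \<alpha> (1 / W, 1 / W') = (1 / (W - 1), 1 / (W' - 1))"
        using W by (auto simp: Fhat_flat_def field_simps)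
      moreover have "tower_map t = ((x, y), Suc i)" using 1 by (simp add: t tower_map_def W_def X_def)
      moreover have "level ((x, y), Suc i) = (1 / (W - 1), 1 / (W' - 1))"
        by (simp add: level_def diag_map_def W_def W'_def X_def sgn_div_self)
      ultimately show ?thesis using lv by simp
    next
      case 2
      have "Fhat_flat \<alpha> (1 / W, 1 / W') = (W - 2, W' - 2)"
        using 2 W \<alpha>_pos by (auto simp: Fhat_flat_def field_simps)
      moreover have "tower_map t = (Gstar \<alpha> (x, y), 0)" using 2 by (simp add: t tower_map_def W_def X_def)
      moreover have "cf_digit \<alpha> x = int i + 2"
        by (rule cf_digit_eqI[of _ "W - 2"]) (use 2 \<alpha>_pos XW in \<open>auto simp: X_def\<close>)
      ultimately show ?thesis using ED(13) lv by (simp add: level_0 W_def W'_def X_def)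
    next
      case 3
      have "Fhat_flat \<alpha> (1 / W, 1 / W') = (W - 1, W' - 1)"
        using 3 W \<alpha>_pos \<alpha>_half by (auto simp: Fhat_flat_def field_simps)
      moreover have "tower_map t = (Gstar \<alpha> (x, y), 0)" using 3 \<alpha>_half by (simp add: t tower_map_def W_def X_def)
      moreover have "cf_digit \<alpha> x = int i + 1"
        by (rule cf_digit_eqI[of _ "W - 1"]) (use 3 W \<alpha>_half XW in \<open>auto simp: X_def\<close>)
      ultimately show ?thesis using ED(13) lv by (simp add: level_0 W_def W'_def X_def)
    qed
  next
    case False
    then have x: "x < 0" "i = 0" using ED(1) by auto
    then have X: "X = - 1 / x" by (simp add: X_def)
    have lv: "level t = (x, y)" using x t by (simp add: level_0)
    have "X \<noteq> 2" using ED(5) unfolding X_def by (metis Ints_numeral)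
    then consider "2 < X" | "X < 2" by linarith
    then show ?thesis
    proof cases
      case 1
      then have "- 1 / 2 < x" using x X by (simp add: field_simps)
      then have "Fhat_flat \<alpha> (x, y) = (1 / (- 1 / x - 1), 1 / (- 1 / y - 1))"
        using x ED(4) by (auto simp: Fhat_flat_def field_simps)
      moreover have "tower_map t = ((x, y), Suc i)" using 1 x by (simp add: t tower_map_def X_def)
      moreover have "level ((x, y), Suc i) = (1 / (- 1 / x - 1), 1 / (- 1 / y - 1))"
        using x by (simp add: level_def diag_map_def)
      ultimately show ?thesis using lv by simp
    next
      case 2
      then have "x < - 1 / 2" using x X by (simp add: field_simps)
      then have "Fhat_flat \<alpha> (x, y) = (- 1 / x - 2, - 1 / y - 2)"
        using x ED(4) by (auto simp: Fhat_flat_def field_simps)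
      moreover have "tower_map t = (Gstar \<alpha> (x, y), 0)" using 2 x by (simp add: t tower_map_def X_def)
      moreover have "cf_digit \<alpha> x = 2"
        by (rule cf_digit_eqI[of _ "X - 2"]) (use 2 ED(11) \<alpha>_pos in \<open>auto simp: X_def\<close>)
      ultimately show ?thesis using ED(13) lv x by (simp add: level_0)
    qed
  qed
qed

text \<open>All levels above a point of \<open>E\<close> leave the tower at the same place, which recovers the point.\<close>

lemma Gstar_level:
  assumes "((x, y), i) \<in> tower"
  shows "Gstar \<alpha> (level ((x, y), i)) = Gstar \<alpha> (x, y)"
proof (cases "i \<noteq> 0 \<or> 0 < x")
  case True
  note lp = level_pos[OF assms True]
  have E: "(x, y) \<in> E" using assms by (auto simp: tower_def)
  let ?u = "1 / (1 / \<bar>x\<bar> - i)"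
  have "cf_digit \<alpha> ?u = cf_digit \<alpha> x - int i"
    by (rule cf_digit_eqI[of _ "1 / \<bar>x\<bar> - cf_digit \<alpha> x"]) (use E_D(8,9)[OF E] lp(2) in auto)
  then show ?thesis using lp E_D(13)[OF E] by (simp add: Gstar_def)
qed (use level_0 in auto)

lemma inj_on_level: "inj_on level tower"
proof (rule inj_onI)
  fix t t' assume t: "t \<in> tower" "t' \<in> tower" and eq: "level t = level t'"
  obtain x y i where xy: "t = ((x, y), i)" by (metis surj_pair)
  obtain x' y' i' where xy': "t' = ((x', y'), i')" by (metis surj_pair)
  have E: "(x, y) \<in> E" "(x', y') \<in> E" using t xy xy' by (auto simp: tower_def)
  have "Gstar \<alpha> (x, y) = Gstar \<alpha> (x', y')" using Gstar_level t xy xy' eq by metis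
  then have p: "x' = x" "y' = y" using E E_bij by (auto dest!: bij_betw_imp_inj_on inj_onD)
  note lp = level_pos[OF t(1)[unfolded xy]] and lp' = level_pos[OF t(2)[unfolded xy' p]]
  have x0: "x \<noteq> 0" using E_D(1)[OF E(1)] .
  have L: "level ((x, y), i) = level ((x, y), i')" using eq xy xy' p by simp
  have inv: "a = b" if "1 / a = 1 / b" for a b :: real using that by simp
  \<comment> \<open>Over a common base point the first coordinate separates the heights: 1 / (1/|x|
    - i) is positive and injective in i, whereas floor 0 over x < 0 is negative.\<close>
  consider "0 < x \<or> i \<noteq> 0 \<and> i' \<noteq> 0" | "i = 0" "i' = 0" | "x < 0" "i = 0" "i' \<noteq> 0" | "x < 0" "i \<noteq> 0" "i' = 0"
    using x0 by linarith
  then have "i = i'"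
  proof cases
    case 1
    then have "1 / (1 / \<bar>x\<bar> - i) = 1 / (1 / \<bar>x\<bar> - i')" using L lp(1) lp'(1) by (metis prod.inject)
    from inv[OF this] show ?thesis by simp
  next
    case 3
    then have "x = 1 / (1 / \<bar>x\<bar> - i')" using L lp'(1) by (metis level_0 prod.inject)
    moreover have "0 < 1 / (1 / \<bar>x\<bar> - i')" using lp'(2) 3 by auto
    ultimately show ?thesis using 3 by linarith
  next
    case 4
    then have "x = 1 / (1 / \<bar>x\<bar> - i)" using L lp(1) by (metis level_0 prod.inject)
    moreover have "0 < 1 / (1 / \<bar>x\<bar> - i)" using lp(2) 4 by auto
    ultimately show ?thesis using 4 by linarith
  qed simp
  then show "t = t'" using xy xy' p by simp
qed

lemma bij_tower_map: "bij_betw tower_map tower tower"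
  unfolding bij_betw_def
proof
  have inj: "inj_on (Gstar \<alpha>) E" and im: "Gstar \<alpha> ` E = E" using E_bij by (auto simp: bij_betw_def)
  show "inj_on tower_map tower"
  proof (rule inj_onI)
    fix t t' assume t: "t \<in> tower" "t' \<in> tower" and eq: "tower_map t = tower_map t'"
    obtain p i where p: "t = (p, i)" by (cases t)
    obtain p' i' where p': "t' = (p', i')" by (cases t')
    show "t = t'"
    proof (cases "1 < 1 / \<bar>fst p\<bar> - Suc i \<or> 1 < 1 / \<bar>fst p'\<bar> - Suc i'")
      case True
      then show ?thesis using eq p p' by (auto simp: tower_map_def split: if_splits)
    next
      case False
      then have "p = p'" using eq p p' t inj by (auto simp: tower_map_def tower_def dest: inj_onD)
      moreover have "i = i'"
        using False t p p' \<open>p = p'\<close> by (auto simp: tower_def) 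
      ultimately show ?thesis using p p' by simp
    qed
  qed
  show "tower_map ` tower = tower"
  proof
    show "tower_map ` tower \<subseteq> tower"
    proof
      fix t assume "t \<in> tower_map ` tower"
      then obtain p i where p: "(p, i) \<in> tower" "t = tower_map (p, i)" by auto
      then have "Gstar \<alpha> p \<in> E" using im by (auto simp: tower_def)
      then show "t \<in> tower" using p by (auto simp: tower_map_def tower_def)
    qed
    show "tower \<subseteq> tower_map ` tower"
    proof
      fix t assume t: "t \<in> tower"
      obtain q i where q: "t = (q, i)" by (cases t)
      show "t \<in> tower_map ` tower"
      proof (cases i)
        case (Suc j)
        then have "(q, j) \<in> tower" "tower_map (q, j) = t" using t q by (auto simp: tower_def tower_map_def)
        then show ?thesis by blast
      next
        case 0
        have "q \<in> Gstar \<alpha> ` E" using t q im by (auto simp: tower_def)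
        then obtain p where p: "p \<in> E" "Gstar \<alpha> p = q" by blast
        \<comment> \<open>A point of floor 0 is reached from the top floor above its
          \<open>Gstar\<close>-preimage \<open>p\<close>, and \<open>n\<close> is that top floor.
          Minimality gives membership of (p, n) in the tower.\<close>
        define n where "n = (LEAST n::nat. \<not> 1 < 1 / \<bar>fst p\<bar> - Suc n)"
        have "\<exists>n::nat. \<not> 1 < 1 / \<bar>fst p\<bar> - Suc n"
        proof -
          obtain n :: nat where "1 / \<bar>fst p\<bar> < n" using reals_Archimedean2 by blast
          then show ?thesis by (intro exI[of _ n]) simp
        qed
        then have n: "\<not> 1 < 1 / \<bar>fst p\<bar> - Suc n" unfolding n_def by (rule LeastI_ex)
        have "n = 0 \<or> 1 < 1 / \<bar>fst p\<bar> - n"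
          using not_less_Least[of "n - 1" "\<lambda>n. \<not> 1 < 1 / \<bar>fst p\<bar> - Suc n"] n_def by (cases n) auto
        then have "(p, n) \<in> tower" using p by (simp add: tower_def)
        moreover have "tower_map (p, n) = t" using n p q 0 by (simp add: tower_map_def)
        ultimately show ?thesis by blast
      qed
    qed
  qed
qed

lemma bij_Fhat_flat_V_core: "bij_betw (Fhat_flat \<alpha>) V_core V_core"
proof -
  have lv: "bij_betw level tower V_core" using inj_on_level by (simp add: V_core_def bij_betw_def)
  have "bij_betw (level \<circ> tower_map) tower V_core" by (rule bij_betw_trans[OF bij_tower_map lv])
  then have "bij_betw (Fhat_flat \<alpha> \<circ> level) tower V_core"
    by (subst bij_betw_cong[of _ _ "level \<circ> tower_map"]) (auto simp: Fhat_flat_level)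
  then show ?thesis using bij_betw_comp_iff[OF lv] by blast
qed

end

section \<open>Measurability of \<open>V_flat\<close> and of the branches of
  \<open>Fhat_flat\<close>\<close>

lemma strip_borel:
  assumes "A \<in> sets borel"
  shows "A \<times> UNIV \<in> sets (borel :: (real \<times> real) measure)" "UNIV \<times> A \<in> sets (borel :: (real \<times> real) measure)"
  using assms unfolding borel_prod[symmetric] by (auto intro: pair_measureI)

lemma diag_map_image_borel:
  "measure_aut mobius_measure (diag_map f) \<Longrightarrow> A \<in> sets borel \<Longrightarrow> diag_map f ` A \<in> sets borel"
  using measure_aut_image(1)[of mobius_measure "diag_map f" A] by simp

lemma diag_map_vimage_borel:
  "f \<in> borel_measurable borel \<Longrightarrow> A \<in> sets borel \<Longrightarrow> diag_map f -` A \<in> sets borel"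
  using measurable_sets[OF measurable_diag_map, of f A] by simp

lemma Omega_star_neg_borel: "Omega_star_neg \<alpha> k \<in> sets borel"
proof -
  have "Omega_star_neg \<alpha> k =
    (if k = 2 then Omega_star \<alpha> \<inter> {\<alpha> - 1<..- 1 / (2 + \<alpha>)} \<times> UNIV
     else if k \<ge> 3 then Omega_star \<alpha> \<inter> {- 1 / (of_int k - 1 + \<alpha>)<..- 1 / (of_int k + \<alpha>)} \<times> UNIV else {})"
    by (auto simp: Omega_star_neg_def)
  then show ?thesis using Omega_star_borel strip_borel by simp
qed

lemma Omega_star_pos_borel: "Omega_star_pos \<alpha> k \<in> sets borel"
proof -
  have "Omega_star_pos \<alpha> k =
    (if k = k0 \<alpha> then Omega_star \<alpha> \<inter> {1 / (of_int k + \<alpha>)<..<\<alpha>} \<times> UNIV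
     else if k > k0 \<alpha> then Omega_star \<alpha> \<inter> {1 / (of_int k + \<alpha>)<..1 / (of_int k - 1 + \<alpha>)} \<times> UNIV else {})"
    by (auto simp: Omega_star_pos_def)
  then show ?thesis using Omega_star_borel strip_borel by simp
qed

lemma V_flat_borel: "V_flat \<alpha> \<in> sets borel"
proof -
  have "Omega_hat_neg \<alpha> k = diag_map (\<lambda>t. - 1 / t) -` Omega_star_neg \<alpha> k" for k
    by (auto simp: Omega_hat_neg_def diag_map_def)
  then have n: "Omega_hat_neg \<alpha> k \<in> sets borel" for k
    using diag_map_vimage_borel[OF _ Omega_star_neg_borel] by simp
  have "Omega_hat_pos \<alpha> k = diag_map (\<lambda>t. 1 / t) -` Omega_star_pos \<alpha> k" for k
    by (auto simp: Omega_hat_pos_def diag_map_def)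
  then have p: "Omega_hat_pos \<alpha> k \<in> sets borel" for k
    using diag_map_vimage_borel[OF _ Omega_star_pos_borel] by simp
  have "diag_shift c A = diag_map (\<lambda>t. t - of_int c) ` A" for c A
    by (simp add: diag_shift_def diag_map_def)
  then have sh: "A \<in> sets borel \<Longrightarrow> diag_shift c A \<in> sets borel" for c A
    using diag_map_image_borel[OF aut_shift] by simp
  have lev: "Upsilon_level \<alpha> j \<in> sets borel" for j
    unfolding Upsilon_level_def
    by (intro sets.Un sets.countable_UN'' countableI_type sh n p)
  have U: "Upsilon \<alpha> \<in> sets borel" unfolding Upsilon_def
    by (intro sets.countable_UN'' countableI_type lev)
  have "Upsilon_inv \<alpha> = diag_map (\<lambda>t. 1 / t) -` Upsilon \<alpha> \<inter> (- {0}) \<times> UNIV \<inter> UNIV \<times> (- {0})"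
    by (auto simp: Upsilon_inv_def diag_map_def)
  then have UI: "Upsilon_inv \<alpha> \<in> sets borel"
    using diag_map_vimage_borel[OF _ U, of "\<lambda>t. 1 / t"] strip_borel[of "- {0}"] by auto
  have "V_flat \<alpha> = (Omega_star \<alpha> \<union> Upsilon_inv \<alpha>) \<inter> {..1} \<times> UNIV"
    by (auto simp: V_flat_def V_def)
  then show ?thesis using UI Omega_star_borel strip_borel(1)[of "{..1}"] by auto
qed

lemma aut_lift: "s \<in> {-1, 1} \<Longrightarrow> measure_aut mobius_measure (diag_map (\<lambda>t. 1 / (s / t - k)))"
  using aut_diag_comp[OF aut_inverse aut_digit] by (simp add: inverse_eq_divide)

text \<open>The branches are rewritten in terms of 1/t to make them composites of shifts, negation
  and inversion. Both axes must go: at t = 0 the rewriting fails under HOL division, for example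
  \<open>(1 - 2 * 0) / 0 = 0\<close> but \<open>1 / 0 - 2 = -2\<close>.\<close>

lemma piecewise_aut_Fhat_flat:
  assumes "0 < \<alpha>" "\<alpha> < 1 / 2"
  shows "piecewise_aut mobius_measure (Fhat_flat \<alpha>) {z. fst z \<noteq> 0 \<and> snd z \<noteq> 0}"
proof (rule piecewise_autI[where I = "{..<5::nat}"
    and P = "\<lambda>i. [{..<- 1 / 2}, {- 1 / 2..<0}, {0<..<1 / 2}, {1 / 2..1 / (1 + \<alpha>)}, {1 / (1 + \<alpha>)<..}] ! i \<times> (- {0})"
    and \<phi> = "\<lambda>i. diag_map ([\<lambda>t. - 1 / t - 2, \<lambda>t. 1 / (- 1 / t - 1), \<lambda>t. 1 / (1 / t - 1), \<lambda>t. 1 / t - 2, \<lambda>t. 1 / t - 1] ! i)"])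
  have half: "1 / 2 < 1 / (1 + \<alpha>)" using assms by (simp add: field_simps)
  fix i :: nat assume "i \<in> {..<5}"
  then have i: "i \<in> {0, 1, 2, 3, 4}" by auto
  let ?P = "\<lambda>i. [{..<- 1 / 2}, {- 1 / 2..<0}, {0<..<1 / 2}, {1 / 2..1 / (1 + \<alpha>)}, {1 / (1 + \<alpha>)<..}] ! i"
  have "?P i \<in> sets borel" using i by auto
  then have "?P i \<times> (- {0::real}) \<in> sets (borel :: (real \<times> real) measure)"
    unfolding borel_prod[symmetric] by (intro pair_measureI) auto
  then show "?P i \<times> (- {0}) \<in> sets mobius_measure" by simp
  show "measure_aut mobius_measure (diag_map ([\<lambda>t. - 1 / t - 2, \<lambda>t. 1 / (- 1 / t - 1), \<lambda>t. 1 / (1 / t - 1), \<lambda>t. 1 / t - 2, \<lambda>t. 1 / t - 1] ! i))"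
    using i aut_digit[of "-1" 2] aut_digit[of 1 2] aut_digit[of 1 1] aut_lift[of "-1" 1] aut_lift[of 1 1] by auto
  fix z :: "real \<times> real" assume z: "z \<in> ?P i \<times> (- {0})"
  obtain x y where xy: "z = (x, y)" by force
  have inv1: "1 / (- 1 / t - 1) = - (t / (1 + t))" "1 / (1 / t - 1) = t / (1 - t)" if "t \<noteq> 0" for t :: real
  proof -
    have "- 1 / t - 1 = - ((1 + t) / t)" "1 / t - 1 = (1 - t) / t" using that by (auto simp: field_simps)
    then show "1 / (- 1 / t - 1) = - (t / (1 + t))" "1 / (1 / t - 1) = t / (1 - t)" by simp_all
  qed
  have inv2: "- 1 / t - 2 = - ((1 + 2 * t) / t)" "1 / t - 2 = (1 - 2 * t) / t" "1 / t - 1 = (1 - t) / t"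
    if "t \<noteq> 0" for t :: real using that by (auto simp: field_simps)
  consider "i = 0" | "i = 1" | "i = 2" | "i = 3" | "i = 4" using i by auto
  then show "Fhat_flat \<alpha> z = diag_map ([\<lambda>t. - 1 / t - 2, \<lambda>t. 1 / (- 1 / t - 1), \<lambda>t. 1 / (1 / t - 1), \<lambda>t. 1 / t - 2, \<lambda>t. 1 / t - 1] ! i) z"
  proof cases
    case 1
    then have "x < - 1 / 2" "y \<noteq> 0" using z xy by auto
    then show ?thesis using 1 inv2 by (simp add: xy Fhat_flat_def diag_map_def)
  next
    case 2
    then have "\<not> x < - 1 / 2" "x < 0" "y \<noteq> 0" using z xy by auto
    then show ?thesis using 2 inv1 by (simp add: xy Fhat_flat_def diag_map_def)
  next
    case 3
    then have "0 < x" "x < 1 / 2" "y \<noteq> 0" using z xy by auto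
    then show ?thesis using 3 inv1 by (simp add: xy Fhat_flat_def diag_map_def)
  next
    case 4
    then have "1 / 2 \<le> x" "x \<le> 1 / (1 + \<alpha>)" "y \<noteq> 0" using z xy by auto
    then show ?thesis using 4 inv2 by (simp add: xy Fhat_flat_def diag_map_def)
  next
    case 5
    then have "1 / (1 + \<alpha>) < x" "y \<noteq> 0" using z xy by auto
    then show ?thesis using 5 inv2 half by (simp add: xy Fhat_flat_def diag_map_def)
  qed
next
  have half: "1 / 2 < 1 / (1 + \<alpha>)" using assms by (simp add: field_simps)
  have eq: "{..<5::nat} = {0, 1, 2, 3, 4}" by auto
  have "x \<noteq> 0 \<longleftrightarrow> x < - 1 / 2 \<or> (- 1 / 2 \<le> x \<and> x < 0) \<or> (0 < x \<and> x < 1 / 2) \<or>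
      (1 / 2 \<le> x \<and> x \<le> 1 / (1 + \<alpha>)) \<or> 1 / (1 + \<alpha>) < x" for x :: real
    using half by linarith
  then show "{z. fst z \<noteq> 0 \<and> snd z \<noteq> 0} =
    (\<Union>i\<in>{..<5}. [{..<- 1 / 2}, {- 1 / 2..<0}, {0<..<1 / 2}, {1 / 2..1 / (1 + \<alpha>)}, {1 / (1 + \<alpha>)<..}] ! i \<times> (- {0}))"
    unfolding eq by (intro set_eqI) (simp add: mem_Times_iff, blast)
qed (auto simp: lessThan_empty_iff)

section \<open>Comparison of the tower with \<open>V_flat\<close>\<close>

context gstar_core
begin

lemma Omega_star_neg_D:
  assumes "(x, y) \<in> Omega_star_neg \<alpha> k"
  shows "(x, y) \<in> Omega_star \<alpha>" "x < 0" "of_int k - 1 + \<alpha> \<le> 1 / \<bar>x\<bar>" "2 \<le> k"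
proof -
  show om: "(x, y) \<in> Omega_star \<alpha>" and k: "2 \<le> k" using assms by (auto simp: Omega_star_neg_def split: if_splits)
  have "x \<le> - 1 / (k + \<alpha>)" using assms by (auto simp: Omega_star_neg_def split: if_splits)
  moreover have "- 1 / (k + \<alpha>) < 0" using k \<alpha>_pos by simp
  ultimately show x: "x < 0" by linarith
  have "\<bar>x\<bar> < 1 / (of_int k - 1 + \<alpha>)"
  proof (cases "k = 2")
    case True
    then have "\<bar>x\<bar> < 1 - \<alpha>" using assms x by (auto simp: Omega_star_neg_def)
    also have "1 - \<alpha> \<le> 1 / (1 + \<alpha>)" using \<alpha>_pos by (simp add: field_simps)
    finally show ?thesis using True by simp
  next
    case False
    then show ?thesis using assms x by (auto simp: Omega_star_neg_def split: if_splits)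
  qed
  then show "of_int k - 1 + \<alpha> \<le> 1 / \<bar>x\<bar>" using inverse_abs_gt_iff[of "of_int k - 1 + \<alpha>" x] x k \<alpha>_pos by auto
qed

lemma Omega_star_pos_D:
  assumes "(x, y) \<in> Omega_star_pos \<alpha> k"
  shows "(x, y) \<in> Omega_star \<alpha>" "0 < x" "of_int k - 1 + \<alpha> \<le> 1 / \<bar>x\<bar>" "2 \<le> k"
proof -
  note k0 = k0_bounds[OF \<alpha>_pos \<alpha>_half]
  show om: "(x, y) \<in> Omega_star \<alpha>" and k: "2 \<le> k" using assms k0 by (auto simp: Omega_star_pos_def split: if_splits)
  have "1 / (k + \<alpha>) < x" using assms by (auto simp: Omega_star_pos_def split: if_splits)
  moreover have "0 < 1 / (k + \<alpha>)" using k \<alpha>_pos by simp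
  ultimately show x: "0 < x" by linarith
  show "of_int k - 1 + \<alpha> \<le> 1 / \<bar>x\<bar>"
  proof (cases "k = k0 \<alpha>")
    case True
    then have "x < \<alpha>" using assms by (auto simp: Omega_star_pos_def)
    then have "1 / \<alpha> < 1 / x" using x by (simp add: frac_less2)
    then show ?thesis using True k0 x by simp
  next
    case False
    then have "\<bar>x\<bar> \<le> 1 / (of_int k - 1 + \<alpha>)" using assms x by (auto simp: Omega_star_pos_def split: if_splits)
    then show ?thesis using inverse_abs_ge_iff[of "of_int k - 1 + \<alpha>" x] x k \<alpha>_pos by auto
  qed
qed

text \<open>For digit k the number 1/|x| lies strictly between k - 1 + \<alpha> and k + \<alpha>,
  and inverting this gives the cylinder. In the outermost cylinders the end of the interval takes
  over one bound; on the positive side 1/|x| > 1/\<alpha> shows that no digit falls below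
  \<open>k0\<close>.\<close>

lemma E_cylinder:
  assumes "(x, y) \<in> E"
  shows "x < 0 \<Longrightarrow> (x, y) \<in> Omega_star_neg \<alpha> (cf_digit \<alpha> x)"
    and "0 < x \<Longrightarrow> (x, y) \<in> Omega_star_pos \<alpha> (cf_digit \<alpha> x)"
proof -
  note ED = E_D[OF assms]
  let ?b = "cf_digit \<alpha> x"
  have b: "0 < of_int ?b - 1 + \<alpha>" "0 < ?b + \<alpha>" using ED(7) \<alpha>_pos by auto
  have "of_int ?b - 1 + \<alpha> < 1 / \<bar>x\<bar>" "1 / \<bar>x\<bar> < ?b + \<alpha>" using ED(8,9) by auto
  then have x: "\<bar>x\<bar> < 1 / (of_int ?b - 1 + \<alpha>)" "1 / (?b + \<alpha>) < \<bar>x\<bar>"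
    using inverse_abs_gt_iff[OF b(1) ED(1)] inverse_abs_less_iff[OF b(2) ED(1)] by auto
  show "x < 0 \<Longrightarrow> (x, y) \<in> Omega_star_neg \<alpha> ?b"
    using x ED(2,7,14) by (auto simp: Omega_star_neg_def)
  note k0 = k0_bounds[OF \<alpha>_pos \<alpha>_half]
  assume "0 < x"
  then have "1 / \<alpha> < 1 / \<bar>x\<bar>" using ED(3) by (simp add: frac_less2)
  then have "k0 \<alpha> < ?b + 1" using k0(2) ED(9) by linarith
  then show "(x, y) \<in> Omega_star_pos \<alpha> ?b"
    using x \<open>0 < x\<close> ED(3,14) by (auto simp: Omega_star_pos_def)
qed

lemma V_core_subset: "V_core \<subseteq> V_flat \<alpha>"
proof
  fix v assume "v \<in> V_core"
  then obtain t where t: "t \<in> tower" "v = level t" by (auto simp: V_core_def)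
  obtain x y i where xyi: "t = ((x, y), i)" by (metis surj_pair)
  have E: "(x, y) \<in> E" using t xyi by (auto simp: tower_def)
  note ED = E_D[OF E]
  show "v \<in> V_flat \<alpha>"
  proof (cases "i = 0")
    case True
    then show ?thesis using ED(3,14) \<alpha>_half t xyi by (simp add: level_0 V_flat_def V_def)
  next
    case False
    note lp = level_pos[OF t(1)[unfolded xyi], OF disjI1[OF False]]
    let ?b = "cf_digit \<alpha> x"
    let ?W = "1 / \<bar>x\<bar> - i" and ?W' = "sgn x / y - i"
    \<comment> \<open>Floor i over a point of digit k belongs to \<open>Upsilon_level\<close> with
      index k - i. The index is positive since 1/|x| - i > 1 while 1/|x| - k < \<alpha> < 1.\<close>
    have "real_of_int (int i) < ?b" using lp(2) ED(9) \<alpha>_half by linarith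
    then have j: "1 \<le> ?b - int i" "?b - int i + 1 \<le> ?b" using False by linarith+
    have "(?W, ?W') \<in> Upsilon_level \<alpha> (?b - int i)"
    proof (cases "x < 0")
      case True
      have "(- 1 / x, - 1 / y) \<in> Omega_hat_neg \<alpha> ?b"
        using E_cylinder(1)[OF E True] by (simp add: Omega_hat_neg_def)
      moreover have "(?W, ?W') = (case (- 1 / x, - 1 / y) of (x, y) \<Rightarrow> (x - of_int (?b - (?b - int i)), y - of_int (?b - (?b - int i))))"
        using True by simp
      ultimately have "(?W, ?W') \<in> diag_shift (?b - (?b - int i)) (Omega_hat_neg \<alpha> ?b)"
        unfolding diag_shift_def by (rule image_eqI[rotated])
      then show ?thesis unfolding Upsilon_level_def using j(2) by blast
    next
      case False
      then have "0 < x" using ED(1) by simp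
      have "(1 / x, 1 / y) \<in> Omega_hat_pos \<alpha> ?b"
        using E_cylinder(2)[OF E \<open>0 < x\<close>] by (simp add: Omega_hat_pos_def)
      moreover have "(?W, ?W') = (case (1 / x, 1 / y) of (x, y) \<Rightarrow> (x - of_int (?b - (?b - int i)), y - of_int (?b - (?b - int i))))"
        using \<open>0 < x\<close> by simp
      ultimately have "(?W, ?W') \<in> diag_shift (?b - (?b - int i)) (Omega_hat_pos \<alpha> ?b)"
        unfolding diag_shift_def by (rule image_eqI[rotated])
      then show ?thesis unfolding Upsilon_level_def using j(2) by blast
    qed
    then have "(?W, ?W') \<in> Upsilon \<alpha>" unfolding Upsilon_def using j(1) by blast
    moreover have "?W \<noteq> 0" "?W' \<noteq> 0" "1 / ?W \<le> 1" using lp by auto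
    ultimately show ?thesis using lp(1) t xyi by (simp add: V_flat_def V_def Upsilon_inv_def)
  qed
qed

text \<open>A piece of \<open>Upsilon\<close> shifted by k - j is floor i = k - j. On a cylinder of
  index k one has 1/|x| \<ge> k - 1 + \<alpha>, hence 1/|x| - i \<ge> j - 1 + \<alpha> > 0. So the
  first coordinate is positive, and its being at most 1 turns into a lower bound for the
  reciprocal.\<close>

lemma V_flat_cases:
  assumes "v \<in> V_flat \<alpha>"
  obtains "v \<in> Omega_star \<alpha>"
  | i p where "p \<in> Omega_star \<alpha>" "fst p \<noteq> 0" "i \<noteq> 0" "v = level (p, i)" "1 \<le> 1 / \<bar>fst p\<bar> - real i"
proof -
  obtain x y where v: "v = (x, y)" by force
  consider "v \<in> Omega_star \<alpha>" | "v \<in> Upsilon_inv \<alpha>" using assms by (auto simp: V_flat_def V_def)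
  then show ?thesis
  proof cases
    case 2
    have x1: "x \<le> 1" using assms v by (auto simp: V_flat_def)
    from 2 v have xy: "x \<noteq> 0" "y \<noteq> 0" "(1 / x, 1 / y) \<in> Upsilon \<alpha>" by (auto simp: Upsilon_inv_def)
    then obtain j where j: "1 \<le> j" "(1 / x, 1 / y) \<in> Upsilon_level \<alpha> j" by (auto simp: Upsilon_def)
    then obtain k a b where k: "j + 1 \<le> k" "(1 / x, 1 / y) = (a - of_int (k - j), b - of_int (k - j))"
      and ab: "(a, b) \<in> Omega_hat_neg \<alpha> k \<or> (a, b) \<in> Omega_hat_pos \<alpha> k"
      unfolding Upsilon_level_def diag_shift_def by fastforce
    obtain s :: real where s: "s = -1 \<and> (s / a, s / b) \<in> Omega_star_neg \<alpha> k \<or> s = 1 \<and> (s / a, s / b) \<in> Omega_star_pos \<alpha> k"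
      using ab that[of "-1"] that[of 1] unfolding Omega_hat_neg_def Omega_hat_pos_def by auto
    define i where "i = nat (k - j)"
    have i: "i \<noteq> 0" "real_of_int (k - j) = real i" using k(1) by (auto simp: i_def)
    let ?p = "(s / a, s / b)"
    have p: "?p \<in> Omega_star \<alpha>" "sgn (fst ?p) = s" "of_int k - 1 + \<alpha> \<le> 1 / \<bar>fst ?p\<bar>"
    proof -
      have "?p \<in> Omega_star \<alpha> \<and> sgn (s / a) = s \<and> of_int k - 1 + \<alpha> \<le> 1 / \<bar>s / a\<bar>"
        using s
      proof (elim disjE conjE)
        assume "s = -1" and m: "?p \<in> Omega_star_neg \<alpha> k"
        show ?thesis using Omega_star_neg_D(1,3)[OF m] sgn_neg[OF Omega_star_neg_D(2)[OF m]] \<open>s = -1\<close> by metis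
      next
        assume "s = 1" and m: "?p \<in> Omega_star_pos \<alpha> k"
        show ?thesis using Omega_star_pos_D(1,3)[OF m] sgn_pos[OF Omega_star_pos_D(2)[OF m]] \<open>s = 1\<close> by metis
      qed
      then show "?p \<in> Omega_star \<alpha>" "sgn (fst ?p) = s" "of_int k - 1 + \<alpha> \<le> 1 / \<bar>fst ?p\<bar>"
        unfolding fst_conv by blast+
    qed
    have s1: "s \<in> {-1, 1}" using s by auto
    have ab': "sgn (fst ?p) / fst ?p = a" "sgn (fst ?p) / snd ?p = b" unfolding p(2) using s1 by auto
    then have a: "1 / \<bar>fst ?p\<bar> = a" unfolding sgn_div_self by blast
    have "level (?p, i) = (1 / (sgn (fst ?p) / fst ?p - i), 1 / (sgn (fst ?p) / snd ?p - i))"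
      using i(1) by (simp add: level_def diag_map_def)
    also have "\<dots> = (1 / (a - real i), 1 / (b - real i))" unfolding ab' ..
    also have "\<dots> = (1 / (1 / x), 1 / (1 / y))" using k(2) i(2) by simp
    finally have lv: "v = level (?p, i)" using v by simp
    have "\<alpha> \<le> a - real i" using p(3) j(1) unfolding a i(2)[symmetric] by linarith
    moreover have "1 / x = a - real i" using k(2) i(2) by simp
    ultimately have "0 < x" using \<alpha>_pos by (metis less_le_trans zero_less_divide_1_iff)
    then have "1 \<le> 1 / x" using x1 by simp
    then have "1 \<le> 1 / \<bar>fst ?p\<bar> - real i" using a \<open>1 / x = a - real i\<close> by simp
    moreover have "fst ?p \<noteq> 0" using p(2) s1 by auto
    ultimately show ?thesis using that(2)[OF p(1) _ i(1) lv] by blast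
  qed (use that in blast)
qed

lemma V_core_borel: "V_core \<in> sets borel"
proof -
  let ?S = "\<lambda>s i. {x. sgn x = s \<and> 1 < 1 / \<bar>x\<bar> - real i}"
  let ?U = "\<Union>s\<in>{-1, 1}. \<Union>i\<in>{1..}. diag_map (\<lambda>t. 1 / (s / t - real i)) ` (E \<inter> ?S s i \<times> UNIV)"
  have "?S s i \<in> sets borel" for s i
  proof -
    have "{x \<in> space borel. sgn x = s \<and> 1 < 1 / \<bar>x\<bar> - real i} \<in> sets borel" by measurable
    then show ?thesis by simp
  qed
  then have "?U \<in> sets borel"
    by (intro sets.countable_UN'' countableI_type sets.finite_UN diag_map_image_borel aut_lift sets.Int E_borel strip_borel(1)) auto
  moreover have "V_core = E \<union> ?U"
  proof
    show "V_core \<subseteq> E \<union> ?U"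
    proof
      fix v assume "v \<in> V_core"
      then obtain p i where p: "(p, i) \<in> tower" "v = level (p, i)" by (auto simp: V_core_def)
      have E: "p \<in> E" using p by (auto simp: tower_def)
      show "v \<in> E \<union> ?U"
      proof (cases "i = 0")
        case False
        have "fst p \<noteq> 0" using E E_D(1)[of "fst p" "snd p"] by simp
        then have "sgn (fst p) \<in> {-1, 1}" by (simp add: sgn_if)
        moreover have "p \<in> E \<inter> ?S (sgn (fst p)) i \<times> UNIV" using p E False by (auto simp: tower_def mem_Times_iff)
        moreover have "v = diag_map (\<lambda>t. 1 / (sgn (fst p) / t - real i)) p" using p False by (simp add: level_def)
        ultimately show ?thesis using False by (intro UnI2 UN_I[of "sgn (fst p)"] UN_I[of i]) auto
      qed (use p E in \<open>simp add: level_0\<close>)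
    qed
    show "E \<union> ?U \<subseteq> V_core"
    proof
      fix v assume "v \<in> E \<union> ?U"
      then consider "v \<in> E" | s i p where "i \<ge> 1" "p \<in> E" "sgn (fst p) = s" "1 < 1 / \<bar>fst p\<bar> - real i"
          "v = diag_map (\<lambda>t. 1 / (s / t - real i)) p" by auto
      then show "v \<in> V_core"
      proof cases
        case 1
        then have "(v, 0) \<in> tower" by (simp add: tower_def)
        then show ?thesis unfolding V_core_def by (metis imageI level_0)
      next
        case 2
        then have "(p, i) \<in> tower" "v = level (p, i)" by (auto simp: tower_def level_def)
        then show ?thesis unfolding V_core_def by blast
      qed
    qed
  qed
  ultimately show ?thesis by simp
qed

text \<open>\<open>V_flat\<close> allows 1 \<le> 1/|x| - i where the tower asks for strict
  inequality, which costs the line x = 1. Everything else missing is the null set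
  \<open>Omega_star \<alpha> - E\<close> or one of its countably many lifts by measure
  automorphisms.\<close>

lemma V_core_full: "V_flat \<alpha> - V_core \<in> null_sets mobius_measure"
proof -
  let ?N = "Omega_star \<alpha> - E"
  let ?U = "\<Union>s\<in>{-1, 1}. \<Union>i::nat. diag_map (\<lambda>t. 1 / (s / t - real i)) ` ?N"
  have "diag_map (\<lambda>t. 1 / (s / t - real i)) ` ?N \<in> null_sets mobius_measure" if "s \<in> {-1, 1}" for s and i :: nat
    using measure_aut_image[OF aut_lift[OF that], of ?N i] E_full by (auto simp: null_sets_def)
  then have "?U \<in> null_sets mobius_measure" by (intro null_sets_UN' null_sets_UN) auto
  then have "?N \<union> ?U \<union> {1} \<times> UNIV \<in> null_sets mobius_measure"
    using E_full null_line_fst by (intro null_sets.Un)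
  moreover have "V_flat \<alpha> - V_core \<in> sets mobius_measure" using V_flat_borel V_core_borel by simp
  moreover have "V_flat \<alpha> - V_core \<subseteq> ?N \<union> ?U \<union> {1} \<times> UNIV"
  proof
    fix v assume v: "v \<in> V_flat \<alpha> - V_core"
    then have "v \<in> V_flat \<alpha>" by simp
    then show "v \<in> ?N \<union> ?U \<union> {1} \<times> UNIV"
    proof (cases rule: V_flat_cases)
      case 1
      have "v \<notin> E"
      proof
        assume "v \<in> E"
        then have "(v, 0) \<in> tower" by (simp add: tower_def)
        then have "v \<in> V_core" unfolding V_core_def by (metis imageI level_0)
        then show False using v by simp
      qed
      then show ?thesis using 1 by simp
    next
      case (2 i p)
      have sg: "sgn (fst p) \<in> {-1, 1}" using 2 by (simp add: sgn_if)
      have lv: "v = diag_map (\<lambda>t. 1 / (sgn (fst p) / t - real i)) p" using 2 by (simp add: level_def)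
      show ?thesis
      proof (cases "p \<in> E")
        case True
        then have "(p, i) \<notin> tower" using v 2 by (auto simp: V_core_def)
        then have "1 / \<bar>fst p\<bar> - real i = 1" using True 2 by (auto simp: tower_def)
        then have "fst v = 1" using lv by (simp add: diag_map_def case_prod_beta sgn_div_self)
        then show ?thesis by (auto simp: mem_Times_iff)
      next
        case False
        then have "v \<in> diag_map (\<lambda>t. 1 / (sgn (fst p) / t - real i)) ` ?N" using lv 2 by blast
        then show ?thesis using sg by blast
      qed
    qed
  qed
  ultimately show ?thesis by (rule null_sets_subset)
qed

lemma V_flat_bounds: "V_flat \<alpha> \<subseteq> {\<alpha> - 1..1} \<times> {..<0}"
proof
  fix v assume v: "v \<in> V_flat \<alpha>"
  then show "v \<in> {\<alpha> - 1..1} \<times> {..<0}"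
  proof (cases rule: V_flat_cases)
    case 1
    then have "v \<in> {\<alpha> - 1..\<alpha>} \<times> {..-1}" using Omega_star_bounds[OF \<alpha>_pos \<alpha>_half] by blast
    then show ?thesis using \<alpha>_half by (auto simp: mem_Times_iff)
  next
    case (2 i p)
    obtain x y where p: "p = (x, y)" by force
    have v_eq: "v = (1 / (1 / \<bar>x\<bar> - i), 1 / (sgn x / y - i))" using 2 p by (simp add: level_def diag_map_def sgn_div_self)
    have y: "y \<le> -1" using 2 p Omega_star_bounds[OF \<alpha>_pos \<alpha>_half] by auto
    \<comment> \<open>The quotient cannot exceed the height i \<ge> 1. Equality would make the
      ordinate \<open>1 / 0 = 0\<close>, which the definition of \<open>V_flat\<close> rules
      out.\<close>
    have "sgn x / y \<le> 1" using y by (auto simp: sgn_if field_simps)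
    moreover have "1 \<le> real i" using 2 by simp
    moreover have "snd v \<noteq> 0" using v by (auto simp: V_flat_def V_def Upsilon_inv_def Omega_star_def)
    ultimately have "snd v < 0" using v_eq by (auto simp: less_le)
    moreover have "0 < 1 / \<bar>x\<bar> - i" using 2(5) p by simp
    then have "0 < fst v" unfolding v_eq by simp
    moreover have "fst v \<le> 1" using v by (auto simp: V_flat_def)
    ultimately show ?thesis using \<alpha>_half \<open>0 < fst v\<close> by (simp add: mem_Times_iff)
  qed
qed

end

section \<open>Measurability of forward images\<close>

text \<open>The two inverse branches are monotone and map the positive half-line onto (0, 1) and (1,
  infinity). If p / q lies strictly between two values of the same branch, it pulls back to p / (q -
  p) or q / (p - q), for which numerator plus denominator is smaller. After n common branches a
  fraction with p + q \<le> n + 1 is exhausted.\<close>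

lemma farey_separation:
  fixes s s' :: "nat \<Rightarrow> real" and p q :: nat
  assumes "\<And>i. 0 < s i" "\<And>i. 0 < s' i" "0 < p" "0 < q" "p + q \<le> n + 1"
    and "\<And>i. i < n \<Longrightarrow>
      s i = s (Suc i) / (1 + s (Suc i)) \<and> s' i = s' (Suc i) / (1 + s' (Suc i)) \<or>
      s i = 1 + 1 / s (Suc i) \<and> s' i = 1 + 1 / s' (Suc i)"
  shows "\<not> (s 0 < p / q \<and> p / q < s' 0)"
  using assms
proof (induction n arbitrary: s s' p q)
  case (Suc n)
  let ?t = "s (Suc 0)" and ?t' = "s' (Suc 0)"
  have t: "0 < ?t" "0 < ?t'" using Suc.prems by auto
  \<comment> \<open>Both orders are needed because the branch 1 + 1/s reverses orientation; the
    hypotheses are symmetric in the two sequences.\<close>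
  have IH: "\<not> (s (Suc 0) < a / b \<and> a / b < s' (Suc 0))" "\<not> (s' (Suc 0) < a / b \<and> a / b < s (Suc 0))"
    if "0 < a" "0 < b" "a + b \<le> n + 1" for a b :: nat
  proof -
    have st: "s (Suc i) = s (Suc (Suc i)) / (1 + s (Suc (Suc i))) \<and> s' (Suc i) = s' (Suc (Suc i)) / (1 + s' (Suc (Suc i))) \<or>
      s (Suc i) = 1 + 1 / s (Suc (Suc i)) \<and> s' (Suc i) = 1 + 1 / s' (Suc (Suc i))" if "i < n" for i
      using Suc.prems(6)[of "Suc i"] that by simp
    show "\<not> (s (Suc 0) < a / b \<and> a / b < s' (Suc 0))"
      by (rule Suc.IH[of "\<lambda>i. s (Suc i)" "\<lambda>i. s' (Suc i)" a b, OF Suc.prems(1,2) that st])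
    have st': "s' (Suc i) = s' (Suc (Suc i)) / (1 + s' (Suc (Suc i))) \<and> s (Suc i) = s (Suc (Suc i)) / (1 + s (Suc (Suc i))) \<or>
      s' (Suc i) = 1 + 1 / s' (Suc (Suc i)) \<and> s (Suc i) = 1 + 1 / s (Suc (Suc i))" if "i < n" for i
      using st[OF that] by blast
    show "\<not> (s' (Suc 0) < a / b \<and> a / b < s (Suc 0))"
      by (rule Suc.IH[of "\<lambda>i. s' (Suc i)" "\<lambda>i. s (Suc i)" a b, OF Suc.prems(2,1) that st'])
  qed
  show ?case
  proof
    assume lt: "s 0 < p / q \<and> p / q < s' 0"
    consider "s 0 = ?t / (1 + ?t)" "s' 0 = ?t' / (1 + ?t')" | "s 0 = 1 + 1 / ?t" "s' 0 = 1 + 1 / ?t'"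
      using Suc.prems(6)[of 0] by auto
    then show False
    proof cases
      case 1
      have "?t' / (1 + ?t') < 1" using t by simp
      then have "real p / q < 1" using lt 1 by simp
      then have pq: "p < q" using Suc.prems by simp
      have "?t * q < p * (1 + ?t)" "p * (1 + ?t') < ?t' * q"
        using lt t Suc.prems unfolding 1 by (auto simp: field_simps)
      then have "?t < p / (q - p)" "p / (q - p) < ?t'" using pq by (auto simp: field_simps of_nat_diff)
      then show False using IH(1)[of p "q - p"] pq Suc.prems by (auto simp: of_nat_diff)
    next
      case 2
      have "1 < 1 + 1 / ?t" using t by simp
      then have "1 < real p / q" using lt unfolding 2 by linarith
      then have pq: "q < p" using Suc.prems by simp
      have "q < (p - real q) * ?t" "(p - real q) * ?t' < q"
        using lt t Suc.prems unfolding 2 by (auto simp: field_simps)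
      then have "q / (p - q) < ?t" "?t' < q / (p - q)" using pq by (auto simp: field_simps of_nat_diff)
      then show False using IH(2)[of q "p - q"] pq Suc.prems by (auto simp: of_nat_diff)
    qed
  qed
qed auto

lemma Fhat_flat_snd_0: "snd z = 0 \<Longrightarrow> snd (Fhat_flat \<alpha> z) = 0"
  by (auto simp: Fhat_flat_def split: prod.splits)

lemma Fhat_flat_fst_0: "fst z = 0 \<Longrightarrow> Fhat_flat \<alpha> z = (0, snd z / (1 - snd z))"
  by (auto simp: Fhat_flat_def split: prod.splits)

definition nonzero_ordinate :: "(real \<times> real) set" where
  "nonzero_ordinate = {z. snd z \<noteq> 0}"

lemma nonzero_ordinate_borel: "nonzero_ordinate \<in> sets borel" "{z. fst z \<noteq> (0::real)} \<in> sets borel"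
  "{z :: real \<times> real. fst z = 0} \<in> sets borel"
  unfolding nonzero_ordinate_def
  by (intro borel_open open_Collect_neq borel_closed closed_Collect_eq continuous_intros)+

text \<open>Off the axis x = 0 the map is piecewise an automorphism. On the axis it fixes the
  abscissa, whereas the automorphism 1 / (1/t - 1) would send 0 to -1; there the image is rewritten
  as a preimage under \<open>?k\<close>, the explicit inverse of \<open>?h\<close>.\<close>

lemma Fhat_flat_image_borel:
  assumes a: "0 < \<alpha>" "\<alpha> < 1 / 2" and C: "C \<in> sets borel" "C \<subseteq> nonzero_ordinate"
  shows "Fhat_flat \<alpha> ` C \<in> sets borel"
    and "C \<in> null_sets mobius_measure \<Longrightarrow> Fhat_flat \<alpha> ` C \<in> null_sets mobius_measure"
proof -
  let ?C1 = "C \<inter> {z. fst z \<noteq> 0}" and ?C0 = "C \<inter> {z. fst z = 0}"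
  let ?h = "\<lambda>z :: real \<times> real. (fst z, 1 / (1 / snd z - 1))" and ?k = "\<lambda>z :: real \<times> real. (fst z, 1 / (1 / snd z + 1))"
  have pw: "piecewise_aut mobius_measure (Fhat_flat \<alpha>) ?C1"
    using C by (intro piecewise_aut_subset[OF piecewise_aut_Fhat_flat[OF a]]) (auto simp: nonzero_ordinate_def nonzero_ordinate_borel)
  have un: "Fhat_flat \<alpha> ` C = Fhat_flat \<alpha> ` ?C1 \<union> Fhat_flat \<alpha> ` ?C0" by auto
  have "Fhat_flat \<alpha> z = ?h z" if "z \<in> ?C0" for z
  proof -
    have "snd z \<noteq> 0" using that C by (auto simp: nonzero_ordinate_def)
    then have "1 / snd z - 1 = (1 - snd z) / snd z" by (simp add: field_simps)
    then show ?thesis using that Fhat_flat_fst_0[of z] by simp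
  qed
  then have "Fhat_flat \<alpha> ` ?C0 = ?h ` ?C0" by (intro image_cong) auto
  also have "\<dots> = ?k -` ?C0"
  proof
    show "?k -` ?C0 \<subseteq> ?h ` ?C0"
    proof
      fix z assume "z \<in> ?k -` ?C0"
      moreover have "z = ?h (?k z)" by (simp add: prod_eq_iff)
      ultimately show "z \<in> ?h ` ?C0" by blast
    qed
  qed auto
  finally have im0: "Fhat_flat \<alpha> ` ?C0 = ?k -` ?C0" .
  have "?k \<in> borel_measurable borel" unfolding borel_prod[symmetric] by measurable
  then have b0: "Fhat_flat \<alpha> ` ?C0 \<in> sets borel" unfolding im0
    using measurable_sets[of ?k borel borel ?C0] C nonzero_ordinate_borel by auto
  show "Fhat_flat \<alpha> ` C \<in> sets borel"
    unfolding un using b0 piecewise_aut_image_sets[OF pw] by auto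
  assume "C \<in> null_sets mobius_measure"
  then have "?C1 \<in> null_sets mobius_measure" using nonzero_ordinate_borel by (intro null_set_Int2) auto
  then have "Fhat_flat \<alpha> ` ?C1 \<in> null_sets mobius_measure" by (rule piecewise_aut_image_null[OF pw space_mobius_measure])
  moreover have "Fhat_flat \<alpha> ` ?C0 \<in> null_sets mobius_measure"
  proof (rule null_sets_subset[OF null_line_fst[of 0]])
    show "Fhat_flat \<alpha> ` ?C0 \<subseteq> {0} \<times> UNIV" using Fhat_flat_fst_0 by (auto simp: mem_Times_iff)
  qed (use b0 in simp)
  ultimately show "Fhat_flat \<alpha> ` C \<in> null_sets mobius_measure" unfolding un by (rule null_sets.Un)
qed

text \<open>The line \<open>y = 0\<close>, where \<open>Fhat_flat\<close> is degenerate, is absorbing, so it can be discarded at every step.\<close>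

lemma Fhat_flat_funpow_image_borel:
  assumes a: "0 < \<alpha>" "\<alpha> < 1 / 2" and C: "C \<in> sets borel" "C \<subseteq> nonzero_ordinate"
  shows "(Fhat_flat \<alpha> ^^ n) ` C \<inter> nonzero_ordinate \<in> sets borel"
    and "C \<in> null_sets mobius_measure \<Longrightarrow> (Fhat_flat \<alpha> ^^ n) ` C \<inter> nonzero_ordinate \<in> null_sets mobius_measure"
proof -
  let ?I = "\<lambda>n. (Fhat_flat \<alpha> ^^ n) ` C \<inter> nonzero_ordinate"
  have step: "?I (Suc n) = Fhat_flat \<alpha> ` ?I n \<inter> nonzero_ordinate" for n
    using Fhat_flat_snd_0 by (fastforce simp: nonzero_ordinate_def)
  show "?I n \<in> sets borel"
  proof (induction n)
    case (Suc n)
    then show ?case unfolding step using Fhat_flat_image_borel(1)[OF a Suc] nonzero_ordinate_borel by auto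
  qed (use C in \<open>auto simp: Int_absorb2\<close>)
  moreover assume "C \<in> null_sets mobius_measure"
  have "?I n \<in> null_sets mobius_measure"
  proof (induction n)
    case (Suc n)
    have "Fhat_flat \<alpha> ` ?I n \<in> null_sets mobius_measure"
      using Fhat_flat_image_borel(2)[OF a, of "?I n"] Suc by auto
    then show ?case unfolding step using nonzero_ordinate_borel by (intro null_set_Int2) auto
  qed (use C \<open>C \<in> null_sets mobius_measure\<close> in \<open>auto simp: Int_absorb2\<close>)
  then show "?I n \<in> null_sets mobius_measure" .
qed

lemma sets_mu_flat: "A \<in> sets (mu_flat \<alpha>) \<longleftrightarrow> A \<in> sets borel \<and> A \<subseteq> V_flat \<alpha>"
  unfolding mu_flat_def using V_flat_borel by (auto simp: sets_restrict_space_iff)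

lemma space_mu_flat: "space (mu_flat \<alpha>) = V_flat \<alpha>"
  by (simp add: mu_flat_def space_restrict_space)

lemma emeasure_mu_flat:
  assumes "A \<in> sets (mu_flat \<alpha>)"
  shows "emeasure (mu_flat \<alpha>) A = emeasure mobius_measure A"
proof -
  let ?f = "\<lambda>(x :: real, y :: real). ennreal (1 / (x - y)\<^sup>2)"
  have A: "A \<in> sets borel" "A \<subseteq> V_flat \<alpha>" using assms by (auto simp: sets_mu_flat)
  have "emeasure (mu_flat \<alpha>) A = (\<integral>\<^sup>+z. ?f z * indicator A z \<partial>restrict_space lborel (V_flat \<alpha>))"
    unfolding mu_flat_def
    by (rule emeasure_density)
       (use A V_flat_borel in \<open>auto intro!: measurable_restrict_space1 simp: sets_restrict_space_iff\<close>)
  also have "\<dots> = (\<integral>\<^sup>+z. ?f z * indicator A z * indicator (V_flat \<alpha>) z \<partial>lborel)"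
    by (rule nn_integral_restrict_space) (use V_flat_borel in auto)
  also have "\<dots> = (\<integral>\<^sup>+z. ?f z * indicator A z \<partial>lborel)"
    using A by (intro nn_integral_cong) (auto simp: indicator_def)
  also have "\<dots> = emeasure mobius_measure A"
    unfolding mobius_measure_def using A by (subst emeasure_density) auto
  finally show ?thesis .
qed

lemma null_sets_mu_flat: "A \<in> null_sets (mu_flat \<alpha>) \<longleftrightarrow> A \<in> null_sets mobius_measure \<and> A \<subseteq> V_flat \<alpha>"
  by (auto simp: null_sets_def emeasure_mu_flat sets_mu_flat)

section \<open>Generation by the past\<close>

text \<open>The sets that generation modulo null sets can reach. Being a sigma-algebra when
  \<open>\<J>\<close> is one inside \<open>sets M\<close>, this family can be tested through
  measurability of coordinate functions.\<close>

definition approx_sets :: "'a measure \<Rightarrow> 'a set set \<Rightarrow> 'a set set" where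
  "approx_sets M \<J> = {A \<in> sets M. \<exists>B\<in>\<J>. sym_diff A B \<in> null_sets M}"

lemma approx_sets_modify:
  assumes "A \<in> sets M" "A' \<in> approx_sets M \<J>" "sym_diff A A' \<in> null_sets M" "\<J> \<subseteq> sets M"
  shows "A \<in> approx_sets M \<J>"
proof -
  from assms(2) obtain B where B: "B \<in> \<J>" "sym_diff A' B \<in> null_sets M" by (auto simp: approx_sets_def)
  have "sym_diff A B \<in> null_sets M"
  proof (rule null_sets_subset)
    show "sym_diff A A' \<union> sym_diff A' B \<in> null_sets M" using assms(3) B(2) by (rule null_sets.Un)
  qed (use assms B in auto)
  then show ?thesis using assms B by (auto simp: approx_sets_def)
qed

lemma sigma_algebra_approx_sets:
  assumes J: "sigma_algebra (space M) \<J>" "\<J> \<subseteq> sets M"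
  shows "sigma_algebra (space M) (approx_sets M \<J>)"
  unfolding sigma_algebra_iff2
proof (intro conjI ballI allI impI)
  interpret J: sigma_algebra "space M" \<J> by fact
  show "approx_sets M \<J> \<subseteq> Pow (space M)" using sets.sets_into_space by (auto simp: approx_sets_def)
  show "{} \<in> approx_sets M \<J>" by (auto simp: approx_sets_def intro!: bexI[of _ "{}"])
  fix A assume A: "A \<in> approx_sets M \<J>"
  then obtain B where B: "B \<in> \<J>" "sym_diff A B \<in> null_sets M" and As: "A \<in> sets M" by (auto simp: approx_sets_def)
  have "sym_diff (space M - A) (space M - B) = sym_diff A B"
    using As B(1) J(2) sets.sets_into_space by blast
  then show "space M - A \<in> approx_sets M \<J>"
    using As B by (auto simp: approx_sets_def intro!: bexI[of _ "space M - B"])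
next
  interpret J: sigma_algebra "space M" \<J> by fact
  fix A :: "nat \<Rightarrow> 'a set" assume A: "range A \<subseteq> approx_sets M \<J>"
  then have "\<forall>n. \<exists>B. B \<in> \<J> \<and> sym_diff (A n) B \<in> null_sets M" and As: "\<And>n. A n \<in> sets M"
    by (auto simp: approx_sets_def)
  then obtain B where B: "\<And>n. B n \<in> \<J>" "\<And>n. sym_diff (A n) (B n) \<in> null_sets M" by metis
  have BJ: "(\<Union>n. B n) \<in> \<J>" using B(1) by auto
  have "sym_diff (\<Union>n. A n) (\<Union>n. B n) \<in> null_sets M"
  proof (rule null_sets_subset)
    show "(\<Union>n. sym_diff (A n) (B n)) \<in> null_sets M" using B(2) by (rule null_sets_UN)
    show "sym_diff (\<Union>n. A n) (\<Union>n. B n) \<in> sets M" using As BJ J(2) by auto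
  qed blast
  then show "(\<Union>n. A n) \<in> approx_sets M \<J>" using As BJ by (auto simp: approx_sets_def)
qed

section \<open>Coding of the fibres by past branches\<close>

context gstar_core
begin

abbreviation "F \<equiv> Fhat_flat \<alpha>"

lemma V_core_D:
  assumes "z \<in> V_core"
  shows "z \<in> V_flat \<alpha>" "fst z \<noteq> 0" "\<alpha> - 1 < fst z" "fst z < 1" "snd z < 0" "fst z < 0 \<Longrightarrow> snd z < -1"
proof -
  obtain x y i where t: "((x, y), i) \<in> tower" "z = level ((x, y), i)" using assms by (auto simp: V_core_def)
  have E: "(x, y) \<in> E" using t by (auto simp: tower_def)
  show "z \<in> V_flat \<alpha>" using assms V_core_subset by auto
  have "fst z \<noteq> 0 \<and> \<alpha> - 1 < fst z \<and> fst z < 1 \<and> snd z < 0 \<and> (fst z < 0 \<longrightarrow> snd z < -1)"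
  proof (cases "i = 0")
    case True
    then show ?thesis using E_D(1-4)[OF E] t \<alpha>_half by (simp add: level_0)
  next
    case False
    note lp = level_pos[OF t(1) disjI1[OF False]]
    have "0 < fst z" "fst z < 1" "snd z < 0" unfolding t(2) lp(1) using lp(2,3) by auto
    then show ?thesis using \<alpha>_half by auto
  qed
  then show "fst z \<noteq> 0" "\<alpha> - 1 < fst z" "fst z < 1" "snd z < 0" "fst z < 0 \<Longrightarrow> snd z < -1" by auto
qed

lemma F_V_core: "z \<in> V_core \<Longrightarrow> F z \<in> V_core"
  using bij_Fhat_flat_V_core by (auto simp: bij_betw_def)

text \<open>
  In the coordinate \<open>fiber_coord\<close>, every branch of \<open>Fhat_flat\<close> acts on fibres as one of the two inverse
  branches \<open>s / (1 + s)\<close> and \<open>1 + 1 / s\<close> of the Farey map on \<open>(0, \<infinity>)\<close>.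
\<close>

definition fiber_coord :: "real \<times> real \<Rightarrow> real" where
  "fiber_coord z = (if fst z < 0 then - snd z - 1 else - snd z)"

definition left_branch :: "real set" where
  "left_branch = {x. x < - 1 / 2 \<or> 0 < x \<and> x < 1 / 2}"

lemma fiber_coord_pos: "z \<in> V_core \<Longrightarrow> 0 < fiber_coord z"
  using V_core_D(5,6)[of z] by (auto simp: fiber_coord_def)

text \<open>The shift by 1 over negative abscissae compensates for the second unit subtracted by
  exactly those branches that land there. The five planar branches thereby collapse to two fibre
  maps. The fact \<open>F0\<close> excludes x = 1/2, whose image would have abscissa 0.\<close>

lemma fiber_coord_Fhat_flat:
  assumes z: "z \<in> V_core"
  shows "fiber_coord (F z) =
    (if fst z \<in> left_branch then fiber_coord z / (1 + fiber_coord z) else 1 + 1 / fiber_coord z)"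
proof -
  obtain x y where xy: "z = (x, y)" by force
  note D = V_core_D[OF z, unfolded xy, simplified]
  have F0: "fst (F (x, y)) \<noteq> 0" using V_core_D(2)[OF F_V_core[OF z]] xy by simp
  have half: "1 / 2 < 1 / (1 + \<alpha>)" using \<alpha>_pos \<alpha>_half by (simp add: field_simps)
  consider "x < - 1 / 2" | "- 1 / 2 \<le> x" "x < 0" | "0 < x" "x < 1 / 2" | "1 / 2 \<le> x" "x \<le> 1 / (1 + \<alpha>)" | "1 / (1 + \<alpha>) < x"
    using D(2) by linarith
  then show ?thesis
  proof cases
    case 1
    then have "- ((1 + 2 * x) / x) < 0" using D by (simp add: field_simps)
    then have "fiber_coord (F (x, y)) = (1 + 2 * y) / y - 1" using 1 by (simp add: Fhat_flat_def fiber_coord_def)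
    also have "\<dots> = (- y - 1) / (1 + (- y - 1))" using D(5) by (simp add: field_simps)
    finally show ?thesis using 1 xy by (simp add: fiber_coord_def left_branch_def)
  next
    case 2
    then have "0 < - (x / (1 + x))" by (simp add: field_simps)
    then have "fiber_coord (F (x, y)) = y / (1 + y)" using 2 by (simp add: Fhat_flat_def fiber_coord_def)
    also have "\<dots> = 1 + 1 / (- y - 1)" using D 2 by (simp add: field_simps)
    finally show ?thesis using 2 xy by (simp add: fiber_coord_def left_branch_def)
  next
    case 3
    then have "\<not> x / (1 - x) < 0" by (simp add: not_less)
    then have "fiber_coord (F (x, y)) = - (y / (1 - y))" using 3 by (simp add: Fhat_flat_def fiber_coord_def)
    also have "\<dots> = - y / (1 + (- y))" by simp
    finally show ?thesis using 3 xy by (simp add: fiber_coord_def left_branch_def)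
  next
    case 4
    then have "F (x, y) = ((1 - 2 * x) / x, (1 - 2 * y) / y)" by (simp add: Fhat_flat_def)
    moreover from this have "(1 - 2 * x) / x < 0" using F0 4 by (auto simp: field_simps)
    ultimately have "fiber_coord (F (x, y)) = - ((1 - 2 * y) / y) - 1" by (simp add: fiber_coord_def)
    also have "\<dots> = 1 + 1 / (- y)" using D(5) by (simp add: field_simps)
    finally show ?thesis using 4 xy by (simp add: fiber_coord_def left_branch_def)
  next
    case 5
    then have x: "1 / 2 < x" using half by linarith
    then have "F (x, y) = ((1 - x) / x, (1 - y) / y)" using 5 by (simp add: Fhat_flat_def)
    moreover from this have "0 < (1 - x) / x" using x D(4) by (auto simp: field_simps)
    ultimately have "fiber_coord (F (x, y)) = - ((1 - y) / y)" by (simp add: fiber_coord_def)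
    also have "\<dots> = 1 + 1 / (- y)" using D(5) by (simp add: field_simps)
    finally show ?thesis using x xy by (simp add: fiber_coord_def left_branch_def)
  qed
qed

definition past :: "nat \<Rightarrow> real \<times> real \<Rightarrow> real \<times> real" where
  "past n = inv_into V_core F ^^ n"

lemma past_V_core: "z \<in> V_core \<Longrightarrow> past n z \<in> V_core"
proof (induction n)
  case (Suc n)
  then show ?case using bij_betw_imp_surj_on[OF bij_Fhat_flat_V_core] inv_into_into[of "past n z" F V_core]
    by (simp add: past_def)
qed (simp add: past_def)

lemma F_past: "z \<in> V_core \<Longrightarrow> F (past (Suc n) z) = past n z"
  using past_V_core[of z n] bij_betw_inv_into_right[OF bij_Fhat_flat_V_core] by (simp add: past_def)

lemma funpow_F_past: "z \<in> V_core \<Longrightarrow> (F ^^ n) (past n z) = z"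
proof (induction n)
  case (Suc n)
  have "(F ^^ Suc n) (past (Suc n) z) = (F ^^ n) (F (past (Suc n) z))" by (simp only: funpow_Suc_right comp_def)
  then show ?case using Suc F_past by simp
qed (simp add: past_def)

lemma past_funpow_F: "z \<in> V_core \<Longrightarrow> (F ^^ n) z \<in> V_core \<and> past n ((F ^^ n) z) = z"
proof (induction n)
  case (Suc n)
  then have c: "(F ^^ n) z \<in> V_core" "past n ((F ^^ n) z) = z" by auto
  then have "F ((F ^^ n) z) \<in> V_core" using F_V_core by blast
  moreover have "inv_into V_core F (F ((F ^^ n) z)) = (F ^^ n) z"
    using bij_betw_inv_into_left[OF bij_Fhat_flat_V_core c(1)] .
  ultimately show ?case using c(2) by (simp add: past_def funpow_swap1[symmetric] funpow_Suc_right del: funpow.simps(2))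
qed (simp add: past_def)

text \<open>The index is shifted because the branch leading from \<open>past (Suc n) z\<close> to
  \<open>past n z\<close> is read off the abscissa of the earlier point.\<close>

definition past_digit_set :: "nat \<Rightarrow> (real \<times> real) set" where
  "past_digit_set n = {z \<in> V_core. fst (past (Suc n) z) \<in> left_branch}"

text \<open>This turns a condition on the past into a forward image of a set described by the first
  coordinate, the form of the generators of \<open>join_forward_images\<close>.\<close>

lemma past_digit_set_eq: "past_digit_set n = (F ^^ Suc n) ` (V_core \<inter> left_branch \<times> UNIV)"
proof
  show "past_digit_set n \<subseteq> (F ^^ Suc n) ` (V_core \<inter> left_branch \<times> UNIV)"
  proof
    fix z assume z: "z \<in> past_digit_set n"
    then have zc: "z \<in> V_core" by (simp add: past_digit_set_def)
    show "z \<in> (F ^^ Suc n) ` (V_core \<inter> left_branch \<times> UNIV)"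
    proof (rule image_eqI[of _ _ "past (Suc n) z"])
      show "z = (F ^^ Suc n) (past (Suc n) z)" using funpow_F_past[OF zc, of "Suc n"] by metis
      show "past (Suc n) z \<in> V_core \<inter> left_branch \<times> UNIV"
        using past_V_core[OF zc, of "Suc n"] z by (auto simp: past_digit_set_def mem_Times_iff)
    qed
  qed
  show "(F ^^ Suc n) ` (V_core \<inter> left_branch \<times> UNIV) \<subseteq> past_digit_set n"
  proof
    fix z assume "z \<in> (F ^^ Suc n) ` (V_core \<inter> left_branch \<times> UNIV)"
    then obtain w where w: "w \<in> V_core" "fst w \<in> left_branch" "z = (F ^^ Suc n) w" by (auto simp: mem_Times_iff)
    then show "z \<in> past_digit_set n"
      using past_funpow_F[OF w(1), of "Suc n"] w(2) unfolding past_digit_set_def w(3)[symmetric] by simp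
  qed
qed

definition past_cell :: "nat \<times> nat set \<Rightarrow> (real \<times> real) set" where
  "past_cell = (\<lambda>(n, S). {z \<in> V_core. \<forall>m<n. z \<in> past_digit_set m \<longleftrightarrow> m \<in> S})"

text \<open>Given a point below c, choose a rational p / q strictly between its fibre coordinate and
  c. By \<open>farey_separation\<close> no point sharing its last p + q branches has fibre
  coordinate above p / q, so the whole cell stays below c. Cells are coded by finite sets of
  positions, hence there are only countably many.\<close>

lemma fiber_coord_sublevel:
  "{z \<in> V_core. fiber_coord z < c} =
    (\<Union>i\<in>{i. finite (snd i) \<and> past_cell i \<subseteq> {z. fiber_coord z < c}}. past_cell i)"
proof
  show "{z \<in> V_core. fiber_coord z < c} \<subseteq>
    (\<Union>i\<in>{i. finite (snd i) \<and> past_cell i \<subseteq> {z. fiber_coord z < c}}. past_cell i)"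
  proof
    fix z assume "z \<in> {z \<in> V_core. fiber_coord z < c}"
    then have z: "z \<in> V_core" "fiber_coord z < c" by auto
    obtain r where r: "r \<in> \<rat>" "fiber_coord z < r" "r < c" using Rats_dense_in_real[OF z(2)] by blast
    have "0 < r" using r fiber_coord_pos[OF z(1)] by linarith
    then have "\<exists>(p :: nat) (q :: nat). 0 < p \<and> 0 < q \<and> r = real p / real q"
    proof -
      obtain p q :: nat where "q \<noteq> 0" "\<bar>r\<bar> = p / q" using Rats_abs_nat_div_natE[OF r(1)] by metis
      then show ?thesis using \<open>0 < r\<close> by (intro exI[of _ p] exI[of _ q]) (auto intro: Nat.gr0I)
    qed
    then obtain p q :: nat where pq: "0 < p" "0 < q" "r = real p / real q" by blast
    define S where "S = {m. m < p + q \<and> z \<in> past_digit_set m}"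
    have "z \<in> past_cell (p + q, S)" using z by (auto simp: past_cell_def S_def)
    moreover have "past_cell (p + q, S) \<subseteq> {z. fiber_coord z < c}"
    proof
      fix w assume "w \<in> past_cell (p + q, S)"
      then have w: "w \<in> V_core" "\<And>m. m < p + q \<Longrightarrow> w \<in> past_digit_set m \<longleftrightarrow> z \<in> past_digit_set m"
        by (auto simp: past_cell_def S_def)
      have st: "fiber_coord (past m u) = (if u \<in> past_digit_set m
          then fiber_coord (past (Suc m) u) / (1 + fiber_coord (past (Suc m) u)) else 1 + 1 / fiber_coord (past (Suc m) u))"
        if "u \<in> V_core" for u m
        using fiber_coord_Fhat_flat[OF past_V_core[OF that, of "Suc m"]] F_past[OF that, of m] that
        by (simp add: past_digit_set_def)
      have "\<not> (fiber_coord (past 0 z) < p / q \<and> p / q < fiber_coord (past 0 w))"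
      proof (rule farey_separation[where n = "p + q" and s = "\<lambda>m. fiber_coord (past m z)" and s' = "\<lambda>m. fiber_coord (past m w)"])
        fix i assume "i < p + q"
        from w(2)[OF this] show "fiber_coord (past i z) = fiber_coord (past (Suc i) z) / (1 + fiber_coord (past (Suc i) z)) \<and>
            fiber_coord (past i w) = fiber_coord (past (Suc i) w) / (1 + fiber_coord (past (Suc i) w)) \<or>
            fiber_coord (past i z) = 1 + 1 / fiber_coord (past (Suc i) z) \<and>
            fiber_coord (past i w) = 1 + 1 / fiber_coord (past (Suc i) w)"
          unfolding st[OF z(1), of i] st[OF w(1), of i] by presburger
      qed (use pq fiber_coord_pos past_V_core z w in auto)
      then show "w \<in> {z. fiber_coord z < c}" using r pq by (simp add: past_def)
    qed
    moreover have "finite S" by (simp add: S_def)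
    ultimately show "z \<in> (\<Union>i\<in>{i. finite (snd i) \<and> past_cell i \<subseteq> {z. fiber_coord z < c}}. past_cell i)"
      by (intro UN_I[of "(p + q, S)"]) auto
  qed
  show "(\<Union>i\<in>{i. finite (snd i) \<and> past_cell i \<subseteq> {z. fiber_coord z < c}}. past_cell i) \<subseteq> {z \<in> V_core. fiber_coord z < c}"
    by (auto simp: past_cell_def)
qed

lemma countable_past_cells: "countable {i :: nat \<times> nat set. finite (snd i) \<and> P i}"
proof (rule countable_subset)
  show "{i :: nat \<times> nat set. finite (snd i) \<and> P i} \<subseteq> UNIV \<times> {S. finite S}" by auto
  show "countable ((UNIV :: nat set) \<times> {S :: nat set. finite S})"
    by (intro countable_SIGMA countableI_type countable_Collect_finite)
qed

end

section \<open>The one-dimensional factor and sigma-finiteness\<close>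

lemma Fhat_flat_measurable: "Fhat_flat \<alpha> \<in> borel_measurable borel"
  unfolding Fhat_flat_def case_prod_beta borel_prod[symmetric] by measurable

lemma F_flat_maps_to:
  assumes "0 < \<alpha>" "\<alpha> < 1 / 2" "x \<in> {\<alpha> - 1..1}"
  shows "F_flat \<alpha> x \<in> {\<alpha> - 1..1}"
proof -
  have half: "1 / 2 < 1 / (1 + \<alpha>)" using assms by (simp add: field_simps)
  consider "x < - 1 / 2" | "- 1 / 2 \<le> x" "x < 0" | "0 \<le> x" "x < 1 / 2" | "1 / 2 \<le> x" "x < 1 / (1 + \<alpha>)" | "1 / (1 + \<alpha>) \<le> x"
    by linarith
  then show ?thesis
  proof cases
    case 1
    have "(1 + \<alpha>) * (- x) \<le> (1 + \<alpha>) * (1 - \<alpha>)" using assms by (intro mult_left_mono) auto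
    also have "\<dots> \<le> 1" by (simp add: algebra_simps)
    finally have "\<alpha> - 1 \<le> - ((1 + 2 * x) / x)" using 1 by (simp add: field_simps)
    moreover have "- ((1 + 2 * x) / x) \<le> 1" using 1 by (simp add: field_simps)
    ultimately show ?thesis using 1 by (simp add: F_flat_def)
  next
    case 2
    have "0 \<le> - (x / (1 + x))" "- (x / (1 + x)) \<le> 1" using 2 by (simp_all add: field_simps)
    moreover have "F_flat \<alpha> x = - (x / (1 + x))" using 2 by (simp add: F_flat_def)
    ultimately have "0 \<le> F_flat \<alpha> x" "F_flat \<alpha> x \<le> 1" by metis+
    then show ?thesis using assms(2) by simp
  next
    case 3
    have "0 \<le> x / (1 - x)" "x / (1 - x) \<le> 1" using 3 by (simp_all add: field_simps)
    moreover have "F_flat \<alpha> x = x / (1 - x)" using 3 by (simp add: F_flat_def)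
    ultimately have "0 \<le> F_flat \<alpha> x" "F_flat \<alpha> x \<le> 1" by metis+
    then show ?thesis using assms(2) by simp
  next
    case 4
    then have "x * (1 + \<alpha>) < 1" using assms(1) by (simp add: field_simps)
    then have "\<alpha> - 1 \<le> (1 - 2 * x) / x" "(1 - 2 * x) / x \<le> 1" using 4 by (simp_all add: field_simps)
    then show ?thesis using 4 by (simp add: F_flat_def)
  next
    case 5
    then have x: "1 / 2 < x" using half by linarith
    then have "0 \<le> (1 - x) / x" "(1 - x) / x \<le> 1" using assms(3) by (simp_all add: field_simps)
    moreover have "F_flat \<alpha> x = (1 - x) / x" using 5 x by (simp add: F_flat_def)
    ultimately have "0 \<le> F_flat \<alpha> x" "F_flat \<alpha> x \<le> 1" by metis+
    then show ?thesis using assms(2) by simp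
  qed
qed

lemma sets_nu_flat: "sets (nu_flat \<alpha>) = sets (restrict_space borel {\<alpha> - 1..1})"
  by (simp add: nu_flat_def)

lemma in_sets_nu_flat: "B \<in> sets (nu_flat \<alpha>) \<longleftrightarrow> B \<in> sets borel \<and> B \<subseteq> {\<alpha> - 1..1}"
  by (auto simp: sets_nu_flat sets_restrict_space_iff)

lemma space_nu_flat: "space (nu_flat \<alpha>) = {\<alpha> - 1..1}"
  by (simp add: nu_flat_def space_restrict_space)

lemma F_flat_measurable:
  assumes "0 < \<alpha>" "\<alpha> < 1 / 2"
  shows "F_flat \<alpha> \<in> measurable (nu_flat \<alpha>) (nu_flat \<alpha>)"
proof -
  have "F_flat \<alpha> \<in> borel_measurable borel" unfolding F_flat_def by measurable
  then have "F_flat \<alpha> \<in> measurable (restrict_space borel {\<alpha> - 1..1}) (restrict_space borel {\<alpha> - 1..1})"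
    using F_flat_maps_to[OF assms] by (intro measurable_restrict_space3) auto
  then show ?thesis using measurable_cong_sets[OF sets_nu_flat sets_nu_flat] by blast
qed

lemma sigma_finite_mu_flat: "sigma_finite_measure (mu_flat \<alpha>)"
proof -
  obtain A :: "nat \<Rightarrow> (real \<times> real) set" where A: "range A \<subseteq> sets mobius_measure" "(\<Union>i. A i) = space mobius_measure"
    "\<And>i. emeasure mobius_measure (A i) \<noteq> \<infinity>"
    using sigma_finite_measure.sigma_finite[OF sigma_finite_mobius_measure] by metis
  have s: "A i \<inter> V_flat \<alpha> \<in> sets (mu_flat \<alpha>)" for i using A(1) V_flat_borel by (auto simp: sets_mu_flat)
  have "emeasure (mu_flat \<alpha>) (A i \<inter> V_flat \<alpha>) \<noteq> \<infinity>" for i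
  proof -
    have "emeasure mobius_measure (A i \<inter> V_flat \<alpha>) \<le> emeasure mobius_measure (A i)"
      using A(1) by (intro emeasure_mono) auto
    then show ?thesis using A(3)[of i] emeasure_mu_flat[OF s] by (auto simp: top_unique)
  qed
  then show ?thesis
    unfolding sigma_finite_measure_def using s A(2)
    by (intro exI[of _ "range (\<lambda>i. A i \<inter> V_flat \<alpha>)"]) (auto simp: space_mu_flat)
qed

context gstar_core
begin

lemma fst_measurable: "fst \<in> measurable (mu_flat \<alpha>) (nu_flat \<alpha>)"
proof (rule measurableI)
  fix B assume "B \<in> sets (nu_flat \<alpha>)"
  then have "fst -` B \<inter> space (mu_flat \<alpha>) = B \<times> UNIV \<inter> V_flat \<alpha>" "B \<times> UNIV \<in> sets (borel :: (real \<times> real) measure)"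
    by (auto simp: space_mu_flat in_sets_nu_flat intro!: strip_borel)
  then show "fst -` B \<inter> space (mu_flat \<alpha>) \<in> sets (mu_flat \<alpha>)"
    using V_flat_borel by (simp add: sets_mu_flat)
qed (use V_flat_bounds in \<open>auto simp: space_mu_flat space_nu_flat\<close>)

lemma emeasure_nu_flat:
  assumes "B \<in> sets (nu_flat \<alpha>)"
  shows "emeasure (nu_flat \<alpha>) B = emeasure mobius_measure (fst -` B \<inter> V_flat \<alpha>)"
proof -
  have m: "fst \<in> measurable (mu_flat \<alpha>) (restrict_space borel {\<alpha> - 1..1})"
    using fst_measurable measurable_cong_sets[OF refl sets_nu_flat] by blast
  have "fst -` B \<inter> space (mu_flat \<alpha>) \<in> sets (mu_flat \<alpha>)" using measurable_sets[OF fst_measurable assms] .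
  then show ?thesis using assms
    unfolding nu_flat_def by (subst emeasure_distr[OF m]) (simp_all add: emeasure_mu_flat space_mu_flat)
qed

text \<open>Over x \<le> 0 only \<open>Omega_star\<close> is present, since all higher floors have
  positive abscissa, and its measure is finite. Over [1/(n+1), 1] the ordinates are negative, so the
  strip stays away from the diagonal.\<close>

lemma sigma_finite_nu_flat: "sigma_finite_measure (nu_flat \<alpha>)"
proof -
  let ?A = "\<lambda>n::nat. {inverse (Suc n)..1 :: real}"
  have sub: "{\<alpha> - 1..0} \<subseteq> {\<alpha> - 1..1}" "?A n \<subseteq> {\<alpha> - 1..1}" for n
  proof -
    have "0 < inverse (real (Suc n))" by simp
    then show "?A n \<subseteq> {\<alpha> - 1..1}" using \<alpha>_half unfolding atLeastatMost_subset_iff by linarith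
  qed simp
  have "emeasure (nu_flat \<alpha>) {\<alpha> - 1..0} \<noteq> \<infinity>"
  proof -
    have "fst -` {\<alpha> - 1..0} \<inter> V_flat \<alpha> \<subseteq> Omega_star \<alpha>"
    proof
      fix v assume v: "v \<in> fst -` {\<alpha> - 1..0} \<inter> V_flat \<alpha>"
      then have "v \<in> V_flat \<alpha>" by simp
      then show "v \<in> Omega_star \<alpha>"
      proof (cases rule: V_flat_cases)
        case (2 i p)
        have "fst v = 1 / (1 / \<bar>fst p\<bar> - i)"
          using 2 by (simp add: level_def diag_map_def case_prod_beta sgn_div_self)
        moreover have "0 < 1 / (1 / \<bar>fst p\<bar> - i)" using 2(5) by (subst zero_less_divide_1_iff) linarith
        ultimately have "0 < fst v" by simp
        then show ?thesis using v by simp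
      qed
    qed
    then have "emeasure mobius_measure (fst -` {\<alpha> - 1..0} \<inter> V_flat \<alpha>) \<le> emeasure mobius_measure (Omega_star \<alpha>)"
      by (intro emeasure_mono) (auto simp: Omega_star_borel)
    also have "\<dots> < \<infinity>" by (rule emeasure_Omega_star[OF \<alpha>_pos \<alpha>_half])
    finally show ?thesis using sub by (subst emeasure_nu_flat) (auto simp: in_sets_nu_flat)
  qed
  moreover have "emeasure (nu_flat \<alpha>) (?A n) \<noteq> \<infinity>" for n
  proof -
    have "emeasure mobius_measure (fst -` ?A n \<inter> V_flat \<alpha>) \<le> emeasure mobius_measure (?A n \<times> {..0})"
      using V_flat_bounds by (intro emeasure_mono) (auto intro!: borel_closed closed_Times)
    also have "\<dots> < \<infinity>" by (rule emeasure_mobius_strip_finite') simp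
    finally show ?thesis using sub by (subst emeasure_nu_flat) (auto simp: in_sets_nu_flat)
  qed
  moreover have "{\<alpha> - 1..0} \<union> (\<Union>n. ?A n) = {\<alpha> - 1..1}"
  proof
    show "{\<alpha> - 1..1} \<subseteq> {\<alpha> - 1..0} \<union> (\<Union>n. ?A n)"
    proof
      fix x :: real assume x: "x \<in> {\<alpha> - 1..1}"
      show "x \<in> {\<alpha> - 1..0} \<union> (\<Union>n. ?A n)"
      proof (cases "x \<le> 0")
        case False
        then obtain n where "inverse (real (Suc n)) < x" using reals_Archimedean[of x] by auto
        then show ?thesis using x by (intro UnI2 UN_I[of n]) (auto simp del: of_nat_Suc)
      qed (use x in auto)
    qed
  qed (use sub in blast)
  ultimately show ?thesis unfolding sigma_finite_measure_def
    using sub by (intro exI[of _ "insert {\<alpha> - 1..0} (range ?A)"]) (auto simp: in_sets_nu_flat space_nu_flat)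
qed

section \<open>Bijectivity, invariance and the factor map\<close>

lemma V_core_sets: "V_core \<in> sets (mu_flat \<alpha>)"
  using V_core_borel V_core_subset by (simp add: sets_mu_flat)

lemma V_core_compl_null: "V_flat \<alpha> - V_core \<in> null_sets (mu_flat \<alpha>)"
  using V_core_full by (simp add: null_sets_mu_flat)

lemma AE_V_core: "AE z in mu_flat \<alpha>. z \<in> V_core"
  using V_core_compl_null by (rule AE_I') (auto simp: space_mu_flat)

lemma bij_mod_null_Fhat_flat: "bij_mod_null (mu_flat \<alpha>) F"
proof -
  have "V_flat \<alpha> - (V_flat \<alpha> - V_core) = V_core" using V_core_subset by auto
  then have "bij_betw F (space (mu_flat \<alpha>) - (V_flat \<alpha> - V_core)) (space (mu_flat \<alpha>) - (V_flat \<alpha> - V_core))"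
    using bij_Fhat_flat_V_core by (simp add: space_mu_flat)
  then show ?thesis unfolding bij_mod_null_def using V_core_compl_null by blast
qed

lemma emeasure_mu_flat_Int_core:
  assumes "A \<in> sets (mu_flat \<alpha>)"
  shows "emeasure (mu_flat \<alpha>) A = emeasure mobius_measure (A \<inter> V_core)"
proof -
  have "emeasure (mu_flat \<alpha>) A = emeasure (mu_flat \<alpha>) (A - (V_flat \<alpha> - V_core))"
    using emeasure_Diff_null_set[OF V_core_compl_null assms] by simp
  also have "A - (V_flat \<alpha> - V_core) = A \<inter> V_core" using assms by (auto simp: sets_mu_flat)
  finally show ?thesis using emeasure_mu_flat[of "A \<inter> V_core"] assms V_core_sets by auto
qed

text \<open>On \<open>V_core\<close> the map is injective and piecewise an automorphism, so it
  preserves the measure of the preimage of A within the core. As it permutes the core, the image of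
  that preimage is \<open>A \<inter> V_core\<close>.\<close>

lemma invariant_measure_mu_flat: "invariant_measure (mu_flat \<alpha>) F"
  unfolding invariant_measure_def
proof (intro conjI ballI)
  show "AE z in mu_flat \<alpha>. F z \<in> space (mu_flat \<alpha>)"
    using AE_V_core by eventually_elim (use F_V_core V_core_subset in \<open>auto simp: space_mu_flat\<close>)
  fix A assume A: "A \<in> sets (mu_flat \<alpha>)"
  then have Ab: "A \<in> sets borel" by (simp add: sets_mu_flat)
  have "F -` A \<inter> space borel \<in> sets borel" using Fhat_flat_measurable Ab by (rule measurable_sets)
  then show pre: "F -` A \<inter> space (mu_flat \<alpha>) \<in> sets (mu_flat \<alpha>)"
    using V_flat_borel by (auto simp: sets_mu_flat space_mu_flat)
  let ?C = "F -` A \<inter> space (mu_flat \<alpha>) \<inter> V_core"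
  have C: "?C = F -` A \<inter> V_core" using V_core_subset by (auto simp: space_mu_flat)
  have im: "F ` ?C = A \<inter> V_core"
  proof
    show "A \<inter> V_core \<subseteq> F ` ?C"
    proof
      fix z assume z: "z \<in> A \<inter> V_core"
      then have "z \<in> F ` V_core" using bij_Fhat_flat_V_core by (simp add: bij_betw_def)
      then show "z \<in> F ` ?C" using z unfolding C by auto
    qed
    show "F ` ?C \<subseteq> A \<inter> V_core"
    proof
      fix z assume "z \<in> F ` ?C"
      then obtain w where "w \<in> V_core" "F w \<in> A" "z = F w" by blast
      then show "z \<in> A \<inter> V_core" using F_V_core by blast
    qed
  qed
  have "?C \<in> sets borel" using pre V_core_borel by (auto simp: sets_mu_flat)
  then have "piecewise_aut mobius_measure F ?C"
    using V_core_D(2,5) by (intro piecewise_aut_subset[OF piecewise_aut_Fhat_flat[OF \<alpha>_pos \<alpha>_half]]) fastforce+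
  moreover have "inj_on F ?C" using bij_Fhat_flat_V_core by (auto simp: bij_betw_def intro: inj_on_subset)
  ultimately have "emeasure mobius_measure (F ` ?C) = emeasure mobius_measure ?C"
    by (intro piecewise_aut_image_inj) auto
  then show "emeasure (mu_flat \<alpha>) (F -` A \<inter> space (mu_flat \<alpha>)) = emeasure (mu_flat \<alpha>) A"
    unfolding im emeasure_mu_flat_Int_core[OF A] emeasure_mu_flat_Int_core[OF pre] by simp
qed

lemma AE_factor: "AE z in mu_flat \<alpha>. fst (F z) = F_flat \<alpha> (fst z)"
proof (rule AE_I')
  \<comment> \<open>At abscissa 1 / (1 + \<alpha>) the planar map uses its fourth branch and
    \<open>F_flat\<close> its fifth; they can disagree nowhere else.\<close>
  show "({1 / (1 + \<alpha>)} \<times> UNIV) \<inter> V_flat \<alpha> \<in> null_sets (mu_flat \<alpha>)"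
    using null_set_Int2[OF null_line_fst] V_flat_borel by (auto simp: null_sets_mu_flat)
  show "{z \<in> space (mu_flat \<alpha>). fst (F z) \<noteq> F_flat \<alpha> (fst z)} \<subseteq> ({1 / (1 + \<alpha>)} \<times> UNIV) \<inter> V_flat \<alpha>"
    by (auto simp: space_mu_flat Fhat_flat_def F_flat_def split: if_splits)
qed

section \<open>The join of the forward images exhausts the Borel sets\<close>

abbreviation "\<J> \<equiv> join_forward_images fst (mu_flat \<alpha>) F (nu_flat \<alpha>)"

lemma fst_vimage:
  assumes "B \<in> sets (nu_flat \<alpha>)"
  shows "fst -` B \<inter> V_flat \<alpha> \<in> sets borel" "fst -` B \<inter> V_flat \<alpha> \<subseteq> nonzero_ordinate"
  using measurable_sets[OF fst_measurable assms] V_flat_bounds by (auto simp: sets_mu_flat space_mu_flat nonzero_ordinate_def)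

lemma V_flat_nonzero: "V_flat \<alpha> \<subseteq> nonzero_ordinate"
  using V_flat_bounds by (auto simp: nonzero_ordinate_def)

lemma join_generator:
  assumes "B \<in> sets (nu_flat \<alpha>)"
  shows "(F ^^ n) ` (fst -` B \<inter> V_flat \<alpha>) \<inter> V_flat \<alpha> \<in> \<J>"
  unfolding join_forward_images_def space_mu_flat using assms by (intro sigma_sets.Basic) auto

lemma join_generator_sets:
  assumes "B \<in> sets (nu_flat \<alpha>)"
  shows "(F ^^ n) ` (fst -` B \<inter> V_flat \<alpha>) \<inter> V_flat \<alpha> \<in> sets (mu_flat \<alpha>)"
proof -
  have "(F ^^ n) ` (fst -` B \<inter> V_flat \<alpha>) \<inter> V_flat \<alpha> =
    (F ^^ n) ` (fst -` B \<inter> V_flat \<alpha>) \<inter> nonzero_ordinate \<inter> V_flat \<alpha>" using V_flat_nonzero by auto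
  then show ?thesis
    using Fhat_flat_funpow_image_borel(1)[OF \<alpha>_pos \<alpha>_half fst_vimage[OF assms], of n] V_flat_borel
    by (auto simp: sets_mu_flat)
qed

lemma join_subset: "\<J> \<subseteq> sets (mu_flat \<alpha>)"
  unfolding join_forward_images_def
  by (rule sets.sigma_sets_subset) (use join_generator_sets in \<open>auto simp: space_mu_flat\<close>)

lemma sigma_algebra_join: "sigma_algebra (space (mu_flat \<alpha>)) \<J>"
  unfolding join_forward_images_def by (rule sigma_algebra_sigma_sets) auto

abbreviation "\<K> \<equiv> approx_sets (mu_flat \<alpha>) \<J>"

lemma sigma_algebra_approx: "sigma_algebra (V_flat \<alpha>) \<K>"
  using sigma_algebra_approx_sets[OF sigma_algebra_join join_subset] by (simp add: space_mu_flat)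

lemma approx_join: "A \<in> \<J> \<Longrightarrow> A \<in> \<K>"
  using join_subset by (auto simp: approx_sets_def intro!: bexI[of _ A])

lemma approx_null: "A \<in> null_sets (mu_flat \<alpha>) \<Longrightarrow> A \<in> \<K>"
proof -
  interpret J: sigma_algebra "space (mu_flat \<alpha>)" \<J> by (rule sigma_algebra_join)
  show "A \<in> null_sets (mu_flat \<alpha>) \<Longrightarrow> A \<in> \<K>"
    by (auto simp: approx_sets_def intro!: bexI[of _ "{}"])
qed

lemma fst_vimage_approx:
  assumes "B \<in> sets borel"
  shows "fst -` B \<inter> V_flat \<alpha> \<in> \<K>"
proof -
  have "B \<inter> {\<alpha> - 1..1} \<in> sets (nu_flat \<alpha>)" using assms by (auto simp: in_sets_nu_flat)
  from join_generator[OF this, of 0] have "fst -` (B \<inter> {\<alpha> - 1..1}) \<inter> V_flat \<alpha> \<in> \<J>" by simp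
  also have "fst -` (B \<inter> {\<alpha> - 1..1}) \<inter> V_flat \<alpha> = fst -` B \<inter> V_flat \<alpha>" using V_flat_bounds by auto
  finally show ?thesis by (rule approx_join)
qed

lemma funpow_F_V_core: "z \<in> V_core \<Longrightarrow> (F ^^ n) z \<in> V_core"
  using past_funpow_F by blast

text \<open>A generator of the join is an image of a subset of \<open>V_flat\<close>, while the past
  is only defined on \<open>V_core\<close>. The two sets differ inside the forward image of a null
  set, and forward images, cut down to nonzero ordinates, keep null sets null.\<close>

lemma past_digit_set_approx: "past_digit_set n \<in> \<K>"
proof -
  let ?B = "left_branch \<inter> {\<alpha> - 1..1}"
  have "left_branch \<in> sets borel"
  proof -
    have eq: "left_branch = {..<- 1 / 2} \<union> {0<..<1 / 2}" by (auto simp: left_branch_def)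
    show ?thesis unfolding eq by (intro sets.Un borel_open) auto
  qed
  then have B: "?B \<in> sets (nu_flat \<alpha>)" by (auto simp: in_sets_nu_flat)
  let ?V = "fst -` ?B \<inter> V_flat \<alpha>"
  let ?G = "(F ^^ Suc n) ` ?V \<inter> V_flat \<alpha>"
  let ?C = "V_core \<inter> left_branch \<times> UNIV" and ?D = "?V - V_core"
  let ?I = "(F ^^ Suc n) ` ?D \<inter> nonzero_ordinate"
  have CV: "?V = ?C \<union> ?D" using V_core_subset V_flat_bounds by (fastforce simp: mem_Times_iff)
  have sub1: "past_digit_set n \<subseteq> ?G"
  proof
    fix z assume "z \<in> past_digit_set n"
    then obtain w where w: "w \<in> ?C" "z = (F ^^ Suc n) w" unfolding past_digit_set_eq by blast
    then have "z \<in> V_core" using funpow_F_V_core by blast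
    then show "z \<in> ?G" using w CV V_core_subset by blast
  qed
  have sub2: "?G - past_digit_set n \<subseteq> ?I"
  proof
    fix z assume z: "z \<in> ?G - past_digit_set n"
    then obtain w where w: "w \<in> ?V" "z = (F ^^ Suc n) w" "z \<in> V_flat \<alpha>" by blast
    have "w \<notin> ?C" using z w(2) unfolding past_digit_set_eq by blast
    then have "w \<in> ?D" using w(1) CV by blast
    then show "z \<in> ?I" using w(2,3) V_flat_nonzero by blast
  qed
  have "?D = ?V \<inter> (V_flat \<alpha> - V_core)" by auto
  moreover have "?V \<inter> (V_flat \<alpha> - V_core) \<in> null_sets mobius_measure"
    using fst_vimage(1)[OF B] by (intro null_set_Int1[OF V_core_full]) simp
  ultimately have D: "?D \<in> null_sets mobius_measure" by simp
  have I: "?I \<in> null_sets mobius_measure"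
    using D V_flat_nonzero null_setsD2[OF D] by (intro Fhat_flat_funpow_image_borel(2)[OF \<alpha>_pos \<alpha>_half]) auto
  have Ps: "past_digit_set n \<in> sets (mu_flat \<alpha>)"
  proof -
    have C: "?C \<in> sets borel" using V_core_borel strip_borel(1)[OF \<open>left_branch \<in> sets borel\<close>] by (rule sets.Int)
    have Cn: "?C \<subseteq> nonzero_ordinate" using V_core_subset V_flat_nonzero by blast
    have "(F ^^ Suc n) ` ?C \<inter> nonzero_ordinate = past_digit_set n"
      using sub1 V_flat_nonzero unfolding past_digit_set_eq by blast
    then show ?thesis using Fhat_flat_funpow_image_borel(1)[OF \<alpha>_pos \<alpha>_half C Cn, of "Suc n"] sub1
      by (auto simp: sets_mu_flat)
  qed
  have Gs: "?G \<in> sets (mu_flat \<alpha>)" by (rule join_generator_sets[OF B])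
  have "sym_diff (past_digit_set n) ?G = ?G - past_digit_set n" using sub1 by auto
  moreover have "?G - past_digit_set n \<in> null_sets mobius_measure"
    using I by (rule null_sets_subset) (use Ps Gs sub2 in \<open>auto simp: sets_mu_flat\<close>)
  ultimately have "sym_diff (past_digit_set n) ?G \<in> null_sets (mu_flat \<alpha>)" by (auto simp: null_sets_mu_flat)
  then show ?thesis
    by (rule approx_sets_modify[OF Ps approx_join[OF join_generator[OF B]] _ join_subset])
qed

text \<open>Abscissa and fibre coordinate are both measurable with respect to \<open>\<K>\<close>:
  the former by the zeroth generators, the latter because its sublevel sets are countable unions of
  past cells. Together they determine the point on \<open>V_core\<close>.\<close>

lemma sets_mu_flat_approx:
  assumes A: "A \<in> sets (mu_flat \<alpha>)"
  shows "A \<in> \<K>"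
proof -
  interpret K: sigma_algebra "V_flat \<alpha>" \<K> by (rule sigma_algebra_approx)
  \<comment> \<open>The zero measure is a placeholder; only the measurable space carried by
    \<open>\<K>\<close> is wanted.\<close>
  let ?\<Sigma> = "measure_of (V_flat \<alpha>) \<K> (\<lambda>_. 0)"
  have sets: "sets ?\<Sigma> = \<K>" and space: "space ?\<Sigma> = V_flat \<alpha>"
    by (auto simp: K.sets_measure_of_eq)
  have core: "V_core \<in> \<K>"
  proof -
    have "V_flat \<alpha> - (V_flat \<alpha> - V_core) \<in> \<K>" using approx_null[OF V_core_compl_null] by (rule K.compl_sets)
    moreover have "V_flat \<alpha> - (V_flat \<alpha> - V_core) = V_core" using V_core_subset by auto
    ultimately show ?thesis by simp
  qed
  have cell: "past_cell i \<in> \<K>" for i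
  proof -
    obtain n S where i: "i = (n, S)" by force
    show ?thesis
    proof (cases "n = 0")
      case True
      then have "past_cell i = V_core" by (simp add: i past_cell_def)
      then show ?thesis using core by simp
    next
      case False
      let ?I = "\<Inter>m\<in>{..<n}. if m \<in> S then past_digit_set m else V_flat \<alpha> - past_digit_set m"
      have "?I \<in> \<K>" using False past_digit_set_approx by (intro K.finite_INT) auto
      with core have "V_core \<inter> ?I \<in> \<K>" by (rule K.Int)
      moreover have "past_cell i = V_core \<inter> ?I"
        using V_core_subset False by (auto simp: i past_cell_def split: if_splits)
      ultimately show ?thesis by simp
    qed
  qed
  \<comment> \<open>The filler value 0 off the core is why the sublevel sets for a > 0 acquire the
    null set \<open>V_flat \<alpha> - V_core\<close>.\<close>
  let ?c = "\<lambda>z. if z \<in> V_core then fiber_coord z else 0"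
  have "?c \<in> borel_measurable ?\<Sigma>"
    unfolding borel_measurable_iff_less
  proof
    fix a
    have "{z \<in> V_core. fiber_coord z < a} \<in> \<K>"
      unfolding fiber_coord_sublevel by (intro K.countable_UN' countable_past_cells) (use cell in auto)
    moreover have "(if 0 < a then V_flat \<alpha> - V_core else {}) \<in> \<K>" using approx_null[OF V_core_compl_null] by auto
    ultimately have "{z \<in> V_core. fiber_coord z < a} \<union> (if 0 < a then V_flat \<alpha> - V_core else {}) \<in> \<K>" by (rule K.Un)
    also have "{z \<in> V_core. fiber_coord z < a} \<union> (if 0 < a then V_flat \<alpha> - V_core else {}) = {z \<in> space ?\<Sigma>. ?c z < a}"
      using V_core_subset unfolding space by auto
    finally show "{z \<in> space ?\<Sigma>. ?c z < a} \<in> sets ?\<Sigma>" unfolding sets .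
  qed
  moreover have fst: "fst \<in> borel_measurable ?\<Sigma>"
    by (rule measurableI) (use fst_vimage_approx in \<open>auto simp: sets space\<close>)
  \<comment> \<open>\<open>?h\<close> rebuilds a point from abscissa and fibre coordinate, so it is
    the identity on the core, and \<open>A\<close> differs from its \<open>?h\<close>-preimage only
    by a null set.\<close>
  let ?h = "\<lambda>z. (fst z, - ?c z - (if fst z < 0 then 1 else 0))"
  have "(\<lambda>z. - ?c z - (if fst z < 0 then 1 else 0)) \<in> borel_measurable ?\<Sigma>"
    using calculation fst by measurable
  with fst have "?h \<in> measurable ?\<Sigma> (borel \<Otimes>\<^sub>M borel)" by (rule measurable_Pair)
  then have "?h \<in> measurable ?\<Sigma> borel" unfolding borel_prod .
  from measurable_sets[OF this, of A] have hA: "?h -` A \<inter> V_flat \<alpha> \<in> \<K>"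
    using A by (simp add: sets space sets_mu_flat)
  have "?h z = z" if "z \<in> V_core" for z using that by (auto simp: fiber_coord_def prod_eq_iff)
  then have sub: "sym_diff A (?h -` A \<inter> V_flat \<alpha>) \<subseteq> V_flat \<alpha> - V_core"
    using A V_core_subset by (auto simp: sets_mu_flat)
  have "?h -` A \<inter> V_flat \<alpha> \<in> sets (mu_flat \<alpha>)" using hA by (simp add: approx_sets_def)
  then have "sym_diff A (?h -` A \<inter> V_flat \<alpha>) \<in> null_sets (mu_flat \<alpha>)"
    using A by (intro null_sets_subset[OF V_core_compl_null _ sub]) auto
  then show ?thesis by (rule approx_sets_modify[OF A hA _ join_subset])
qed

lemma natural_extension_mu_flat:
  "represents_natural_extension fst (mu_flat \<alpha>) F (nu_flat \<alpha>) (F_flat \<alpha>)"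
  unfolding represents_natural_extension_def
proof (intro conjI)
  show "nu_flat \<alpha> = distr (mu_flat \<alpha>) (nu_flat \<alpha>) fst"
    unfolding nu_flat_def by (intro distr_cong) auto
  show "eq_mod_null (mu_flat \<alpha>) (sets (mu_flat \<alpha>)) \<J>"
    unfolding eq_mod_null_def
  proof (intro conjI ballI)
    fix A assume "A \<in> sets (mu_flat \<alpha>)"
    then show "\<exists>B\<in>\<J>. sym_diff A B \<in> null_sets (mu_flat \<alpha>)" using sets_mu_flat_approx by (auto simp: approx_sets_def)
  next
    fix B assume "B \<in> \<J>"
    then show "\<exists>A\<in>sets (mu_flat \<alpha>). sym_diff A B \<in> null_sets (mu_flat \<alpha>)"
      using join_subset by (intro bexI[of _ B]) auto
  qed
qed (fact sigma_finite_mu_flat sigma_finite_nu_flat F_flat_measurable[OF \<alpha>_pos \<alpha>_half] bij_mod_null_Fhat_flat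
    invariant_measure_mu_flat AE_factor fst_measurable)+

end

theorem theorem2:
  fixes \<alpha> :: real
  assumes "0 < \<alpha>" and "\<alpha> < 1 / 2"
  shows "invariant_measure (mu_flat \<alpha>) (Fhat_flat \<alpha>) \<and>
         represents_natural_extension fst
           (mu_flat \<alpha>) (Fhat_flat \<alpha>) (nu_flat \<alpha>) (F_flat \<alpha>)"
proof -
  obtain E where "E \<in> sets borel" "E \<subseteq> Omega_star \<alpha> - exceptional_lines \<alpha>"
    "Omega_star \<alpha> - E \<in> null_sets mobius_measure" "bij_betw (Gstar \<alpha>) E E"
    using Gstar_bij_core[OF assms] .
  then interpret gstar_core \<alpha> E using assms by unfold_locales
  show ?thesis using invariant_measure_mu_flat natural_extension_mu_flat by blast
qed

end
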